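(* Let $k \ge 0$ be an integer. Then, as $n \to \infty$, $$ M_{2k}(n) = \pi \xi_{2k} (24 n-1)^{k - 3/4} I_{3/2}(y_{n}) + \widetilde{\xi}_{2k}\,(24n-1)^{k-5/4} I_{1/2}(y_{n}) + O\!\left(n^{k-7/4}\cdot n^{-1/4} \exp( y_{n}) \right), $$ where $y_{n}:= \frac{\pi}{6} \sqrt{24n-1}$, and the constants are $$\xi_{2k}:= (-1)^{k}\, 2\, B_{2k}(1/2), \qquad \widetilde{\xi}_{2k}:= -3 (2k)(2k-3)\, \xi_{2k}+ \xi_{2k}',$$ with $\xi_0':=0$ and, for $k>0$, $\xi'_{2k}:=-\frac14 (2k)(2k-1)\xi_{2k-2}$.
   Context: Define integers $\mathcal{M}(m,n)$ ($m\in\mathbb Z$, $n\ge 0$) by the generating function $\sum_{m\in\mathbb Z,\, n\ge0}\mathcal{M}(m,n)x^mq^n=\prod_{n\ge1}\frac{1-q^n}{(1-xq^n)(1-x^{-1}q^n)}$ (for $n\neq 1$, $\mathcal{M}(m,n)$ is the number of partitions of $n$ with crank $m$). The $2k$-th crank moment is $M_{2k}(n):=\sum_{m\in\mathbb Z} m^{2k}\mathcal{M}(m,n)$. $B_n(x)$ denotes the $n$-th Bernoulli polynomial, and $I_\nu$ denotes the modified Bessel function of the first kind of order $\nu$. The implied constant in the $O$-term may depend on $k$. *)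

theory Defs
  imports "HOL-Analysis.Analysis" "HOL-Library.Landau_Symbols"
    "HOL-Computational_Algebra.Formal_Laurent_Series"
begin

text \<open>
  The generating function is a formal power series in \<open>q\<close> whose coefficients are formal
  Laurent series in \<open>x\<close>. The coefficients of those are taken in a field, because inverses of
  formal series are only available there; the coefficients \<open>crank_coeff m n\<close> are in fact
  integers. The infinite product is the limit in the
  \<open>q\<close>-adic topology of formal power series.
\<close>

definition crank_factor :: "nat \<Rightarrow> real fls fps" where
  "crank_factor n =
     (1 - fps_X ^ n) /
     ((1 - fps_const fls_X * fps_X ^ n) * (1 - fps_const fls_X_inv * fps_X ^ n))"

definition crank_gf :: "real fls fps" where
  "crank_gf = (\<Prod>n. crank_factor (Suc n))"

definition crank_coeff :: "int \<Rightarrow> nat \<Rightarrow> real" where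
  "crank_coeff m n = fls_nth (fps_nth crank_gf n) m"

text \<open>
  Only finitely many \<open>m\<close> contribute. The convention \<open>0 ^ 0 = 1\<close> is needed for \<open>j = 0\<close>.
\<close>

definition crank_moment :: "nat \<Rightarrow> nat \<Rightarrow> real" where
  "crank_moment j n = (\<Sum>\<^sub>\<infinity>m\<in>UNIV. real_of_int m ^ j * crank_coeff m n)"

text \<open>Generating function: \<open>t * exp (x * t) / (exp t - 1)\<close> is the sum of \<open>B\<^sub>n(x) * t ^ n / n!\<close>.\<close>

definition bernoulli_poly :: "nat \<Rightarrow> real \<Rightarrow> real" where
  "bernoulli_poly n x = fact n * fps_nth (fps_X * fps_exp x / (fps_exp 1 - 1)) n"

text \<open>
  The modified Bessel function of the first kind. Because of \<open>powr\<close>, this is meant for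
  positive \<open>x\<close> only.
\<close>

definition bessel_I :: "real \<Rightarrow> real \<Rightarrow> real" where
  "bessel_I \<nu> x =
     (\<Sum>m. (x / 2) powr (2 * real m + \<nu>) * rGamma (real m + \<nu> + 1) / fact m)"

definition y_crank :: "nat \<Rightarrow> real" where
  "y_crank n = pi / 6 * sqrt (24 * real n - 1)"

text \<open>
  The argument \<open>k\<close> of the following three constants stands for the subscript \<open>2k\<close>.
\<close>

definition xi :: "nat \<Rightarrow> real" where
  "xi k = (-1) ^ k * 2 * bernoulli_poly (2 * k) (1 / 2)"

definition xi' :: "nat \<Rightarrow> real" where
  "xi' k = (if k = 0 then 0 else - (1 / 4) * (2 * real k) * (2 * real k - 1) * xi (k - 1))"

definition xi_tilde :: "nat \<Rightarrow> real" where
  "xi_tilde k = - 3 * (2 * real k) * (2 * real k - 3) * xi k + xi' k"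

end

theory Submission
  imports Defs "HOL-Complex_Analysis.Complex_Analysis" "HOL-Probability.Distributions"
    "HOL-Real_Asymp.Real_Asymp"
begin

text \<open>
  Circle method. For \<open>q = e\<^sup>-\<^sup>t\<close> and \<open>x = e\<^sup>w\<close> the generating function equals
  \<open>P(q) / \<Prod>\<^sub>n (1 - \<kappa> a\<^sub>n)\<close>, where \<open>P\<close> generates the partitions, \<open>\<kappa> = 4 sinh\<^sup>2 (w / 2)\<close> and
  \<open>a\<^sub>n = 1 / (4 sinh\<^sup>2 (n t / 2))\<close>. No modular transformation is needed: the trapezoidal rule
  applied to \<open>1 / sinh\<^sup>2 (u / 2) - 4 / u\<^sup>2\<close> gives \<open>\<Sum>\<^sub>n a\<^sub>n = \<pi>\<^sup>2 / (6 t\<^sup>2) - 1 / (2 t) + 1 / 24 + O(t)\<close> in the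
  sector \<open>\<bar>arg t\<bar> \<le> \<pi> / 4\<close>. With \<open>w = t s\<close>, comparison with the sine product then shows that
  \<open>\<Prod>\<^sub>n (1 - \<kappa> a\<^sub>n) = (sin \<pi>s / \<pi>s) (1 + t s\<^sup>2 / 2 + O(t\<^sup>2))\<close>. As \<open>(log P)' = - \<Sum>\<^sub>n a\<^sub>n\<close>, integration gives
  \<open>P\<close> up to a constant factor, and the case \<open>s = 1 / 2\<close>, where the product over \<open>n\<close> is a quotient of
  values of \<open>P\<close>, determines that factor.

  The coefficient of \<open>q\<^sup>n\<close> is an integral over \<open>t\<close> along the circular arc \<open>\<bar>t\<bar> = c\<close>,
  \<open>\<bar>arg t\<bar> \<le> \<pi> / 4\<close>, through the saddle point \<open>c\<close>, closed up by a vertical segment on which \<open>P\<close> is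
  exponentially smaller. The moments are Cauchy integrals over \<open>w\<close>; they pick out the Taylor
  coefficients of \<open>\<pi>s / sin \<pi>s\<close>, which are the numbers \<open>\<xi>\<close>. On the arc the exponent is \<open>y cos \<psi>\<close>, so
  the main term is a combination of integrals of \<open>cos (\<nu>\<psi>) exp (y cos \<psi>)\<close> with half-integral
  \<open>\<nu>\<close>, which satisfy the recurrence of the Bessel functions up to exponentially small terms.
\<close>

section \<open>The generating function as a convergent product\<close>

text \<open>The variable x enters only through (1 - x Q)(1 - Q / x) = (1 - Q)^2 - \<kappa> Q, so the
  scalar \<kappa> carries all dependence on w. The error term asks for two orders in t, which is of
  size n^(-1/2); hence every expansion is kept up to a relative O(t^2). The restriction |w| \<le> Re
  t / 2 makes each factor 1 - \<kappa> a_n differ from 1 by at most 1 / (4 n^2), whatever t is, so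
  the product is bounded below on the whole contour and not only near the saddle point. The angle pi
  / 4 is a compromise: the analysis near 1 needs a cone in which adding vectors never shortens them,
  while on the vertical segment, at distance c / sqrt 2 from the imaginary axis, a crude bound of
  log P must still stay below the saddle point value. It does so narrowly; 9/20, 11/8, 3/11 and
  19/20 are rational roundings that leave just enough room. The natural main terms have order 2k -
  3/2 and 2k - 5/2. The orders 3/2 and 1/2 are reached by comparing two terms of the expansions for
  large argument, and this mismatch produces the coefficient -3 (2k)(2k - 3).\<close>

definition laurent_poly :: "'a::zero fls \<Rightarrow> bool" where
  "laurent_poly f \<longleftrightarrow> finite {m. fls_nth f m \<noteq> 0}"

text \<open>A formal Laurent series may have infinitely many positive powers, so this is a ring
  homomorphism only on Laurent polynomials. Each coefficient of q^n in the generating function is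
  one, which is what the lemmas on \<open>fps_laurent_poly\<close> establish.\<close>

definition laurent_eval :: "complex \<Rightarrow> real fls \<Rightarrow> complex" where
  "laurent_eval x f = (\<Sum>m | fls_nth f m \<noteq> 0. of_real (fls_nth f m) * x powi m)"

definition fps_laurent_eval :: "complex \<Rightarrow> real fls fps \<Rightarrow> complex fps" where
  "fps_laurent_eval x F = Abs_fps (\<lambda>n. laurent_eval x (fps_nth F n))"

definition fps_laurent_poly :: "'a::zero fls fps \<Rightarrow> bool" where
  "fps_laurent_poly F \<longleftrightarrow> (\<forall>n. laurent_poly (fps_nth F n))"

lemma laurent_eval_superset:
  assumes "finite A" "\<And>m. fls_nth f m \<noteq> 0 \<Longrightarrow> m \<in> A"
  shows "laurent_eval x f = (\<Sum>m\<in>A. of_real (fls_nth f m) * x powi m)"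
  unfolding laurent_eval_def using assms by (intro sum.mono_neutral_left) auto

lemma laurent_poly_0 [simp]: "laurent_poly 0"
  and laurent_poly_1 [simp]: "laurent_poly (1 :: 'b::{zero,one} fls)"
  and laurent_poly_X [simp]: "laurent_poly (fls_X :: 'c::{zero,one} fls)"
  and laurent_poly_X_inv [simp]: "laurent_poly (fls_X_inv :: 'c::{zero,one} fls)"
  by (auto simp: laurent_poly_def intro: finite_subset[of _ "{-1,0,1}"] split: if_splits)

lemma laurent_poly_add: "laurent_poly f \<Longrightarrow> laurent_poly g \<Longrightarrow> laurent_poly (f + g)"
  for f g :: "'a::monoid_add fls"
  unfolding laurent_poly_def
  by (rule finite_subset[of _ "{m. fls_nth f m \<noteq> 0} \<union> {m. fls_nth g m \<noteq> 0}"]) auto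

lemma laurent_poly_uminus: "laurent_poly f \<Longrightarrow> laurent_poly (- f)"
  for f :: "'a::group_add fls"
  unfolding laurent_poly_def by simp

text \<open>The usual range of summation depends on both subdegrees; summing over the support of f
  turns the evaluation of a product into a finite double sum.\<close>

lemma fls_times_nth_superset:
  fixes f g :: "'a::semiring_0 fls"
  assumes "finite A" "\<And>m. fls_nth f m \<noteq> 0 \<Longrightarrow> m \<in> A"
  shows "fls_nth (f * g) n = (\<Sum>i\<in>A. fls_nth f i * fls_nth g (n - i))"
proof -
  let ?I = "{fls_subdegree f..n - fls_subdegree g}"
  have "fls_nth (f * g) n = (\<Sum>i\<in>?I. fls_nth f i * fls_nth g (n - i))"
    by (rule fls_times_nth)
  also have "\<dots> = (\<Sum>i\<in>?I \<union> A. fls_nth f i * fls_nth g (n - i))"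
    using assms(1) by (intro sum.mono_neutral_left) (auto simp: not_le intro: fls_eq0_below_subdegree)
  also have "\<dots> = (\<Sum>i\<in>A. fls_nth f i * fls_nth g (n - i))"
  proof (intro sum.mono_neutral_right ballI)
    fix i assume "i \<in> ?I \<union> A - A"
    hence "fls_nth f i = 0" using assms(2) by auto
    thus "fls_nth f i * fls_nth g (n - i) = 0" by simp
  qed (use assms in auto)
  finally show ?thesis .
qed

lemma fls_times_nth_nonzeroD:
  fixes f g :: "'a::semiring_0 fls"
  assumes "laurent_poly f" "fls_nth (f * g) n \<noteq> 0"
  shows "n \<in> (\<lambda>(i,j). i + j) ` ({m. fls_nth f m \<noteq> 0} \<times> {m. fls_nth g m \<noteq> 0})"
proof -
  have "(\<Sum>i | fls_nth f i \<noteq> 0. fls_nth f i * fls_nth g (n - i)) \<noteq> 0"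
    using assms by (subst (asm) fls_times_nth_superset[of "{m. fls_nth f m \<noteq> 0}"])
      (auto simp: laurent_poly_def)
  then obtain i where "fls_nth f i * fls_nth g (n - i) \<noteq> 0" by (rule sum.not_neutral_contains_not_neutral)
  hence "fls_nth f i \<noteq> 0" "fls_nth g (n - i) \<noteq> 0" by auto
  thus ?thesis by (intro image_eqI[of _ _ "(i, n - i)"]) auto
qed

lemma laurent_poly_mult:
  fixes f g :: "'a::semiring_0 fls"
  assumes "laurent_poly f" "laurent_poly g"
  shows "laurent_poly (f * g)"
  unfolding laurent_poly_def
  by (rule finite_subset[OF subsetI, OF fls_times_nth_nonzeroD[OF assms(1)]])
     (use assms in \<open>auto simp: laurent_poly_def\<close>)

lemma laurent_poly_sum:
  "(\<And>i. i \<in> A \<Longrightarrow> laurent_poly (f i)) \<Longrightarrow> laurent_poly (\<Sum>i\<in>A. f i :: 'a::comm_monoid_add fls)"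
  by (induction A rule: infinite_finite_induct) (auto intro: laurent_poly_add)

lemma laurent_eval_0 [simp]: "laurent_eval x 0 = 0"
  and laurent_eval_1 [simp]: "laurent_eval x 1 = 1"
  and laurent_eval_X [simp]: "laurent_eval x fls_X = x"
  and laurent_eval_X_inv [simp]: "laurent_eval x fls_X_inv = inverse x"
  by (simp_all add: laurent_eval_def power_int_minus)

lemma laurent_eval_add:
  assumes "laurent_poly f" "laurent_poly g"
  shows "laurent_eval x (f + g) = laurent_eval x f + laurent_eval x g"
proof -
  let ?A = "{m. fls_nth f m \<noteq> 0} \<union> {m. fls_nth g m \<noteq> 0}"
  have fin: "finite ?A" using assms by (auto simp: laurent_poly_def)
  show ?thesis
    by (subst (1 2 3) laurent_eval_superset[OF fin]) (auto simp: sum.distrib ring_distribs)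
qed

lemma laurent_eval_uminus: "laurent_eval x (- f) = - laurent_eval x f"
  by (simp add: laurent_eval_def sum_negf)

lemma laurent_eval_mult:
  assumes "laurent_poly f" "laurent_poly g" "x \<noteq> 0"
  shows "laurent_eval x (f * g) = laurent_eval x f * laurent_eval x g"
proof -
  let ?F = "{m. fls_nth f m \<noteq> 0}" and ?G = "{m. fls_nth g m \<noteq> 0}"
  let ?U = "(\<lambda>(i,j). i + j) ` (?F \<times> ?G)"
  have fin: "finite ?F" "finite ?G" "finite ?U" using assms by (auto simp: laurent_poly_def)
  have "laurent_eval x (f * g) = (\<Sum>n\<in>?U. of_real (fls_nth (f * g) n) * x powi n)"
    using fls_times_nth_nonzeroD[OF assms(1)] by (intro laurent_eval_superset fin) 
  also have "\<dots> = (\<Sum>n\<in>?U. \<Sum>i\<in>?F. of_real (fls_nth f i * fls_nth g (n - i)) * x powi n)"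
    using fin by (simp add: fls_times_nth_superset[of ?F] sum_distrib_right)
  also have "\<dots> = (\<Sum>i\<in>?F. \<Sum>n\<in>?U. of_real (fls_nth f i * fls_nth g (n - i)) * x powi n)"
    by (rule sum.swap)
  also have "\<dots> = (\<Sum>i\<in>?F. of_real (fls_nth f i) * x powi i * laurent_eval x g)"
  proof (rule sum.cong, goal_cases)
    case (2 i)
    have "(\<Sum>n\<in>?U. of_real (fls_nth f i * fls_nth g (n - i)) * x powi n) =
          (\<Sum>n\<in>(\<lambda>j. i + j) ` ?G. of_real (fls_nth f i * fls_nth g (n - i)) * x powi n)"
    proof (rule sum.mono_neutral_right)
      have "n \<in> (+) i ` {m. fls_nth g m \<noteq> 0}" if "fls_nth g (n - i) \<noteq> 0" for n
        using that by (intro image_eqI[of _ _ "n - i"]) auto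
      thus "\<forall>n\<in>?U - (+) i ` ?G. of_real (fls_nth f i * fls_nth g (n - i)) * x powi n = 0"
        by auto
      show "(+) i ` ?G \<subseteq> ?U" using 2 by auto
    qed (use fin in auto)
    also have "\<dots> = (\<Sum>j\<in>?G. of_real (fls_nth f i * fls_nth g j) * x powi (i + j))"
      by (subst sum.reindex) auto
    also have "\<dots> = of_real (fls_nth f i) * x powi i * laurent_eval x g"
      using assms(3) by (simp add: laurent_eval_def sum_distrib_left power_int_add mult_ac)
    finally show ?case .
  qed auto
  also have "\<dots> = laurent_eval x f * laurent_eval x g"
    by (simp add: laurent_eval_def sum_distrib_right)
  finally show ?thesis .
qed

lemma laurent_eval_sum:
  "(\<And>i. i \<in> A \<Longrightarrow> laurent_poly (f i)) \<Longrightarrow>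
    laurent_eval x (\<Sum>i\<in>A. f i) = (\<Sum>i\<in>A. laurent_eval x (f i))"
  by (induction A rule: infinite_finite_induct) (auto simp: laurent_eval_add laurent_poly_sum)

lemma fps_laurent_poly_mult:
  "fps_laurent_poly F \<Longrightarrow> fps_laurent_poly G \<Longrightarrow> fps_laurent_poly (F * G)"
  for F G :: "'a::semiring_0 fls fps"
  by (auto simp: fps_laurent_poly_def fps_mult_nth intro!: laurent_poly_sum laurent_poly_mult)

lemma fps_laurent_eval_mult:
  assumes "fps_laurent_poly F" "fps_laurent_poly G" "x \<noteq> 0"
  shows "fps_laurent_eval x (F * G) = fps_laurent_eval x F * fps_laurent_eval x G"
  using assms by (intro fps_ext)
    (auto simp: fps_laurent_eval_def fps_mult_nth laurent_eval_sum laurent_eval_mult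
        fps_laurent_poly_def laurent_poly_mult)

lemma fps_laurent_poly_diff:
  "fps_laurent_poly F \<Longrightarrow> fps_laurent_poly G \<Longrightarrow> fps_laurent_poly (F - G)"
  for F G :: "'a::ring fls fps"
  using laurent_poly_add[OF _ laurent_poly_uminus] 
  by (fastforce simp: fps_laurent_poly_def)

lemma fps_laurent_eval_diff:
  assumes "fps_laurent_poly F" "fps_laurent_poly G"
  shows "fps_laurent_eval x (F - G) = fps_laurent_eval x F - fps_laurent_eval x G"
  using assms laurent_eval_add[OF _ laurent_poly_uminus]
  by (intro fps_ext) (auto simp: fps_laurent_eval_def fps_laurent_poly_def laurent_eval_uminus)

lemma fps_laurent_poly_const_X [simp]:
  "fps_laurent_poly (fps_X ^ n :: 'a::comm_ring_1 fls fps)"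
  "fps_laurent_poly (1 :: 'a::comm_ring_1 fls fps)"
  "laurent_poly f \<Longrightarrow> fps_laurent_poly (fps_const f)"
  by (auto simp: fps_laurent_poly_def)

lemma fps_laurent_eval_const_X [simp]:
  "fps_laurent_eval x (fps_X ^ n) = fps_X ^ n"
  "fps_laurent_eval x 1 = 1"
  "fps_laurent_eval x (fps_const f) = fps_const (laurent_eval x f)"
  by (auto intro!: fps_ext simp: fps_laurent_eval_def)

text \<open>The recursion for the coefficients of the inverse divides by the constant coefficient
  only. As this is 1, no division of Laurent series takes place and finite supports are
  preserved.\<close>

lemma fps_laurent_poly_inverse:
  fixes F :: "'a::field fls fps"
  assumes "fps_laurent_poly F" "fps_nth F 0 = 1"
  shows "fps_laurent_poly (inverse F)"
proof -
  have "laurent_poly (fps_nth (inverse F) n)" for n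
  proof (induction n rule: less_induct)
    case (less n)
    show ?case
    proof (cases "n = 0")
      case False
      have "fps_nth (inverse F) n = - (\<Sum>i = 1..n. fps_nth F i * fps_nth (inverse F) (n - i))"
        using False assms(2) by (cases n) (simp_all add: fps_inverse_def)
      thus ?thesis using less assms(1)
        by (auto intro!: laurent_poly_uminus laurent_poly_sum laurent_poly_mult simp: fps_laurent_poly_def)
    qed (simp add: assms(2))
  qed
  thus ?thesis by (simp add: fps_laurent_poly_def)
qed

lemma fps_laurent_poly_prod:
  "(\<And>i. i \<in> A \<Longrightarrow> fps_laurent_poly (F i)) \<Longrightarrow> fps_laurent_poly (\<Prod>i\<in>A. F i :: 'a::comm_ring_1 fls fps)"
  by (induction A rule: infinite_finite_induct) (auto simp: fps_laurent_poly_mult)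

lemma fps_laurent_eval_prod:
  "(\<And>i. i \<in> A \<Longrightarrow> fps_laurent_poly (F i)) \<Longrightarrow> x \<noteq> 0 \<Longrightarrow>
    fps_laurent_eval x (\<Prod>i\<in>A. F i) = (\<Prod>i\<in>A. fps_laurent_eval x (F i))"
  by (induction A rule: infinite_finite_induct) (auto simp: fps_laurent_eval_mult fps_laurent_poly_prod)

section \<open>The infinite product and its partial products\<close>

definition crank_factor_at :: "'a::field \<Rightarrow> nat \<Rightarrow> 'a fps" where
  "crank_factor_at x n =
     (1 - fps_X ^ n) / ((1 - fps_const x * fps_X ^ n) * (1 - fps_const (inverse x) * fps_X ^ n))"

lemma crank_factor_eq:
  assumes "n > 0"
  shows "crank_factor n * ((1 - fps_const fls_X * fps_X ^ n) * (1 - fps_const fls_X_inv * fps_X ^ n))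
          = 1 - fps_X ^ n"
    and "fps_laurent_poly (crank_factor n)"
proof -
  let ?D = "(1 - fps_const fls_X * fps_X ^ n) * (1 - fps_const fls_X_inv * fps_X ^ n) :: real fls fps"
  have D0: "fps_nth ?D 0 = 1" 
    unfolding fps_mult_nth_0 using assms by (simp add: fps_X_power_nth)
  have D: "fps_laurent_poly ?D"
    by (intro fps_laurent_poly_mult fps_laurent_poly_diff) auto
  have eq: "crank_factor n = (1 - fps_X ^ n) * inverse ?D"
    unfolding crank_factor_def by (rule fps_divide_unit, subst D0) simp
  show "crank_factor n * ?D = 1 - fps_X ^ n"
    unfolding eq mult.assoc by (subst inverse_mult_eq_1, subst D0, simp_all)
  show "fps_laurent_poly (crank_factor n)"
    unfolding eq by (intro fps_laurent_poly_mult fps_laurent_poly_diff fps_laurent_poly_inverse D D0) auto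
qed

text \<open>Evaluation is known to respect products, not quotients, so the defining equation of the
  factor is used in multiplied form and the nonzero denominator is cancelled afterwards.\<close>

lemma fps_laurent_eval_crank_factor:
  assumes "n > 0" "x \<noteq> 0"
  shows "fps_laurent_eval x (crank_factor n) = crank_factor_at x n"
proof -
  let ?D = "(1 - fps_const fls_X * fps_X ^ n) * (1 - fps_const fls_X_inv * fps_X ^ n) :: real fls fps"
  let ?E = "(1 - fps_const x * fps_X ^ n) * (1 - fps_const (inverse x) * fps_X ^ n)"
  have poly: "fps_laurent_poly (1 - fps_const fls_X * fps_X ^ n :: real fls fps)"
             "fps_laurent_poly (1 - fps_const fls_X_inv * fps_X ^ n :: real fls fps)"
    by (auto intro!: fps_laurent_poly_mult fps_laurent_poly_diff)
  have "fps_laurent_eval x (crank_factor n) * fps_laurent_eval x ?D = fps_laurent_eval x (1 - fps_X ^ n)"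
    using crank_factor_eq[OF assms(1)] poly assms(2)
    by (simp flip: fps_laurent_eval_mult add: fps_laurent_poly_mult)
  also have "fps_laurent_eval x (1 - fps_X ^ n) = 1 - fps_X ^ n"
    by (simp add: fps_laurent_eval_diff)
  also have "fps_laurent_eval x ?D = ?E"
    using assms(2) by (simp add: poly fps_laurent_eval_mult fps_laurent_eval_diff fps_laurent_poly_mult)
  finally have "fps_laurent_eval x (crank_factor n) * ?E = 1 - fps_X ^ n" .
  moreover have "fps_nth ?E 0 = 1" using assms by simp
  hence "?E \<noteq> 0" by force
  ultimately show ?thesis unfolding crank_factor_at_def
    by (metis nonzero_mult_div_cancel_right)
qed

lemma fps_nth_mult_eq_left:
  fixes F G :: "'a::comm_ring_1 fps"
  assumes "\<And>i. 0 < i \<Longrightarrow> i \<le> n \<Longrightarrow> fps_nth G i = 0" "fps_nth G 0 = 1"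
  shows "fps_nth (F * G) n = fps_nth F n"
proof -
  have "fps_nth (F * G) n = (\<Sum>i=0..n. fps_nth F i * fps_nth G (n - i))"
    by (simp add: fps_mult_nth)
  also have "\<dots> = (\<Sum>i\<in>{n}. fps_nth F i * fps_nth G (n - i))"
    using assms by (intro sum.mono_neutral_right) auto
  finally show ?thesis using assms by simp
qed

text \<open>This makes the partial products stabilise coefficient by coefficient.\<close>

lemma crank_factor_nth:
  assumes "n > 0"
  shows "fps_nth (crank_factor n) 0 = 1" "\<And>i. 0 < i \<Longrightarrow> i < n \<Longrightarrow> fps_nth (crank_factor n) i = 0"
proof -
  let ?D = "(1 - fps_const fls_X * fps_X ^ n) * (1 - fps_const fls_X_inv * fps_X ^ n) :: real fls fps"
  have D: "fps_nth ?D i = (if i = 0 then 1 else 0)" if "i < n" for i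
  proof -
    have "?D = 1 - fps_const fls_X * fps_X ^ n - fps_const fls_X_inv * fps_X ^ n
             + fps_const (fls_X * fls_X_inv) * fps_X ^ (n + n)"
      by (simp add: algebra_simps power_add flip: fps_const_mult)
    show ?thesis using that unfolding \<open>?D = _\<close> fps_sub_nth fps_add_nth 
      by (simp add: fps_X_power_mult_right_nth fps_X_power_nth)
  qed
  have *: "fps_nth (crank_factor n) i = fps_nth (1 - fps_X ^ n) i" if "i < n" for i
    using D that assms unfolding crank_factor_eq(1)[OF assms, symmetric]
    by (intro fps_nth_mult_eq_left[symmetric]) auto
  show "fps_nth (crank_factor n) 0 = 1" "\<And>i. 0 < i \<Longrightarrow> i < n \<Longrightarrow> fps_nth (crank_factor n) i = 0"
    using assms by (auto simp: *)
qed

lemma crank_partial_prod_stable: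
  assumes "n \<le> N"
  shows "fps_nth (\<Prod>j<N. crank_factor (Suc j)) n = fps_nth (\<Prod>j<n. crank_factor (Suc j)) n"
  using assms
proof (induction N rule: dec_induct)
  case (step N)
  thus ?case by (simp add: fps_nth_mult_eq_left crank_factor_nth)
qed auto

lemma crank_gf_nth:
  assumes "n \<le> N"
  shows "fps_nth crank_gf n = fps_nth (\<Prod>j<N. crank_factor (Suc j)) n"
proof -
  define g where "g = Abs_fps (\<lambda>n. fps_nth (\<Prod>j<n. crank_factor (Suc j)) n)"
  have "(\<lambda>N. \<Prod>j\<le>N. crank_factor (Suc j)) \<longlonglongrightarrow> g"
    unfolding tendsto_fps_iff
  proof safe
    fix n :: nat
    show "\<forall>\<^sub>F N in sequentially. fps_nth (\<Prod>j\<le>N. crank_factor (Suc j)) n = fps_nth g n"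
      using eventually_ge_at_top[of n]
    proof eventually_elim
      case (elim N)
      thus ?case using crank_partial_prod_stable[of n "Suc N"]
        by (simp add: g_def lessThan_Suc_atMost del: prod.lessThan_Suc)
    qed
  qed
  \<comment> \<open>\<open>has_prod\<close> asks for a nonzero limit; the constant coefficient 1
    provides it.\<close>
  moreover have "fps_nth g 0 = 1" by (simp add: g_def)
  hence "g \<noteq> 0" by force
  ultimately have "(\<lambda>j. crank_factor (Suc j)) has_prod g"
    by (auto simp: has_prod_def raw_has_prod_def)
  hence eq: "crank_gf = g" unfolding crank_gf_def by (rule has_prod_unique[symmetric])
  show ?thesis unfolding crank_partial_prod_stable[OF assms] eq by (simp add: g_def)
qed

lemma finite_crank_coeff: "finite {m. crank_coeff m n \<noteq> 0}"
proof -
  have "fps_laurent_poly (\<Prod>j<n. crank_factor (Suc j))"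
    by (intro fps_laurent_poly_prod crank_factor_eq) auto
  thus ?thesis using crank_gf_nth[of n n]
    by (simp add: crank_coeff_def fps_laurent_poly_def laurent_poly_def)
qed

text \<open>The coefficient of q^n after the substitution x = exp w. It is entire in w, and its j-th
  Taylor coefficient at 0 is the j-th moment divided by j!.\<close>

definition crank_exp_sum :: "nat \<Rightarrow> complex \<Rightarrow> complex" where
  "crank_exp_sum n w = (\<Sum>m | crank_coeff m n \<noteq> 0. of_real (crank_coeff m n) * exp (of_int m * w))"

lemma crank_exp_sum_eq:
  assumes "n \<le> N"
  shows "crank_exp_sum n w = fps_nth (\<Prod>j<N. crank_factor_at (exp w) (Suc j)) n"
proof -
  have "crank_exp_sum n w = fps_nth (fps_laurent_eval (exp w) (\<Prod>j<N. crank_factor (Suc j))) n"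
    using assms 
    by (simp add: crank_exp_sum_def fps_laurent_eval_def laurent_eval_def crank_coeff_def
        crank_gf_nth exp_power_int)
  also have "fps_laurent_eval (exp w) (\<Prod>j<N. crank_factor (Suc j)) = 
        (\<Prod>j<N. crank_factor_at (exp w) (Suc j))"
    by (subst fps_laurent_eval_prod) (auto simp: crank_factor_eq fps_laurent_eval_crank_factor)
  finally show ?thesis .
qed

lemma crank_moment_eq:
  "crank_moment j n = (\<Sum>m | crank_coeff m n \<noteq> 0. real_of_int m ^ j * crank_coeff m n)"
proof -
  have "crank_moment j n = (\<Sum>\<^sub>\<infinity>m\<in>{m. crank_coeff m n \<noteq> 0}. real_of_int m ^ j * crank_coeff m n)"
    unfolding crank_moment_def by (rule infsum_cong_neutral) auto
  thus ?thesis using finite_crank_coeff by simp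
qed

section \<open>Regularised hyperbolic functions\<close>

lemma norm_sinh_ge:
  assumes "Re z \<ge> 0"
  shows "norm (sinh z) \<ge> sinh (Re z)"
proof -
  have "exp (Re z) - exp (- Re z) = norm (exp z) - norm (exp (-z))" by (simp add: norm_exp_eq_Re)
  also have "\<dots> \<le> norm (exp z - exp (-z))" by (rule norm_triangle_ineq2)
  finally show ?thesis by (simp add: sinh_def)
qed

lemma sinh_ge_self:
  assumes "x \<ge> (0::real)"
  shows "sinh x \<ge> x"
proof -
  have "sinh 0 - 0 \<le> sinh x - x"
  proof (rule DERIV_nonneg_imp_nondecreasing[OF assms])
    fix y :: real
    show "\<exists>d. ((\<lambda>x. sinh x - x) has_real_derivative d) (at y) \<and> 0 \<le> d"
      by (rule exI[of _ "cosh y - 1"]) (auto intro!: derivative_eq_intros simp: cosh_real_ge_1)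
  qed
  thus ?thesis by simp
qed

lemma sinh_eq_0_iff_complex: "sinh z = 0 \<longleftrightarrow> (\<exists>n::int. z = of_int n * (of_real pi * \<i>))"
proof -
  have "sinh z = 0 \<longleftrightarrow> exp z = exp (-z)" by (simp add: sinh_def)
  also have "\<dots> \<longleftrightarrow> (\<exists>n::int. z = -z + (of_int (2 * n) * pi) * \<i>)" by (rule exp_eq)
  also have "\<dots> \<longleftrightarrow> (\<exists>n::int. z = of_int n * (of_real pi * \<i>))"
    by (intro ex_cong1) (auto simp: complex_eq_iff)
  finally show ?thesis .
qed

text \<open>The cone |arg u| \<le> pi / 4. It is closed under sums and nonnegative scaling, so the
  points n t and the segments between them never leave it.\<close>

definition sector :: "complex set" where "sector = {u. \<bar>Im u\<bar> \<le> Re u}"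

lemma sectorD: 
  assumes "u \<in> sector"
  shows "Re u \<ge> 0" "norm u ^ 2 \<le> 2 * Re u ^ 2" "Re u \<le> norm u" "7/10 * norm u \<le> Re u"
proof -
  show *: "Re u \<ge> 0" using assms by (auto simp: sector_def)
  have "Im u ^ 2 \<le> Re u ^ 2" using assms power_mono[of "\<bar>Im u\<bar>" "Re u" 2] by (auto simp: sector_def)
  thus **: "norm u ^ 2 \<le> 2 * Re u ^ 2" by (simp add: cmod_power2)
  show "Re u \<le> norm u" by (rule complex_Re_le_cmod)
  \<comment> \<open>7/10 is a rational number below 1 / sqrt 2: its square 49/100 is below
    1/2.\<close>
  have "(7/10 * norm u) ^ 2 = 49/100 * norm u ^ 2" by (simp add: power_mult_distrib power_divide)
  also have "\<dots> \<le> Re u ^ 2" using ** zero_le_power2[of "Re u"] by linarith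
  finally have "(7/10 * norm u) ^ 2 \<le> Re u ^ 2" .
  thus "7/10 * norm u \<le> Re u" using * by (rule power2_le_imp_le)
qed

lemma sector_Re_pos: "u \<in> sector \<Longrightarrow> u \<noteq> 0 \<Longrightarrow> Re u > 0"
  by (auto simp: sector_def complex_eq_iff)

lemma sector_add: "u \<in> sector \<Longrightarrow> v \<in> sector \<Longrightarrow> u + v \<in> sector"
  by (auto simp: sector_def)

lemma sector_scaleR: "u \<in> sector \<Longrightarrow> c \<ge> 0 \<Longrightarrow> of_real c * u \<in> sector"
  by (auto simp: sector_def abs_mult mult_left_mono)

lemma sector_of_nat: "u \<in> sector \<Longrightarrow> of_nat n * u \<in> sector"
  using sector_scaleR[of u "real n"] by simp

text \<open>Two vectors of the cone enclose an angle of at most pi / 2, so their inner product is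
  nonnegative.\<close>

lemma norm_add_sector_ge:
  assumes "u \<in> sector" "v \<in> sector"
  shows "norm u \<le> norm (u + v)"
proof (rule power2_le_imp_le)
  have "\<bar>Im u\<bar> * \<bar>Im v\<bar> \<le> Re u * Re v"
    using assms by (intro mult_mono) (auto simp: sector_def)
  hence "Re u * Re v + Im u * Im v \<ge> 0"
    using abs_ge_minus_self[of "Im u * Im v"] by (simp add: abs_mult)
  moreover have "norm (u + v) ^ 2 = norm u ^ 2 + 2 * (Re u * Re v) + 2 * (Im u * Im v) + norm v ^ 2"
    unfolding cmod_power2 by (simp add: power2_sum)
  ultimately show "norm u ^ 2 \<le> norm (u + v) ^ 2" using zero_le_power2[of "norm v"] by linarith
qed auto

text \<open>\<open>coth_reg u = 4 / u - 2 coth (u / 2)\<close>, extended over the removable singularity at 0.\<close>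

definition sinhc :: "complex \<Rightarrow> complex" where
  "sinhc u = (if u = 0 then 1 / 2 else sinh (u / 2) / u)"

definition coth_num :: "complex \<Rightarrow> complex" where
  "coth_num u = 4 - 2 * cosh (u / 2) / sinhc u"

definition coth_reg :: "complex \<Rightarrow> complex" where
  "coth_reg u = (if u = 0 then deriv coth_num 0 else coth_num u / u)"

text \<open>The zeros of sinh (u / 2) nearest to 0, apart from 0 itself, are 2 pi i and -2 pi i, and
  6 < 2 pi. The disc leaves room for unit discs around the points of the sector close to 0.\<close>

definition reg_dom :: "complex set" where "reg_dom = {u. Re u > 0} \<union> ball 0 6"

lemma open_reg_dom [simp]: "open reg_dom"
  by (auto simp: reg_dom_def open_halfspace_Re_gt)

lemma zero_in_reg_dom [simp]: "0 \<in> reg_dom"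
  by (simp add: reg_dom_def)

lemma sinh_half_nonzero:
  assumes "u \<in> reg_dom" "u \<noteq> 0"
  shows "sinh (u / 2) \<noteq> 0"
proof
  assume "sinh (u / 2) = 0"
  then obtain n :: int where n: "u / 2 = of_int n * (of_real pi * \<i>)"
    unfolding sinh_eq_0_iff_complex by blast
  hence u: "u = 2 * of_int n * (of_real pi * \<i>)" by simp
  have "Re u = 0" by (simp add: u)
  hence "norm u < 6" using assms by (auto simp: reg_dom_def)
  moreover have "norm u = 2 * pi * \<bar>of_int n\<bar>" by (simp add: u norm_mult)
  moreover have "n \<noteq> 0" using u assms by auto
  hence "\<bar>real_of_int n\<bar> \<ge> 1" by linarith
  hence "2 * pi * 1 \<le> 2 * pi * \<bar>of_int n\<bar>" by (intro mult_left_mono) auto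
  ultimately show False using pi_gt3 by linarith
qed

lemma sinhc_holomorphic: "sinhc holomorphic_on UNIV"
proof -
  have "deriv (\<lambda>u::complex. sinh (u / 2)) 0 = 1 / 2"
    by (rule DERIV_imp_deriv) (auto intro!: derivative_eq_intros)
  hence "sinhc = (\<lambda>z. if z = 0 then deriv (\<lambda>u::complex. sinh (u / 2)) 0
      else (sinh (z / 2) - sinh (0 / 2)) / (z - 0))"
    by (auto simp: sinhc_def fun_eq_iff)
  moreover have "\<dots> holomorphic_on UNIV"
    by (rule pole_lemma) (auto simp: sinh_def intro!: holomorphic_intros)
  ultimately show ?thesis by simp
qed

lemma coth_num_holomorphic: "coth_num holomorphic_on reg_dom"
proof -
  have "sinhc u \<noteq> 0" if "u \<in> reg_dom" for u
    using sinh_half_nonzero[OF that] by (auto simp: sinhc_def)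
  thus ?thesis unfolding coth_num_def cosh_def scaleR_conv_of_real
    by (intro holomorphic_intros holomorphic_on_subset[OF sinhc_holomorphic]) auto
qed

lemma coth_reg_holomorphic: "coth_reg holomorphic_on reg_dom"
proof -
  \<comment> \<open>\<open>coth_num 0\<close> is 4 - 2 / (1/2) = 0, so \<open>coth_reg\<close> is a
    difference quotient at 0 and \<open>pole_lemma\<close> applies a second time.\<close>
  have "coth_reg = (\<lambda>z. if z = 0 then deriv coth_num 0 else (coth_num z - coth_num 0) / (z - 0))"
    by (auto simp: coth_reg_def fun_eq_iff coth_num_def sinhc_def)
  moreover have "\<dots> holomorphic_on reg_dom"
    by (rule pole_lemma[OF coth_num_holomorphic])
       (use open_reg_dom in \<open>auto simp: interior_open reg_dom_def simp del: open_reg_dom\<close>)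
  ultimately show ?thesis by simp
qed

text \<open>Taken as a derivative so that \<open>coth_reg\<close> is an antiderivative by
  construction: sums of \<open>csch_reg\<close> are compared with telescoping differences of
  \<open>coth_reg\<close>.\<close>

definition csch_reg :: "complex \<Rightarrow> complex" where "csch_reg = deriv coth_reg"

lemma csch_reg_holomorphic: "csch_reg holomorphic_on reg_dom"
  unfolding csch_reg_def by (intro holomorphic_deriv coth_reg_holomorphic) auto

lemma coth_reg_eq: "u \<in> reg_dom \<Longrightarrow> u \<noteq> 0 \<Longrightarrow> coth_reg u = 4 / u - 2 * cosh (u / 2) / sinh (u / 2)"
  using sinh_half_nonzero[of u] by (simp add: coth_reg_def coth_num_def sinhc_def field_simps)

lemma csch_reg_eq:
  assumes "u \<in> reg_dom" "u \<noteq> 0"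
  shows "csch_reg u = 1 / sinh (u / 2) ^ 2 - 4 / u ^ 2"
proof -
  have "((\<lambda>u. 4 / u - 2 * cosh (u / 2) / sinh (u / 2)) has_field_derivative
         - 4 / u ^ 2 - (sinh (u / 2) ^ 2 - cosh (u / 2) ^ 2) / sinh (u / 2) ^ 2) (at u)"
    using sinh_half_nonzero[OF assms] assms
    by (auto intro!: derivative_eq_intros simp: field_simps power2_eq_square)
  hence "(coth_reg has_field_derivative
         - 4 / u ^ 2 - (sinh (u / 2) ^ 2 - cosh (u / 2) ^ 2) / sinh (u / 2) ^ 2) (at u)"
  proof (rule has_field_derivative_transform_within_open)
    show "open (reg_dom - {0})" by auto
  qed (use assms coth_reg_eq in auto)
  hence "csch_reg u = - 4 / u ^ 2 - (sinh (u / 2) ^ 2 - cosh (u / 2) ^ 2) / sinh (u / 2) ^ 2"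
    unfolding csch_reg_def by (rule DERIV_imp_deriv)
  also have "sinh (u / 2) ^ 2 - cosh (u / 2) ^ 2 = - 1" by (simp add: cosh_square_eq)
  finally show ?thesis by simp
qed

text \<open>Gives the value of a regularised function at its removable singularity from a one-sided
  real limit, which can be computed automatically.\<close>

lemma tendsto_real_axis:
  fixes f :: "complex \<Rightarrow> complex"
  assumes "isCont f 0" "(g \<longlongrightarrow> l) (at_right (0::real))" 
    "eventually (\<lambda>x. f (of_real x) = of_real (g x)) (at_right 0)"
  shows "f 0 = of_real l"
proof (rule tendsto_unique)
  show "((\<lambda>x. f (of_real x)) \<longlongrightarrow> f 0) (at_right (0::real))"
    using assms(1) by (intro isCont_tendsto_compose[of _ f] tendsto_eq_intros) auto
  have "((\<lambda>x. complex_of_real (g x)) \<longlongrightarrow> of_real l) (at_right 0)"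
    by (intro tendsto_intros assms)
  thus "((\<lambda>x. f (of_real x)) \<longlongrightarrow> of_real l) (at_right (0::real))"
    by (rule Lim_transform_eventually) (use assms(3) in \<open>auto elim: eventually_mono\<close>)
qed auto

lemma sinh_of_real_complex: "sinh (complex_of_real x) = of_real (sinh x)"
  and cosh_of_real_complex: "cosh (complex_of_real x) = of_real (cosh x)"
  by (simp_all add: sinh_def cosh_def exp_of_real scaleR_conv_of_real flip: of_real_minus)

lemma coth_reg_0: "coth_reg 0 = 0"
proof -
  have lim: "((\<lambda>x::real. 4 / x - 2 * cosh (x / 2) / sinh (x / 2)) \<longlongrightarrow> 0) (at_right 0)"
    by real_asymp
  have "coth_reg 0 = of_real 0"
  proof (rule tendsto_real_axis[OF _ lim])
    have "continuous_on reg_dom coth_reg" using coth_reg_holomorphic by (rule holomorphic_on_imp_continuous_on)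
    thus "isCont coth_reg 0" using zero_in_reg_dom by (simp add: continuous_on_eq_continuous_at)
    have "coth_reg (of_real x) = of_real (4 / x - 2 * cosh (x / 2) / sinh (x / 2))" if "x > 0" for x
      using that by (subst coth_reg_eq)
        (auto simp: reg_dom_def sinh_of_real_complex[symmetric] cosh_of_real_complex[symmetric])
    thus "\<forall>\<^sub>F x in at_right 0. coth_reg (of_real x) = of_real (4 / x - 2 * cosh (x / 2) / sinh (x / 2))"
      by (auto simp: eventually_at_filter)
  qed
  thus ?thesis by simp
qed

text \<open>This value is the origin of the 1/24 in the sum of the a_n: the trapezoidal rule weights
  the endpoint 0 by one half, and the resulting 1/6 is divided by 4 later.\<close>

lemma csch_reg_0: "csch_reg 0 = - 1 / 3"
proof -
  have "((\<lambda>x::real. 4 / (exp (x/2) - exp (-x/2)) ^ 2 - 4 / x ^ 2) \<longlongrightarrow> - (1 / 3)) (at_right 0)"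
    by real_asymp
  hence lim: "((\<lambda>x::real. 1 / sinh (x / 2) ^ 2 - 4 / x ^ 2) \<longlongrightarrow> - (1 / 3)) (at_right 0)"
    by (simp add: sinh_field_def power_divide)
  have "csch_reg 0 = of_real (- (1 / 3))"
  proof (rule tendsto_real_axis[OF _ lim])
    have "continuous_on reg_dom csch_reg" using csch_reg_holomorphic by (rule holomorphic_on_imp_continuous_on)
    thus "isCont csch_reg 0" using zero_in_reg_dom by (simp add: continuous_on_eq_continuous_at)
    have "csch_reg (of_real x) = of_real (1 / sinh (x / 2) ^ 2 - 4 / x ^ 2)" if "x > 0" for x
      using that by (subst csch_reg_eq)
        (auto simp: reg_dom_def sinh_of_real_complex[symmetric])
    thus "\<forall>\<^sub>F x in at_right 0. csch_reg (of_real x) = of_real (1 / sinh (x / 2) ^ 2 - 4 / x ^ 2)"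
      by (auto simp: eventually_at_filter)
  qed
  thus ?thesis by simp
qed

section \<open>Bounds for \<open>csch_reg\<close> near the sector\<close>

lemma sector_nbhd:
  assumes "u \<in> sector" "dist u v \<le> 1"
  shows "norm u \<le> 4 \<Longrightarrow> v \<in> cball 0 5"
    and "norm u \<ge> 4 \<Longrightarrow> Re v \<ge> 2/5 * norm u"
    and "v \<in> reg_dom"
proof -
  have 1: "norm v \<le> norm u + 1" using norm_triangle_ineq2[of v u] assms
    by (simp add: dist_norm norm_minus_commute)
  show 2: "norm u \<le> 4 \<Longrightarrow> v \<in> cball 0 5" using 1 by simp
  have "\<bar>Re u - Re v\<bar> \<le> 1" using abs_Re_le_cmod[of "u - v"] assms by (simp add: dist_norm)
  \<comment> \<open>7/10 r - 1 is at least 2/5 r as soon as r \<ge> 10/3; the threshold 4 also keeps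
    the unit discs of the remaining points inside the disc of radius 5.\<close>
  thus 3: "norm u \<ge> 4 \<Longrightarrow> Re v \<ge> 2/5 * norm u" using sectorD[OF assms(1)] by linarith
  show "v \<in> reg_dom" using 1 3 by (cases "norm u \<le> 4") (auto simp: reg_dom_def)
qed

text \<open>The bound covers whole unit discs so that Cauchy's inequality can turn it into a bound
  with the same decay for the derivatives of \<open>csch_reg\<close>.\<close>

lemma csch_reg_bound_nbhd:
  obtains C where "C > 0" "\<And>u v. u \<in> sector \<Longrightarrow> dist u v \<le> 1 \<Longrightarrow> norm (csch_reg v) \<le> C / (1 + norm u ^ 2)"
proof -
  have "compact (csch_reg ` cball 0 5)"
    by (intro compact_continuous_image holomorphic_on_imp_continuous_on
         holomorphic_on_subset[OF csch_reg_holomorphic]) (auto simp: reg_dom_def)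
  hence "bounded (csch_reg ` cball 0 5)" by (rule compact_imp_bounded)
  then obtain B where B: "B > 0" "\<And>v. v \<in> cball 0 5 \<Longrightarrow> norm (csch_reg v) \<le> B"
    unfolding bounded_pos by auto
  show ?thesis
  \<comment> \<open>17 = 1 + 4^2 serves the points with |u| \<le> 4. Farther out the two terms of
    \<open>csch_reg\<close> add up to at most 50 / |u|^2, and 1 + |u|^2 \<le> 2 |u|^2 doubles the
    50.\<close>
  proof (rule that[of "17 * B + 100"])
    fix u v assume uv: "u \<in> sector" "dist u v \<le> 1"
    show "norm (csch_reg v) \<le> (17 * B + 100) / (1 + norm u ^ 2)"
    proof (cases "norm u \<le> 4")
      case True
      hence "norm u ^ 2 \<le> 4 ^ 2" by (intro power_mono) auto
      hence "B * (1 + norm u ^ 2) \<le> B * 17" using B by (intro mult_left_mono) auto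
      hence "B \<le> (17 * B + 100) / (1 + norm u ^ 2)"
        by (subst pos_le_divide_eq) (auto simp: add_pos_nonneg)
      thus ?thesis using B(2)[OF sector_nbhd(1)[OF uv True]] by linarith
    next
      case False
      define r where "r = 2/5 * norm u"
      have r: "r > 0" "Re v \<ge> r" "norm v \<ge> r" using sector_nbhd(2)[OF uv] False complex_Re_le_cmod[of v]
        by (auto simp: r_def)
      have v: "v \<in> reg_dom" "v \<noteq> 0" using sector_nbhd(3)[OF uv] r by auto
      have "norm (csch_reg v) \<le> norm (1 / sinh (v / 2) ^ 2) + norm (4 / v ^ 2)"
        unfolding csch_reg_eq[OF v] by (rule norm_triangle_ineq4)
      also have "norm (1 / sinh (v / 2) ^ 2) = 1 / norm (sinh (v / 2)) ^ 2"
        by (simp add: norm_divide norm_power)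
      also have "norm (4 / v ^ 2) = 4 / norm v ^ 2" by (simp add: norm_divide norm_power)
      also have "r / 2 \<le> norm (sinh (v / 2))"
        using norm_sinh_ge[of "v / 2"] sinh_ge_self[of "Re v / 2"] r by simp
      hence "1 / norm (sinh (v / 2)) ^ 2 \<le> 1 / (r / 2) ^ 2"
        using r by (intro divide_left_mono power_mono mult_pos_pos zero_less_power) auto
      also have "4 / norm v ^ 2 \<le> 4 / r ^ 2"
        using r by (intro divide_left_mono power_mono mult_pos_pos zero_less_power) auto
      also have "1 / (r / 2) ^ 2 + 4 / r ^ 2 = 50 / norm u ^ 2"
        by (simp add: r_def power_divide power_mult_distrib)
      also have "\<dots> \<le> (17 * B + 100) / (1 + norm u ^ 2)"
      proof -
        have "norm u ^ 2 \<ge> 1" using False by (intro one_le_power) auto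
        moreover have "17 * B * norm u ^ 2 \<ge> 0" using B by simp
        ultimately have "50 * (1 + norm u ^ 2) \<le> (17 * B + 100) * norm u ^ 2"
          by (simp add: algebra_simps)
        moreover have "norm u ^ 2 > 0" "1 + norm u ^ 2 > 0" using False by (auto intro!: add_pos_nonneg)
        ultimately show ?thesis by (simp add: divide_simps mult.commute)
      qed
      finally show ?thesis by simp
    qed
  qed (use B in auto)
qed

text \<open>One step of the trapezoidal rule for the integral of \<open>csch_reg\<close> from u to u
  + t. The usual error, the cube of the step times a second derivative, keeps the decay 1 / (1 +
  |u|^2), so that the errors at all u = n t sum to O(t^2).\<close>

lemma trapezoid_csch_reg:
  obtains C where "C > 0"
    "\<And>u t. u \<in> sector \<Longrightarrow> t \<in> sector \<Longrightarrow> 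
      norm (coth_reg (u + t) - coth_reg u - t / 2 * (csch_reg u + csch_reg (u + t))) 
         \<le> C * norm t ^ 3 / (1 + norm u ^ 2)"
proof -
  obtain C where C: "C > 0" "\<And>u v. u \<in> sector \<Longrightarrow> dist u v \<le> 1 \<Longrightarrow> norm (csch_reg v) \<le> C / (1 + norm u ^ 2)"
    using csch_reg_bound_nbhd by blast
  show ?thesis
  proof (rule that[of "2 * C"])
    fix u t assume ut: "u \<in> sector" "t \<in> sector"
    define B where "B = 2 * C / (1 + norm u ^ 2)"
    define S where "S = closed_segment u (u + t)"
    have S: "x \<in> sector \<and> norm u \<le> norm x \<and> x \<in> reg_dom" if "x \<in> S" for x
    proof -
      from that obtain r where r: "0 \<le> r" "x = u + of_real r * t"
        by (auto simp: S_def in_segment scaleR_conv_of_real algebra_simps)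
      have "x \<in> sector" "norm u \<le> norm x" using ut r
        by (auto intro!: sector_add sector_scaleR norm_add_sector_ge)
      moreover have "x \<in> reg_dom" by (rule sector_nbhd(3)[of x]) (use \<open>x \<in> sector\<close> in auto)
      ultimately show ?thesis by blast
    qed
    have bd: "norm (deriv (deriv csch_reg) x) \<le> B" if "x \<in> S" for x
    proof -
      have "norm ((deriv ^^ 2) csch_reg x) \<le> fact 2 * (C / (1 + norm x ^ 2)) / 1 ^ 2"
      proof (rule Cauchy_inequality)
        have sub: "cball x 1 \<subseteq> reg_dom" using sector_nbhd(3)[of x] S[OF that] by auto
        thus "csch_reg holomorphic_on ball x 1" 
          by (intro holomorphic_on_subset[OF csch_reg_holomorphic]) auto
        show "continuous_on (cball x 1) csch_reg"
          by (intro holomorphic_on_imp_continuous_on holomorphic_on_subset[OF csch_reg_holomorphic] sub)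
      qed (use C(2)[of x] S[OF that] in \<open>auto simp: dist_norm\<close>)
      also have "\<dots> = 2 * C / (1 + norm x ^ 2)" by simp
      also have "\<dots> \<le> B" unfolding B_def using C S[OF that]
        by (intro divide_left_mono add_mono power_mono mult_pos_pos) (auto simp: add_pos_nonneg)
      finally show ?thesis by (simp add: numeral_2_eq_2)
    qed
    define f where "f = (\<lambda>i. (deriv ^^ i) coth_reg)"
    have f: "(f i has_field_derivative f (Suc i) x) (at x within S)" if "x \<in> S" for i x
    proof -
      have "f i holomorphic_on reg_dom" unfolding f_def
        by (intro holomorphic_higher_deriv coth_reg_holomorphic) auto
      hence "(f i has_field_derivative deriv (f i) x) (at x within S)"
        by (rule holomorphic_derivI) (use S[OF that] in auto)
      thus ?thesis by (simp add: f_def)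
    qed
    have f0: "f 0 = coth_reg" "f (Suc 0) = csch_reg" "f (Suc (Suc 0)) = deriv csch_reg" 
      "f (Suc (Suc (Suc 0))) = deriv (deriv csch_reg)"
      by (simp_all add: f_def csch_reg_def)
    have uS: "u \<in> S" "u + t \<in> S" "convex S" by (auto simp: S_def)
    have "norm (f 0 (u + t) - (\<Sum>i\<le>2. f i u * (u + t - u) ^ i / fact i)) \<le> B * norm (u + t - u) ^ Suc 2 / fact 2"
      by (rule complex_Taylor[OF uS(3), of 2 f]) (simp_all add: f numeral_2_eq_2 f0 bd uS)
    hence 1: "norm (coth_reg (u + t) - coth_reg u - csch_reg u * t - deriv csch_reg u * t ^ 2 / 2) \<le> B * norm t ^ 3 / 2"
      by (simp add: f0 numeral_2_eq_2 numeral_3_eq_3 diff_diff_eq)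
    have "norm (f (Suc 0) (u + t) - (\<Sum>i\<le>1. f (Suc i) u * (u + t - u) ^ i / fact i)) \<le> B * norm (u + t - u) ^ Suc 1 / fact 1"
      by (rule complex_Taylor[OF uS(3), of 1 "\<lambda>i. f (Suc i)"]) (simp_all add: f f0 bd uS)
    hence 2: "norm (csch_reg (u + t) - csch_reg u - deriv csch_reg u * t) \<le> B * norm t ^ 2"
      by (simp add: f0 diff_diff_eq power2_eq_square)
    \<comment> \<open>The trapezoidal error is the second order Taylor remainder of the
      antiderivative minus t / 2 times the first order remainder of the integrand; the terms with
      \<open>deriv csch_reg u\<close> cancel.\<close>
    have "coth_reg (u + t) - coth_reg u - t / 2 * (csch_reg u + csch_reg (u + t)) =
      (coth_reg (u + t) - coth_reg u - csch_reg u * t - deriv csch_reg u * t ^ 2 / 2)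
      - t / 2 * (csch_reg (u + t) - csch_reg u - deriv csch_reg u * t)"
      by (simp add: algebra_simps power2_eq_square)
    also have "norm \<dots> \<le> B * norm t ^ 3 / 2 + norm t / 2 * (B * norm t ^ 2)"
      by (intro order.trans[OF norm_triangle_ineq4] add_mono 1)
         (simp add: norm_mult 2 mult_left_mono)
    also have "\<dots> = B * norm t ^ 3" by (simp add: power3_eq_cube power2_eq_square)
    finally show "norm (coth_reg (u + t) - coth_reg u - t / 2 * (csch_reg u + csch_reg (u + t))) 
         \<le> 2 * C * norm t ^ 3 / (1 + norm u ^ 2)" by (simp add: B_def)
  qed (use C in auto)
qed

text \<open>The sum times x is a lower Riemann sum of 1 / (1 + z^2), whose integral is an arctangent
  bounded by pi / 2.\<close>

lemma sum_inverse_one_plus_square_le: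
  assumes "x > (0::real)"
  shows "(\<Sum>n<N. 1 / (1 + (real (Suc n) * x) ^ 2)) \<le> pi / (2 * x)"
proof -
  have "x / (1 + (real (Suc n) * x) ^ 2) \<le> arctan (real (Suc n) * x) - arctan (real n * x)" for n
  proof -
    have "\<exists>z. real n * x < z \<and> z < real (Suc n) * x \<and> 
        arctan (real (Suc n) * x) - arctan (real n * x) = (real (Suc n) * x - real n * x) * inverse (1 + z^2)"
      by (rule MVT2) (use assms in \<open>auto intro!: DERIV_arctan\<close>)
    then obtain z where z: "real n * x < z" "z < real (Suc n) * x"
      "arctan (real (Suc n) * x) - arctan (real n * x) = x / (1 + z^2)" by (auto simp: field_simps)
    have "0 \<le> real n * x" using assms by simp
    hence "z > 0" using z by linarith
    hence "z ^ 2 \<le> (real (Suc n) * x) ^ 2" using z by (intro power_mono) auto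
    thus ?thesis unfolding z using assms by (intro divide_left_mono) (auto simp: add_pos_nonneg)
  qed
  hence "(\<Sum>n<N. x / (1 + (real (Suc n) * x) ^ 2)) \<le> (\<Sum>n<N. arctan (real (Suc n) * x) - arctan (real n * x))"
    by (intro sum_mono)
  also have "\<dots> = arctan (real N * x)" using sum_lessThan_telescope[of "\<lambda>n. arctan (real n * x)" N] by simp
  also have "\<dots> \<le> pi / 2" using arctan_ubound[of "real N * x"] by linarith
  finally have "x * (\<Sum>n<N. 1 / (1 + (real (Suc n) * x) ^ 2)) \<le> pi / 2" by (simp add: sum_distrib_left)
  thus ?thesis using assms by (simp add: field_simps)
qed

section \<open>The trapezoidal sum along the ray through t\<close>

lemma trapezoid_sum:
  fixes h :: "complex \<Rightarrow> complex" and t :: complex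
  shows "(\<Sum>n<N. t / 2 * (h (of_nat n * t) + h (of_nat n * t + t))) =
     t * (\<Sum>n<N. h (of_nat (Suc n) * t)) + t / 2 * (h 0 - h (of_nat N * t))"
  by (induction N) (simp_all add: algebra_simps)

lemma telescope_coth:
  fixes H :: "complex \<Rightarrow> complex" and t :: complex
  shows "(\<Sum>n<N. H (of_nat n * t + t) - H (of_nat n * t)) = H (of_nat N * t) - H 0"
  by (induction N) (simp_all add: algebra_simps)

lemma csch_reg_bound:
  obtains C where "C > 0" 
    "\<And>u. u \<in> sector \<Longrightarrow> norm (csch_reg u) \<le> C / (1 + norm u ^ 2)"
    "\<And>t N. t \<in> sector \<Longrightarrow> t \<noteq> 0 \<Longrightarrow> (\<Sum>n<N. norm (csch_reg (of_nat (Suc n) * t))) \<le> C * pi / (2 * norm t)"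
proof -
  obtain C where C: "C > 0" "\<And>u v. u \<in> sector \<Longrightarrow> dist u v \<le> 1 \<Longrightarrow> norm (csch_reg v) \<le> C / (1 + norm u ^ 2)"
    using csch_reg_bound_nbhd by blast
  have bd: "norm (csch_reg u) \<le> C / (1 + norm u ^ 2)" if "u \<in> sector" for u using C(2)[OF that] by simp
  show ?thesis
  proof (rule that[OF C(1) bd])
    fix t :: complex and N :: nat assume t: "t \<in> sector" "t \<noteq> 0"
    have "(\<Sum>n<N. norm (csch_reg (of_nat (Suc n) * t))) \<le> (\<Sum>n<N. C * (1 / (1 + (real (Suc n) * norm t) ^ 2)))"
    proof (rule sum_mono)
      fix n
      show "norm (csch_reg (of_nat (Suc n) * t)) \<le> C * (1 / (1 + (real (Suc n) * norm t) ^ 2))"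
        using bd[OF sector_of_nat[OF t(1), of "Suc n"]] by (simp only: norm_mult norm_of_nat) simp
    qed
    also have "\<dots> \<le> C * (pi / (2 * norm t))"
      unfolding sum_distrib_left[symmetric] using C t
      by (intro mult_left_mono sum_inverse_one_plus_square_le) auto
    finally show "(\<Sum>n<N. norm (csch_reg (of_nat (Suc n) * t))) \<le> C * pi / (2 * norm t)" by simp
  qed
qed

lemma summable_csch_reg:
  assumes "t \<in> sector" "t \<noteq> 0"
  shows "summable (\<lambda>n. norm (csch_reg (of_nat (Suc n) * t)))"
proof -
  obtain C where C: "\<And>t N. t \<in> sector \<Longrightarrow> t \<noteq> 0 \<Longrightarrow> 
      (\<Sum>n<N. norm (csch_reg (of_nat (Suc n) * t))) \<le> C * pi / (2 * norm t)"
    using csch_reg_bound by metis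
  show ?thesis by (rule bounded_imp_summable[of _ "C * pi / (2 * norm t)"])
     (use C[OF assms, of "Suc _"] in \<open>auto simp only: lessThan_Suc_atMost norm_ge_zero\<close>)
qed

text \<open>On the ray coth (u / 2) tends to 1. It is rewritten with E = exp (- t), a number inside
  the unit disc, so that the limit concerns powers of E.\<close>

lemma coth_reg_tendsto:
  assumes "t \<in> sector" "t \<noteq> 0"
  shows "(\<lambda>N. coth_reg (of_nat N * t)) \<longlonglongrightarrow> -2"
proof -
  have Re: "Re t > 0" using assms by (rule sector_Re_pos)
  define E where "E = exp (- t)"
  have nE: "norm E < 1" using Re by (simp add: E_def norm_exp_eq_Re)
  have "(\<lambda>N. 4 / t * (1 / of_nat N) - 2 * (1 + E ^ N) / (1 - E ^ N)) \<longlonglongrightarrow> 4 / t * 0 - 2 * (1 + 0) / (1 - 0)"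
    by (intro tendsto_intros lim_1_over_n LIMSEQ_power_zero nE) auto
  moreover have "\<forall>\<^sub>F N in sequentially. 4 / t * (1 / of_nat N) - 2 * (1 + E ^ N) / (1 - E ^ N) = coth_reg (of_nat N * t)"
    using eventually_gt_at_top[of 0]
  proof eventually_elim
    case (elim N)
    define u where "u = of_nat N * t"
    have u: "u \<in> reg_dom" "u \<noteq> 0" using elim Re assms by (auto simp: u_def reg_dom_def)
    have EN: "E ^ N = exp (- u)" by (simp add: E_def u_def flip: exp_of_nat_mult)
    have ne: "exp (- u) \<noteq> 1"
    proof
      assume "exp (- u) = 1"
      hence "norm (exp (- u)) = 1" by simp
      thus False using elim Re by (simp add: norm_exp_eq_Re u_def)
    qed
    have split: "exp (u / 2) = exp (- u) * (exp (u/2) * exp u)" "exp (-(u/2)) = exp (- u) * exp (u/2)"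
      by (simp_all flip: exp_add)
    have "cosh (u / 2) / sinh (u / 2) = (exp (u/2) + exp (-(u/2))) / (exp (u/2) - exp (-(u/2)))"
    proof -
      have "a / 2 / (b / 2) = a / b" for a b :: complex by simp
      thus ?thesis unfolding cosh_field_def sinh_field_def .
    qed
    also have "\<dots> = (exp (u/2) * (1 + exp (- u))) / (exp (u/2) * (1 - exp (- u)))"
      by (simp add: split(2) ring_distribs mult.commute)
    also have "\<dots> = (1 + exp (- u)) / (1 - exp (- u))" by simp
    finally have "2 * (cosh (u / 2) / sinh (u / 2)) = 2 * ((1 + exp (- u)) / (1 - exp (- u)))" by (rule arg_cong)
    thus ?case using coth_reg_eq[OF u] unfolding EN by (simp add: u_def mult_ac)
  qed
  ultimately show ?thesis by (simp add: Lim_transform_eventually)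
qed

definition csch_sum :: "complex \<Rightarrow> complex" where
  "csch_sum t = (\<Sum>n. csch_reg (of_nat (Suc n) * t))"

text \<open>The telescoping sum contributes the difference -2 of \<open>coth_reg\<close> between
  infinity and 0, the half weight of the endpoint 0 contributes 1/6, and dividing the total error
  O(t^2) by t leaves O(t).\<close>

lemma csch_sum_asymp:
  obtains C where "C > 0" 
    "\<And>t. t \<in> sector \<Longrightarrow> t \<noteq> 0 \<Longrightarrow> norm t \<le> 1 \<Longrightarrow> norm (csch_sum t + 2 / t - 1 / 6) \<le> C * norm t"
proof -
  obtain C where C: "C > 0" 
    "\<And>u t. u \<in> sector \<Longrightarrow> t \<in> sector \<Longrightarrow> 
      norm (coth_reg (u + t) - coth_reg u - t / 2 * (csch_reg u + csch_reg (u + t))) 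
         \<le> C * norm t ^ 3 / (1 + norm u ^ 2)"
    using trapezoid_csch_reg by blast
  show ?thesis
  proof (rule that[of "3 * C"])
    fix t assume t: "t \<in> sector" "t \<noteq> 0" "norm t \<le> 1"
    define f where "f = (\<lambda>N. coth_reg (of_nat N * t) - 
       (t * (\<Sum>n<N. csch_reg (of_nat (Suc n) * t)) + t / 2 * (csch_reg 0 - csch_reg (of_nat N * t))))"
    have sums: "(\<lambda>n. csch_reg (of_nat (Suc n) * t)) sums csch_sum t"
      unfolding csch_sum_def using summable_norm_cancel[OF summable_csch_reg[OF t(1,2)]] by (rule summable_sums)
    have "(\<lambda>N. csch_reg (of_nat (Suc N) * t)) \<longlonglongrightarrow> 0"
      using sums sums_summable summable_LIMSEQ_zero by blast
    hence "(\<lambda>N. csch_reg (of_nat N * t)) \<longlonglongrightarrow> 0" by (rule LIMSEQ_imp_Suc)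
    hence lim: "f \<longlonglongrightarrow> -2 - (t * csch_sum t + t / 2 * (csch_reg 0 - 0))"
      using sums unfolding f_def sums_def
      by (intro tendsto_intros coth_reg_tendsto t)
    have bound: "norm (f N) \<le> 3 * C * norm t ^ 2" for N
    proof -
      have "f N = (\<Sum>n<N. coth_reg (of_nat n * t + t) - coth_reg (of_nat n * t)
           - t / 2 * (csch_reg (of_nat n * t) + csch_reg (of_nat n * t + t)))"
        by (subst sum_subtractf) (simp only: telescope_coth trapezoid_sum, simp add: f_def coth_reg_0)
      also have "norm \<dots> \<le> (\<Sum>n<N. C * norm t ^ 3 / (1 + norm (of_nat n * t) ^ 2))"
        by (intro sum_norm_le C sector_of_nat t)
      \<comment> \<open>One more term is added so that splitting off n = 0 leaves N terms with index
        \<open>Suc n\<close>, the form of the arctangent bound.\<close>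
      also have "\<dots> \<le> (\<Sum>n<Suc N. C * norm t ^ 3 / (1 + norm (of_nat n * t) ^ 2))"
        using C(1) by (simp add: add_nonneg_nonneg)
      also have "\<dots> = C * norm t ^ 3 + C * norm t ^ 3 * (\<Sum>n<N. 1 / (1 + (real (Suc n) * norm t) ^ 2))"
        unfolding sum.lessThan_Suc_shift sum_distrib_left by (simp del: of_nat_Suc add: norm_mult)
      also have "\<dots> \<le> C * norm t ^ 3 + C * norm t ^ 3 * (pi / (2 * norm t))"
        using C t by (intro add_left_mono mult_left_mono sum_inverse_one_plus_square_le) auto
      also have "\<dots> = C * norm t ^ 2 * (norm t + pi / 2)"
        using t by (simp add: field_simps power3_eq_cube power2_eq_square)
      also have "\<dots> \<le> C * norm t ^ 2 * 3"
        using C t pi_less_4 by (intro mult_left_mono) auto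
      finally show ?thesis by (simp add: mult_ac)
    qed
    have "norm (-2 - (t * csch_sum t + t / 2 * (csch_reg 0 - 0))) \<le> 3 * C * norm t ^ 2"
      using bound by (intro Lim_norm_ubound[OF _ lim]) auto
    also have "-2 - (t * csch_sum t + t / 2 * (csch_reg 0 - 0)) = - t * (csch_sum t + 2 / t - 1 / 6)"
      using t by (simp add: csch_reg_0 field_simps)
    finally have "norm t * norm (csch_sum t + 2 / t - 1 / 6) \<le> norm t * (3 * C * norm t)"
      by (simp add: norm_mult power2_eq_square mult_ac)
    thus "norm (csch_sum t + 2 / t - 1 / 6) \<le> 3 * C * norm t"
      using t by (subst (asm) mult_le_cancel_left_pos) auto
  qed (use C in auto)
qed

section \<open>The factors 1 - \<kappa> a_n\<close>

definition kap :: "complex \<Rightarrow> complex" where "kap w = exp w + exp (- w) - 2"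

lemma kap_eq: "kap w = 4 * sinh (w / 2) ^ 2"
proof -
  have "kap w = (exp (w/2) - exp (-(w/2))) ^ 2"
    by (simp add: kap_def power2_diff flip: exp_double exp_add)
  thus ?thesis by (simp add: sinh_field_def power_divide)
qed

text \<open>\<open>kap\<close> is even, so the cubic Taylor polynomials of the two exponentials
  leave only w^2 and a remainder of order 4.\<close>

lemma kap_bound:
  assumes "norm w \<le> 1"
  shows "norm (kap w - w ^ 2) \<le> norm w ^ 4" "norm (kap w) \<le> 2 * norm w ^ 2"
proof -
  have T: "norm (exp z - (1 + z + z ^ 2 / 2 + z ^ 3 / 6)) \<le> norm z ^ 4 / 2" if "norm z \<le> 1" for z :: complex
  proof -
    have "norm (exp z - (\<Sum>k\<le>3. z ^ k / fact k)) \<le> exp \<bar>Re z\<bar> * norm z ^ Suc 3 / fact 3"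
      by (rule Taylor_exp)
    also have "(\<Sum>k\<le>3. z ^ k / fact k) = 1 + z + z ^ 2 / 2 + z ^ 3 / 6"
      by (simp add: numeral_3_eq_3 numeral_2_eq_2 fact_Suc)
    also have "exp \<bar>Re z\<bar> \<le> exp (1::real)" using that abs_Re_le_cmod[of z] by auto
    hence "exp \<bar>Re z\<bar> \<le> 3" using exp_le by linarith
    hence "exp \<bar>Re z\<bar> * norm z ^ Suc 3 / fact 3 \<le> 3 * norm z ^ Suc 3 / fact 3"
      by (intro divide_right_mono mult_right_mono) auto
    finally show ?thesis by (simp add: fact_numeral)
  qed
  have "kap w - w ^ 2 = (exp w - (1 + w + w ^ 2 / 2 + w ^ 3 / 6)) + (exp (-w) - (1 + (-w) + (-w) ^ 2 / 2 + (-w) ^ 3 / 6))"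
    by (simp add: kap_def)
  also have "norm \<dots> \<le> norm w ^ 4 / 2 + norm (-w) ^ 4 / 2"
    using assms by (intro norm_triangle_mono T) auto
  finally show 1: "norm (kap w - w ^ 2) \<le> norm w ^ 4" by simp
  have "norm (kap w) \<le> norm (kap w - w ^ 2) + norm (w ^ 2)" by norm
  also have "\<dots> \<le> norm w ^ 2 + norm w ^ 2"
    using 1 power_decreasing[of 2 4 "norm w"] assms by (auto simp: norm_power)
  finally show "norm (kap w) \<le> 2 * norm w ^ 2" by simp
qed

definition csch2 :: "complex \<Rightarrow> complex" where
  "csch2 u = 1 / (4 * sinh (u / 2) ^ 2)"

lemma csch2_eq:
  assumes "Re u > 0"
  shows "csch2 u = csch_reg u / 4 + 1 / u ^ 2"
proof -
  have "u \<in> reg_dom" "u \<noteq> 0" using assms by (auto simp: reg_dom_def)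
  from csch_reg_eq[OF this] show ?thesis by (simp add: csch2_def diff_divide_distrib)
qed

lemma sums_inverse_squares: "(\<lambda>n. 1 / real (Suc n) ^ 2) sums (pi ^ 2 / 6)"
  using inverse_squares_sums by (simp add: add.commute)

lemma sum_inverse_squares_le: "(\<Sum>n<N. 1 / real (Suc n) ^ 2) \<le> 2"
proof -
  have "(\<Sum>n<N. 1 / real (Suc n) ^ 2) \<le> pi ^ 2 / 6"
    using sum_le_suminf[OF sums_summable[OF sums_inverse_squares], of "{..<N}"] sums_unique[OF sums_inverse_squares] by simp
  also have "pi ^ 2 \<le> (32/10) ^ 2" using pi_less_4 pi_approx by (intro power_mono) auto
  finally show ?thesis by (simp add: power2_eq_square)
qed

lemma csch2_sum:
  assumes "t \<in> sector" "t \<noteq> 0"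
  shows "(\<lambda>n. csch2 (of_nat (Suc n) * t)) sums (csch_sum t / 4 + of_real (pi ^ 2 / 6) / t ^ 2)"
proof -
  have Re: "Re t > 0" using assms by (rule sector_Re_pos)
  have "(\<lambda>n. csch_reg (of_nat (Suc n) * t)) sums csch_sum t"
    unfolding csch_sum_def using summable_norm_cancel[OF summable_csch_reg[OF assms]] by (rule summable_sums)
  moreover have "(\<lambda>n. complex_of_real (1 / real (Suc n) ^ 2)) sums of_real (pi ^ 2 / 6)"
    using sums_inverse_squares by (rule sums_of_real)
  ultimately have "(\<lambda>n. csch_reg (of_nat (Suc n) * t) / 4 + complex_of_real (1 / real (Suc n) ^ 2) / t ^ 2) sums 
        (csch_sum t / 4 + of_real (pi ^ 2 / 6) / t ^ 2)"
    by (intro sums_add sums_divide)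
  moreover have "csch2 (of_nat (Suc n) * t) = csch_reg (of_nat (Suc n) * t) / 4 + complex_of_real (1 / real (Suc n) ^ 2) / t ^ 2" for n
    using Re by (subst csch2_eq) (auto simp: power_mult_distrib simp del: of_nat_Suc)
  ultimately show ?thesis by simp
qed

section \<open>The quotient of the crank and partition generating functions\<close>

text \<open>Rests on exp (-2 x) \<le> 1 - x for 0 \<le> x \<le> 1/2.\<close>

lemma norm_prod_one_minus_ge:
  fixes z :: "nat \<Rightarrow> complex"
  assumes "\<And>i. i < N \<Longrightarrow> norm (z i) \<le> 1 / 2"
  shows "exp (- 2 * (\<Sum>i<N. norm (z i))) \<le> norm (\<Prod>i<N. 1 - z i)"
proof -
  have *: "exp (- 2 * x) \<le> 1 - x" if "0 \<le> x" "x \<le> 1 / 2" for x :: real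
  proof -
    have "x * x \<le> x * (1 / 2)" using that by (intro mult_left_mono)
    hence "- 2 * x \<le> - x - 2 * x ^ 2" by (simp add: power2_eq_square)
    also have "\<dots> \<le> ln (1 - x)" using that by (intro ln_one_minus_pos_lower_bound)
    finally have "exp (- 2 * x) \<le> exp (ln (1 - x))" by (simp only: exp_le_cancel_iff)
    thus ?thesis using that by simp
  qed
  have "exp (- 2 * (\<Sum>i<N. norm (z i))) = (\<Prod>i<N. exp (- 2 * norm (z i)))"
    by (simp add: exp_sum[symmetric] sum_distrib_left sum_negf)
  also have "\<dots> \<le> (\<Prod>i<N. norm (1 - z i))"
  proof (intro prod_mono conjI)
    fix i assume "i \<in> {..<N}"
    hence "exp (- 2 * norm (z i)) \<le> 1 - norm (z i)" using assms by (intro *) auto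
    also have "\<dots> \<le> norm (1 - z i)" using norm_triangle_ineq2[of 1 "z i"] by simp
    finally show "exp (- 2 * norm (z i)) \<le> norm (1 - z i)" .
  qed auto
  finally show ?thesis by (simp add: prod_norm)
qed

text \<open>What remains of the expanded product consists of the monomials of degree at least two,
  and the triangle inequality replaces each factor g i by its norm. Induction on N avoids the
  expansion over subsets.\<close>

lemma norm_prod_one_plus_linear:
  fixes g :: "nat \<Rightarrow> complex"
  shows "norm ((\<Prod>i<N. 1 + g i) - 1 - (\<Sum>i<N. g i)) \<le> (\<Prod>i<N. 1 + norm (g i)) - 1 - (\<Sum>i<N. norm (g i))"
proof (induction N)
  case (Suc N)
  note IH = Suc.IH
  let ?P = "\<Prod>i<N. 1 + g i" and ?S = "\<Sum>i<N. g i" and ?P' = "\<Prod>i<N. 1 + norm (g i)" and ?S' = "\<Sum>i<N. norm (g i)"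
  have "norm (?P - 1) \<le> norm (?P - 1 - ?S) + norm ?S"
    using norm_triangle_ineq[of "?P - 1 - ?S" ?S] by simp
  also have "\<dots> \<le> (?P' - 1 - ?S') + ?S'" by (intro add_mono IH norm_sum)
  finally have 1: "norm (?P - 1) \<le> ?P' - 1" by simp
  have "norm (?P * (1 + g N) - 1 - (?S + g N)) = norm ((?P - 1 - ?S) + g N * (?P - 1))"
    by (simp add: algebra_simps)
  also have "\<dots> \<le> (?P' - 1 - ?S') + norm (g N) * (?P' - 1)"
    by (intro norm_triangle_mono IH) (simp add: norm_mult 1 mult_left_mono)
  finally show ?case by (simp add: algebra_simps)
qed auto

lemma norm_prod_one_plus_quadratic:
  fixes g :: "nat \<Rightarrow> complex"
  assumes "(\<Sum>i<N. norm (g i)) \<le> A" "A \<le> 1"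
  shows "norm ((\<Prod>i<N. 1 + g i) - 1 - (\<Sum>i<N. g i)) \<le> A ^ 2"
proof -
  let ?B = "\<Sum>i<N. norm (g i)"
  have B: "0 \<le> ?B" by (intro sum_nonneg) auto
  have "(\<Prod>i<N. 1 + norm (g i)) \<le> (\<Prod>i<N. exp (norm (g i)))"
    by (intro prod_mono conjI exp_ge_add_one_self) auto
  also have "\<dots> = exp ?B" by (simp add: exp_sum)
  also have "\<dots> \<le> 1 + ?B + ?B ^ 2" using B assms by (intro exp_bound) auto
  finally have "norm ((\<Prod>i<N. 1 + g i) - 1 - (\<Sum>i<N. g i)) \<le> ?B ^ 2"
    using norm_prod_one_plus_linear[of g N] by linarith
  also have "\<dots> \<le> A ^ 2" using assms B by (intro power_mono) auto
  finally show ?thesis .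
qed

lemma sinh_mult_ge:
  assumes "x \<ge> (0::real)"
  shows "sinh (real m * x) \<ge> real m * sinh x"
proof (induction m)
  case (Suc m)
  have "real (Suc m) * sinh x = (real m * sinh x) * 1 + 1 * sinh x" by (simp add: algebra_simps)
  also have "\<dots> \<le> sinh (real m * x) * cosh x + cosh (real m * x) * sinh x"
    using Suc assms by (intro add_mono mult_mono) (auto simp: cosh_real_ge_1)
  also have "\<dots> = sinh (real (Suc m) * x)" by (simp add: sinh_add algebra_simps)
  finally show ?case .
qed auto

lemma norm_sinh_le: "norm (sinh z) \<le> sinh (norm z)" for z :: complex
  by (rule norm_sums_le[OF sinh_converges sinh_converges]) (simp add: norm_power divide_inverse)

text \<open>With x = Re t / 4 the numerator is at most sinh x and the denominator at least sinh (2
  (n + 1) x) \<ge> 2 (n + 1) sinh x, so sinh x cancels. This makes the bound uniform in t and is the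
  reason for the radius Re t / 2.\<close>

lemma kap_csch2_bound:
  assumes "Re t > 0" "norm w \<le> Re t / 2"
  shows "norm (kap w * csch2 (of_nat (Suc n) * t)) \<le> 1 / (4 * real (Suc n) ^ 2)"
proof -
  define x where "x = Re t / 4"
  have x: "x > 0" using assms by (simp add: x_def)
  have sx: "sinh x > 0" using sinh_ge_self[of x] x by simp
  have "norm (sinh (w / 2)) \<le> sinh (norm (w / 2))" by (rule norm_sinh_le)
  also have "\<dots> \<le> sinh x" using assms by (simp add: x_def)
  finally have 1: "norm (sinh (w / 2)) \<le> sinh x" .
  have 2: "real (2 * Suc n) * sinh x \<le> norm (sinh (of_nat (Suc n) * t / 2))"
  proof -
    have "real (2 * Suc n) * sinh x \<le> sinh (real (2 * Suc n) * x)" using x by (intro sinh_mult_ge) auto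
    also have "real (2 * Suc n) * x = Re (of_nat (Suc n) * t / 2)" by (simp add: x_def field_simps)
    also have "sinh \<dots> \<le> norm (sinh (of_nat (Suc n) * t / 2))"
      using assms by (intro norm_sinh_ge) auto
    finally show ?thesis .
  qed
  have "norm (kap w * csch2 (of_nat (Suc n) * t)) = (norm (sinh (w / 2)) / norm (sinh (of_nat (Suc n) * t / 2))) ^ 2"
    by (simp add: kap_eq csch2_def norm_mult norm_divide norm_power power_divide)
  also have "\<dots> \<le> (sinh x / (real (2 * Suc n) * sinh x)) ^ 2"
    using 1 2 sx by (intro power_mono frac_le) auto
  also have "\<dots> = 1 / (2 * real (Suc n)) ^ 2" using sx by (simp add: power_divide)
  also have "\<dots> = 1 / (4 * real (Suc n) ^ 2)" by (simp only: power_mult_distrib) simp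
  finally show ?thesis .
qed

definition kap_prod :: "complex \<Rightarrow> complex \<Rightarrow> complex" where
  "kap_prod w t = (\<Prod>n. 1 - kap w * csch2 (of_nat (Suc n) * t))"

lemma kap_prod_tendsto:
  assumes "Re t > 0" "norm w \<le> Re t / 2"
  shows "(\<lambda>N. \<Prod>n<N. 1 - kap w * csch2 (of_nat (Suc n) * t)) \<longlonglongrightarrow> kap_prod w t"
proof -
  have "summable (\<lambda>n. norm (1 - kap w * csch2 (of_nat (Suc n) * t) - 1))"
  proof (rule summable_comparison_test')
    show "summable (\<lambda>n. 1 / 4 * (1 / real (Suc n) ^ 2))"
      using sums_summable[OF sums_inverse_squares] by (rule summable_mult)
  qed (use kap_csch2_bound[OF assms] in simp)
  hence "abs_convergent_prod (\<lambda>n. 1 - kap w * csch2 (of_nat (Suc n) * t))"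
    by (rule summable_imp_abs_convergent_prod)
  hence "convergent_prod (\<lambda>n. 1 - kap w * csch2 (of_nat (Suc n) * t))"
    by (rule abs_convergent_prod_imp_convergent_prod)
  thus ?thesis unfolding kap_prod_def by (intro has_prod_imp_tendsto' convergent_prod_has_prod)
qed

text \<open>The norms of the z n sum to at most 1/4 times 2, hence the exponent -1. The lemma serves
  \<open>kap_prod\<close> and, because |s| \<le> 1/2, the sine product.\<close>

lemma prod_inverse_square_bound_ge:
  fixes z :: "nat \<Rightarrow> complex"
  assumes "\<And>n. norm (z n) \<le> 1 / (4 * real (Suc n) ^ 2)" "(\<lambda>N. \<Prod>n<N. 1 - z n) \<longlonglongrightarrow> l"
  shows "exp (- 1) \<le> norm l"
proof (rule Lim_norm_lbound[OF _ assms(2)])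
  have "exp (- 1) \<le> norm (\<Prod>n<N. 1 - z n)" for N
  proof -
    have "(\<Sum>n<N. norm (z n)) \<le> (\<Sum>n<N. 1 / 4 * (1 / real (Suc n) ^ 2))"
      using assms(1) by (intro sum_mono) simp
    also have "\<dots> \<le> 1 / 4 * 2" unfolding sum_distrib_left[symmetric]
      using sum_inverse_squares_le by (intro mult_left_mono) auto
    finally have "exp (- 1) \<le> exp (- 2 * (\<Sum>n<N. norm (z n)))" by simp
    also have "\<dots> \<le> norm (\<Prod>n<N. 1 - z n)"
    proof (rule norm_prod_one_minus_ge)
      fix n
      have "1 / (4 * real (Suc n) ^ 2) \<le> 1 / (4 * 1)"
        by (intro divide_left_mono mult_left_mono) auto
      thus "norm (z n) \<le> 1 / 2" using assms(1)[of n] by linarith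
    qed
    finally show ?thesis .
  qed
  thus "\<forall>\<^sub>F N in sequentially. exp (- 1) \<le> norm (\<Prod>n<N. 1 - z n)" by simp
qed auto

lemma kap_prod_ge:
  assumes "Re t > 0" "norm w \<le> Re t / 2"
  shows "exp (- 1) \<le> norm (kap_prod w t)"
  using kap_csch2_bound[OF assms] kap_prod_tendsto[OF assms] by (rule prod_inverse_square_bound_ge)

section \<open>Comparison with the sine product\<close>

definition sincpi :: "complex \<Rightarrow> complex" where
  "sincpi s = (if s = 0 then 1 else sin (of_real pi * s) / (of_real pi * s))"

lemma sincpi_tendsto: "(\<lambda>N. \<Prod>n<N. 1 - s ^ 2 / of_nat (Suc n) ^ 2) \<longlonglongrightarrow> sincpi s"
proof (cases "s = 0")
  case False
  have "(\<lambda>N. of_real pi * s * (\<Prod>k=1..N. 1 - s^2 / of_nat k^2) / (of_real pi * s)) \<longlonglongrightarrow> 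
     sin (of_real pi * s) / (of_real pi * s)"
    by (intro tendsto_divide sin_product_formula_complex tendsto_const) (use False in auto)
  hence "(\<lambda>N. \<Prod>k=1..N. 1 - s^2 / of_nat k^2) \<longlonglongrightarrow> sincpi s"
    using False by (simp add: sincpi_def)
  thus ?thesis by (simp add: prod.atLeast1_atMost_eq)
qed (simp add: sincpi_def)

lemma norm_sincpi_ge:
  assumes "norm s \<le> 1 / 2"
  shows "exp (- 1) \<le> norm (sincpi s)"
proof (rule prod_inverse_square_bound_ge[OF _ sincpi_tendsto])
  fix n
  have "norm s ^ 2 \<le> (1 / 2) ^ 2" using assms by (intro power_mono) auto
  hence "norm (s ^ 2 / of_nat (Suc n) ^ 2) \<le> (1/2)^2 / real (Suc n) ^ 2"
    unfolding norm_divide norm_power norm_of_nat by (intro divide_right_mono) auto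
  thus "norm (s ^ 2 / of_nat (Suc n) ^ 2) \<le> 1 / (4 * real (Suc n) ^ 2)" by (simp add: power_divide)
qed

text \<open>Write 1 - \<kappa> a_n = (1 - z_n)(1 + g_n) with z_n = s^2 / n^2 and s = w / t. The
  product of the 1 - z_n is the sine product. The g_n are O(t^2) each and O(t) in total, so the
  product of the 1 + g_n is 1 plus their sum up to O(t^2). With the same accuracy that sum is -
  \<kappa> / 4 times \<open>csch_sum t\<close>, whose leading term -2 / t yields w^2 / (2
  t).\<close>

lemma kap_prod_asymp:
  obtains C \<delta> where "C > 0" "\<delta> > 0" "\<delta> \<le> 1"
    "\<And>t w. t \<in> sector \<Longrightarrow> t \<noteq> 0 \<Longrightarrow> norm t \<le> \<delta> \<Longrightarrow> norm w \<le> Re t / 2 \<Longrightarrow>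
       norm (kap_prod w t / sincpi (w / t) - (1 + w ^ 2 / (2 * t))) \<le> C * norm t ^ 2"
proof -
  obtain C0 where C0: "C0 > 0" 
    "\<And>u. u \<in> sector \<Longrightarrow> norm (csch_reg u) \<le> C0 / (1 + norm u ^ 2)"
    "\<And>t N. t \<in> sector \<Longrightarrow> t \<noteq> 0 \<Longrightarrow> (\<Sum>n<N. norm (csch_reg (of_nat (Suc n) * t))) \<le> C0 * pi / (2 * norm t)"
    using csch_reg_bound by blast
  obtain C1 where C1: "C1 > 0" 
    "\<And>t. t \<in> sector \<Longrightarrow> t \<noteq> 0 \<Longrightarrow> norm t \<le> 1 \<Longrightarrow> norm (csch_sum t + 2 / t - 1 / 6) \<le> C1 * norm t"
    using csch_sum_asymp by blast
  \<comment> \<open>\<open>D\<close> bounds both |d i| / T^2 and the sum of the |g i| divided by T;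
    the 4 comes from 2 T^2 times the bound 2 for the sum of inverse squares. The threshold 1 / D for
    |t| gives D T \<le> 1, as the quadratic estimate for products requires.\<close>
  define D where "D = C0 + 4"
  define K where "K = D ^ 2 + 2 * (D + 1)"
  have D: "D \<ge> 1" using C0 by (simp add: D_def)
  have K: "K > 0" using D by (simp add: K_def add_pos_pos)
  show ?thesis
  proof (rule that[of "K + C1 + 2" "1 / D"])
    fix t w :: complex assume t: "t \<in> sector" "t \<noteq> 0" "norm t \<le> 1 / D" and w: "norm w \<le> Re t / 2"
    define T where "T = norm t"
    have "1 / D \<le> 1" using D by simp
    hence T: "T > 0" "T \<le> 1" using t by (auto simp: T_def)
    have "D * T \<le> D * (1 / D)" using t D unfolding T_def by (intro mult_left_mono) auto
    hence DT: "D * T \<le> 1" using D by simp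
    have Re: "Re t > 0" using t by (intro sector_Re_pos)
    have wT: "norm w \<le> T / 2" using w complex_Re_le_cmod[of t] by (simp add: T_def)
    define s where "s = w / t"
    have s: "norm s \<le> 1 / 2" using wT T by (simp add: s_def norm_divide T_def divide_simps)
    define h where "h = (\<lambda>i. csch_reg (of_nat (Suc i) * t))"
    define z where "z = (\<lambda>i. s ^ 2 / of_nat (Suc i) ^ 2)"
    define d where "d = (\<lambda>i. kap w * csch2 (of_nat (Suc i) * t) - z i)"
    define g where "g = (\<lambda>i. - d i / (1 - z i))"
    have w2: "norm w ^ 2 \<le> T ^ 2 / 4" using power_mono[OF wT, of 2] by (simp add: power_divide)
    have w4: "norm w ^ 4 \<le> T ^ 4 / 16" using power_mono[OF wT, of 4] by (simp add: power_divide)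
    have k1: "norm (kap w - w ^ 2) \<le> T ^ 4 / 16" using kap_bound(1)[of w] w4 wT T by linarith
    have k2: "norm (kap w) \<le> T ^ 2 / 2" using kap_bound(2)[of w] w2 wT T by linarith
    have z1: "norm (z i) \<le> 1 / 4 * (1 / real (Suc i) ^ 2)" for i
    proof -
      have "norm s ^ 2 \<le> 1 / 4" using power_mono[OF s, of 2] by (simp add: power_divide)
      hence "norm (z i) \<le> (1 / 4) / real (Suc i) ^ 2"
        unfolding z_def norm_divide norm_power norm_of_nat by (intro divide_right_mono) auto
      thus ?thesis by simp
    qed
    have sq1: "1 / real (Suc i) ^ 2 \<le> 1" for i by (simp add: divide_simps)
    have z2: "norm (z i) \<le> 1 / 4" for i using z1[of i] sq1[of i] by linarith
    have z3: "norm (1 / (1 - z i)) \<le> 2" for i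
    proof -
      have "1 - norm (z i) \<le> norm (1 - z i)" using norm_triangle_ineq2[of 1 "z i"] by simp
      hence "norm (1 - z i) \<ge> 1 / 2" using z2[of i] by linarith
      hence "1 / norm (1 - z i) \<le> 1 / (1 / 2)" by (intro divide_left_mono) auto
      thus ?thesis by (simp add: norm_divide)
    qed
    have z4: "1 - z i \<noteq> 0" for i using z2[of i] by auto
    \<comment> \<open>The pole part 1 / u^2 of \<open>csch2\<close> almost cancels against z i and
      leaves only \<kappa> - w^2, which is of order 4.\<close>
    have deq: "d i = kap w / 4 * h i + (kap w - w ^ 2) / t ^ 2 / of_nat (Suc i) ^ 2" for i
      using Re t unfolding d_def z_def s_def h_def
      by (subst csch2_eq) (auto simp: field_simps power_mult_distrib power_divide simp del: of_nat_Suc)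
    have k3: "norm ((kap w - w ^ 2) / t ^ 2 / of_nat (Suc i) ^ 2) \<le> T ^ 2 * (1 / real (Suc i) ^ 2)" for i
    proof -
      have "norm ((kap w - w ^ 2) / t ^ 2) \<le> (T ^ 4 / 16) / T ^ 2"
        unfolding norm_divide norm_power T_def[symmetric] using k1 by (intro divide_right_mono) auto
      also have "\<dots> = T ^ 2 / 16" using T by (simp add: field_simps flip: power_add)
      also have "\<dots> \<le> T ^ 2" by simp
      finally have "norm ((kap w - w ^ 2) / t ^ 2) / real (Suc i) ^ 2 \<le> T ^ 2 / real (Suc i) ^ 2"
        by (intro divide_right_mono) auto
      thus ?thesis by (simp add: norm_divide norm_power norm_mult del: of_nat_Suc)
    qed
    have d1: "norm (d i) \<le> T ^ 2 / 8 * norm (h i) + T ^ 2 * (1 / real (Suc i) ^ 2)" for i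
    proof -
      have "norm (d i) \<le> norm (kap w / 4 * h i) + norm ((kap w - w ^ 2) / t ^ 2 / of_nat (Suc i) ^ 2)"
        unfolding deq by (rule norm_triangle_ineq)
      also have "norm (kap w / 4 * h i) \<le> T ^ 2 / 8 * norm (h i)"
        unfolding norm_mult using k2 by (intro mult_right_mono) (auto simp: norm_divide)
      finally show ?thesis using k3[of i] by linarith
    qed
    have h1: "norm (h i) \<le> C0" for i
    proof -
      have "norm (h i) \<le> C0 / (1 + norm (of_nat (Suc i) * t) ^ 2)"
        unfolding h_def by (intro C0 sector_of_nat t)
      also have "\<dots> \<le> C0 / 1" using C0 by (intro divide_left_mono) (auto simp: add_pos_nonneg)
      finally show ?thesis by simp
    qed
    have d2: "norm (d i) \<le> D * T ^ 2" for i
    proof -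
      have "norm (d i) \<le> T ^ 2 / 8 * C0 + T ^ 2 * 1"
        using d1[of i] h1[of i] sq1[of i] 
        by (elim order.trans, intro add_mono mult_left_mono) auto
      also have "\<dots> \<le> D * T ^ 2" using C0 by (simp add: D_def algebra_simps)
      finally show ?thesis .
    qed
    have g1: "(\<Sum>i<N. norm (g i)) \<le> D * T" for N
    proof -
      have "norm (g i) = norm (d i) * norm (1 / (1 - z i))" for i by (simp add: g_def norm_divide)
      also have "\<dots> i \<le> (T ^ 2 / 8 * norm (h i) + T ^ 2 * (1 / real (Suc i) ^ 2)) * 2" for i
        using d1[of i] z3[of i] by (intro mult_mono) auto
      finally have "(\<Sum>i<N. norm (g i)) \<le> (\<Sum>i<N. T ^ 2 / 4 * norm (h i) + 2 * T ^ 2 * (1 / real (Suc i) ^ 2))"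
        by (intro sum_mono) (simp add: algebra_simps del: of_nat_Suc)
      also have "\<dots> = T ^ 2 / 4 * (\<Sum>i<N. norm (h i)) + 2 * T ^ 2 * (\<Sum>i<N. 1 / real (Suc i) ^ 2)"
        by (simp add: sum.distrib sum_distrib_left)
      also have "\<dots> \<le> T ^ 2 / 4 * (C0 * pi / (2 * T)) + 2 * T ^ 2 * 2"
        unfolding h_def T_def by (intro add_mono mult_left_mono C0(3) t sum_inverse_squares_le) auto
      also have "\<dots> = T * (C0 * (pi / 8) + 4 * T)" using T by (simp add: field_simps power2_eq_square)
      also have "\<dots> \<le> T * (C0 * 1 + 4 * 1)"
        using T C0 pi_less_4 by (intro mult_left_mono add_mono) auto
      finally show ?thesis by (simp add: D_def algebra_simps)
    qed
    have g2: "norm (g i + kap w / 4 * h i) \<le> (D + 1) * T ^ 2 * (1 / real (Suc i) ^ 2)" for i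
    proof -
      \<comment> \<open>The part d i * z i carries the factor 1 / (i + 1)^2 and therefore sums to
        O(T^2); so does the pole remainder. Only \<kappa> / 4 * h i can contribute to order
        T.\<close>
      have "g i = - d i - d i * z i * (1 / (1 - z i))" using z4[of i] by (simp add: g_def field_simps)
      hence "g i + kap w / 4 * h i = - ((kap w - w ^ 2) / t ^ 2 / of_nat (Suc i) ^ 2) - d i * z i * (1 / (1 - z i))"
        unfolding deq by simp
      also have "norm \<dots> \<le> T ^ 2 * (1 / real (Suc i) ^ 2) + D * T ^ 2 * (1 / 4 * (1 / real (Suc i) ^ 2)) * 2"
        unfolding norm_minus_cancel[of "_ / _"]
      proof (rule order.trans[OF norm_triangle_ineq4], intro add_mono)
        show "norm (d i * z i * (1 / (1 - z i))) \<le> D * T ^ 2 * (1 / 4 * (1 / real (Suc i) ^ 2)) * 2"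
          unfolding norm_mult using z1[of i] z3[of i] d2[of i] D by (intro mult_mono) auto
      qed (use k3[of i] in simp)
      also have "\<dots> \<le> (D + 1) * T ^ 2 * (1 / real (Suc i) ^ 2)"
      proof -
        define q where "q = T ^ 2 * (1 / real (Suc i) ^ 2)"
        have "D * q \<ge> 0" using D by (simp add: q_def)
        hence "q + D * q * (1 / 4) * 2 \<le> (D + 1) * q" by (simp add: ring_distribs)
        thus ?thesis by (simp add: q_def mult_ac)
      qed
      finally show ?thesis .
    qed
    have bd: "norm ((\<Prod>i<N. 1 + g i) - 1 + kap w / 4 * (\<Sum>i<N. h i)) \<le> K * T ^ 2" for N
    proof -
      have "(\<Prod>i<N. 1 + g i) - 1 + kap w / 4 * (\<Sum>i<N. h i) =
        ((\<Prod>i<N. 1 + g i) - 1 - (\<Sum>i<N. g i)) + (\<Sum>i<N. g i + kap w / 4 * h i)"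
        by (simp add: sum.distrib sum_distrib_left)
      also have "norm \<dots> \<le> (D * T) ^ 2 + (\<Sum>i<N. (D + 1) * T ^ 2 * (1 / real (Suc i) ^ 2))"
        by (intro norm_triangle_mono norm_prod_one_plus_quadratic g1 DT sum_norm_le g2)
      also have "\<dots> \<le> (D * T) ^ 2 + (D + 1) * T ^ 2 * 2"
        unfolding sum_distrib_left[symmetric] using D
        by (intro add_left_mono mult_left_mono sum_inverse_squares_le) auto
      also have "\<dots> = K * T ^ 2" by (simp add: K_def algebra_simps power_mult_distrib)
      finally show ?thesis .
    qed
    have "h sums csch_sum t" unfolding csch_sum_def h_def
      using summable_norm_cancel[OF summable_csch_reg[OF t(1,2)]] by (rule summable_sums)
    hence lim_h: "(\<lambda>N. \<Sum>i<N. h i) \<longlonglongrightarrow> csch_sum t" by (simp add: sums_def)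
    have sinc0: "sincpi s \<noteq> 0" using norm_sincpi_ge[OF s] by auto
    have "(\<lambda>N. (\<Prod>n<N. 1 - kap w * csch2 (of_nat (Suc n) * t)) / (\<Prod>n<N. 1 - s ^ 2 / of_nat (Suc n) ^ 2))
       \<longlonglongrightarrow> kap_prod w t / sincpi s"
      by (intro tendsto_divide kap_prod_tendsto sincpi_tendsto Re w sinc0)
    moreover have "1 - kap w * csch2 (of_nat (Suc n) * t) = (1 - z n) * (1 + g n)" for n
      using z4[of n] by (simp add: g_def d_def field_simps)
    hence "(\<Prod>n<N. 1 - kap w * csch2 (of_nat (Suc n) * t)) / (\<Prod>n<N. 1 - s ^ 2 / of_nat (Suc n) ^ 2)
         = (\<Prod>n<N. 1 + g n)" for N
      using z4 by (simp add: prod.distrib z_def del: of_nat_Suc)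
    ultimately have lim_g: "(\<lambda>N. \<Prod>n<N. 1 + g n) \<longlonglongrightarrow> kap_prod w t / sincpi s" by simp
    have "norm (kap_prod w t / sincpi s - 1 + kap w / 4 * csch_sum t) \<le> K * T ^ 2"
      by (rule Lim_norm_ubound[OF _ tendsto_add[OF tendsto_diff[OF lim_g tendsto_const] tendsto_mult[OF tendsto_const lim_h]]])
         (use bd in auto)
    moreover have "norm (kap w / 4 * (csch_sum t + 2 / t - 1 / 6)) \<le> T ^ 2 / 8 * (C1 * 1)"
    proof -
      have "norm (csch_sum t + 2 / t - 1 / 6) \<le> C1 * T" using C1(2)[of t] t T by (simp add: T_def)
      also have "\<dots> \<le> C1 * 1" using C1 T by (intro mult_left_mono) auto
      finally show ?thesis unfolding norm_mult using k2 by (intro mult_mono) auto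
    qed
    moreover have "norm ((kap w - w ^ 2) / (2 * t)) \<le> T ^ 2 / 32"
    proof -
      have "norm ((kap w - w ^ 2) / (2 * t)) \<le> (T ^ 4 / 16) / (2 * T)"
        using k1 T unfolding norm_divide by (intro frac_le) (auto simp: T_def norm_mult)
      also have "\<dots> = T ^ 2 * T / 32" using T by (simp add: field_simps power4_eq_xxxx power2_eq_square)
      also have "\<dots> \<le> T ^ 2 * 1 / 32" using T by (intro divide_right_mono mult_left_mono) auto
      finally show ?thesis by simp
    qed
    moreover have "norm (kap w / 24) \<le> T ^ 2 / 48" using k2 by (simp add: norm_divide)
    \<comment> \<open>\<kappa> / 4 * (2 / t - 1 / 6) = \<kappa> / (2 t) - \<kappa> / 24: replacing
      \<kappa> by w^2 in the first term and dropping the second cost at most O(T^2) each.\<close>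
    moreover have "kap_prod w t / sincpi s - (1 + w ^ 2 / (2 * t)) =
       (kap_prod w t / sincpi s - 1 + kap w / 4 * csch_sum t) - kap w / 4 * (csch_sum t + 2 / t - 1 / 6)
       + (kap w - w ^ 2) / (2 * t) - kap w / 24"
      using t by (simp add: field_simps)
    ultimately have "norm (kap_prod w t / sincpi s - (1 + w ^ 2 / (2 * t))) \<le> 
       K * T ^ 2 + T ^ 2 / 8 * (C1 * 1) + T ^ 2 / 32 + T ^ 2 / 48"
      by (simp only:) (intro norm_triangle_mono order.trans[OF norm_triangle_ineq4] add_mono; assumption)
    also have "\<dots> = (K + C1 / 8 + 1 / 32 + 1 / 48) * T ^ 2" by (simp add: algebra_simps)
    also have "\<dots> \<le> (K + C1 + 2) * T ^ 2" using C1 by (intro mult_right_mono) auto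
    finally have main: "norm (kap_prod w t / sincpi s - (1 + w ^ 2 / (2 * t))) \<le> (K + C1 + 2) * T ^ 2" .
    thus "norm (kap_prod w t / sincpi (w / t) - (1 + w ^ 2 / (2 * t))) \<le> (K + C1 + 2) * norm t ^ 2"
      by (simp add: s_def T_def)
  qed (use K C1 D in auto)
qed

section \<open>The partition generating function near 1\<close>

lemma csch2_exp: "csch2 u = exp (- u) / (1 - exp (- u)) ^ 2"
proof -
  have "4 * sinh (u / 2) ^ 2 = exp u + exp (- u) - 2" using kap_eq[of u] by (simp add: kap_def)
  also have "\<dots> = exp u * (1 - exp (- u)) ^ 2"
  proof -
    have "exp u * (1 - exp (- u)) ^ 2 = exp u - 2 * (exp u * exp (- u)) + (exp u * exp (- u)) * exp (- u)"
      by (simp add: power2_eq_square algebra_simps)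
    also have "exp u * exp (- u) = 1" by (simp flip: exp_add)
    finally show ?thesis by simp
  qed
  finally have e: "4 * sinh (u / 2) ^ 2 = exp u * (1 - exp (- u)) ^ 2" .
  have "1 / (exp u * x) = exp (- u) / x" for x :: complex by (simp add: exp_minus divide_inverse)
  thus ?thesis unfolding csch2_def e .
qed

lemma one_minus_exp_power_nonzero:
  assumes "Re t > 0"
  shows "1 - exp (- t) ^ Suc n \<noteq> 0"
proof
  assume "1 - exp (- t) ^ Suc n = 0"
  hence "norm (exp (- t) ^ Suc n) = 1" by (metis eq_iff_diff_eq_0 norm_one)
  moreover have "norm (exp (- t) ^ Suc n) < 1" unfolding norm_power
    using assms by (subst power_less_one_iff) (auto simp: norm_exp_eq_Re)
  ultimately show False by simp
qed

text \<open>Ties \<open>kap_prod\<close> to the factors of the generating function: by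
  \<open>csch2_exp\<close>, a_n is Q / (1 - Q)^2 for the power Q of q.\<close>

lemma one_minus_kap_csch2:
  assumes "Re t > 0"
  shows "1 - kap w * csch2 (of_nat (Suc n) * t) =
    (1 - exp w * exp (- t) ^ Suc n) * (1 - exp (- w) * exp (- t) ^ Suc n) / (1 - exp (- t) ^ Suc n) ^ 2"
proof -
  define Q where "Q = exp (- t) ^ Suc n"
  have Q: "exp (- (of_nat (Suc n) * t)) = Q" unfolding Q_def by (metis exp_of_nat_mult mult_minus_right)
  have ne: "1 - Q \<noteq> 0" unfolding Q_def by (rule one_minus_exp_power_nonzero[OF assms])
  have "exp w * exp (- w) = 1" by (simp flip: exp_add)
  hence "(1 - exp w * Q) * (1 - exp (- w) * Q) = (1 - Q) ^ 2 - kap w * Q"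
    by (simp add: kap_def power2_eq_square algebra_simps)
  thus ?thesis unfolding csch2_exp Q using ne by (fold Q_def) (simp add: field_simps)
qed

text \<open>A logarithm of the partition generating function P at q = exp (- t): expand each - log
  (1 - q^j) and sum over j first. Being a convergent series it comes without a choice of
  branch.\<close>

definition log_partition :: "complex \<Rightarrow> complex" where
  "log_partition t = (\<Sum>m. 1 / (of_nat (Suc m) * (exp (of_nat (Suc m) * t) - 1)))"

lemma norm_exp_minus_one_ge:
  assumes "Re u > 0"
  shows "Re u \<le> norm (exp u - 1)"
proof -
  have "Re u \<le> exp (Re u) - 1" using exp_ge_add_one_self[of "Re u"] by linarith
  also have "\<dots> \<le> norm (exp u - 1)" using norm_triangle_ineq2[of "exp u" 1] by (simp add: norm_exp_eq_Re)
  finally show ?thesis .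
qed

lemma log_partition_term_bound:
  assumes "Re t > 0"
  shows "norm (1 / (of_nat (Suc m) * (exp (of_nat (Suc m) * t) - 1))) \<le> 1 / Re t * (1 / real (Suc m) ^ 2)"
proof -
  have "real (Suc m) * Re t \<le> norm (exp (of_nat (Suc m) * t) - 1)"
    using norm_exp_minus_one_ge[of "of_nat (Suc m) * t"] assms by simp
  hence "real (Suc m) * (real (Suc m) * Re t) \<le> norm (of_nat (Suc m) * (exp (of_nat (Suc m) * t) - 1))"
    unfolding norm_mult norm_of_nat by (intro mult_left_mono) auto
  hence "1 / norm (of_nat (Suc m) * (exp (of_nat (Suc m) * t) - 1)) \<le> 1 / (real (Suc m) * (real (Suc m) * Re t))"
    using assms by (intro frac_le) auto
  thus ?thesis by (simp add: norm_divide power2_eq_square mult_ac)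
qed

lemma summable_log_partition:
  assumes "Re t > 0"
  shows "summable (\<lambda>m. norm (1 / (of_nat (Suc m) * (exp (of_nat (Suc m) * t) - 1))))"
  by (rule summable_comparison_test'[OF summable_mult[OF sums_summable[OF sums_inverse_squares], of "1 / Re t"]])
     (use log_partition_term_bound[OF assms] in auto)

lemma log_partition_sums:
  assumes "Re t > 0"
  shows "(\<lambda>m. 1 / (of_nat (Suc m) * (exp (of_nat (Suc m) * t) - 1))) sums log_partition t"
  unfolding log_partition_def using summable_norm_cancel[OF summable_log_partition[OF assms]]
  by (rule summable_sums)

lemma log_partition_of_real:
  assumes "x > 0"
  shows "log_partition (of_real x) = of_real (Re (log_partition (of_real x)))"
proof -
  have "(\<lambda>m. 1 / (of_nat (Suc m) * (exp (of_nat (Suc m) * of_real x) - 1))) = 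
        (\<lambda>m. complex_of_real (1 / (real (Suc m) * (exp (real (Suc m) * x) - 1))))"
    by (simp add: exp_of_real[symmetric] fun_eq_iff)
  hence s: "(\<lambda>m. complex_of_real (1 / (real (Suc m) * (exp (real (Suc m) * x) - 1)))) sums log_partition (of_real x)"
    using log_partition_sums[of "of_real x"] assms by simp
  hence "(\<lambda>m. Im (complex_of_real (1 / (real (Suc m) * (exp (real (Suc m) * x) - 1))))) sums Im (log_partition (of_real x))"
    by (rule sums_Im)
  hence "Im (log_partition (of_real x)) = 0" by (simp add: sums_iff)
  thus ?thesis by (simp add: complex_eq_iff)
qed

text \<open>Meant for the vertical part of the contour. Only the first term keeps its true
  denominator |exp t - 1|, which is noticeably larger than Re t there; the others are estimated by 1
  / (m^2 Re t), hence pi^2 / 6 - 1.\<close>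

lemma norm_exp_log_partition_le:
  assumes "Re t > 0"
  shows "norm (exp (log_partition t)) \<le> exp (1 / norm (exp t - 1) + (pi ^ 2 / 6 - 1) / Re t)"
proof -
  let ?f = "\<lambda>m. 1 / (of_nat (Suc m) * (exp (of_nat (Suc m) * t) - 1))"
  have "norm (log_partition t) \<le> (\<Sum>m. norm (?f m))"
    unfolding log_partition_def by (rule summable_norm[OF summable_log_partition[OF assms]])
  also have "\<dots> = norm (?f 0) + (\<Sum>m. norm (?f (Suc m)))"
    using suminf_split_initial_segment[OF summable_log_partition[OF assms], of 1] by simp
  also have "(\<Sum>m. norm (?f (Suc m))) \<le> (\<Sum>m. 1 / Re t * (1 / real (Suc (Suc m)) ^ 2))"
    using log_partition_term_bound[OF assms] summable_log_partition[OF assms] sums_summable[OF sums_inverse_squares]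
    by (intro suminf_le summable_mult) (auto simp only: summable_Suc_iff[of "\<lambda>m. norm (?f m)"] summable_Suc_iff[of "\<lambda>m. 1 / real (Suc m) ^ 2"])
  also have "(\<Sum>m. 1 / Re t * (1 / real (Suc (Suc m)) ^ 2)) = 1 / Re t * (pi ^ 2 / 6 - 1)"
  proof -
    have "(\<lambda>m. 1 / real (Suc (Suc m)) ^ 2) sums (pi ^ 2 / 6 - 1)"
      using sums_inverse_squares sums_Suc_iff[of "\<lambda>m. 1 / real (Suc m) ^ 2" "pi ^ 2 / 6 - 1"] by simp
    from sums_mult[OF this, of "1 / Re t"] show ?thesis by (simp add: sums_iff)
  qed
  finally have *: "norm (log_partition t) \<le> 1 / norm (exp t - 1) + (pi ^ 2 / 6 - 1) / Re t"
    by (simp add: norm_divide)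
  have "norm (exp (log_partition t)) = exp (Re (log_partition t))" by (simp add: norm_exp_eq_Re)
  also have "\<dots> \<le> exp (1 / norm (exp t - 1) + (pi ^ 2 / 6 - 1) / Re t)"
    using * complex_Re_le_cmod[of "log_partition t"] by simp
  finally show ?thesis .
qed

lemma log_series_exp:
  fixes z :: complex
  assumes "norm z < 1"
  obtains l where "(\<lambda>m. z ^ Suc m / of_nat (Suc m)) sums l" "exp l = inverse (1 - z)"
proof -
  have "(\<lambda>n. - ((-(-z)) ^ n) / of_nat n) sums ln (1 + (-z))" by (rule Ln_series') (use assms in simp)
  hence "(\<lambda>n. z ^ n / of_nat n) sums (- ln (1 - z))" using sums_minus by fastforce
  hence "(\<lambda>m. z ^ Suc m / of_nat (Suc m)) sums (- ln (1 - z))"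
    by (subst sums_Suc_iff) simp
  moreover have "1 - z \<noteq> 0" using assms by auto
  hence "exp (- ln (1 - z)) = inverse (1 - z)" by (simp add: exp_minus)
  ultimately show ?thesis using that by blast
qed

text \<open>Finite products avoid the interchange of two infinite sums: summing the logarithmic
  series over j < N is a finite geometric sum and gives the m-th term times 1 - q^(m N). The
  deviation from the full series is at most |q|^N times a constant.\<close>

lemma partition_prod_tendsto:
  assumes "Re t > 0"
  shows "(\<lambda>N. \<Prod>j<N. 1 - exp (- t) ^ Suc j) \<longlonglongrightarrow> exp (- log_partition t)"
proof -
  define q where "q = exp (- t)"
  have q: "norm q < 1" "q \<noteq> 0" using assms by (auto simp: q_def norm_exp_eq_Re)
  let ?f = "\<lambda>m. 1 / (of_nat (Suc m) * (exp (of_nat (Suc m) * t) - 1))"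
  have qf: "q ^ Suc m / (1 - q ^ Suc m) / of_nat (Suc m) = ?f m" for m
  proof -
    have *: "exp (of_nat (Suc m) * t) = inverse (q ^ Suc m)"
      unfolding q_def exp_minus power_inverse exp_of_nat_mult by simp
    have "1 - q ^ Suc m \<noteq> 0" unfolding q_def by (rule one_minus_exp_power_nonzero[OF assms])
    moreover have "q ^ Suc m \<noteq> 0" using q by simp
    ultimately show ?thesis unfolding * by (simp add: field_simps del: power_Suc of_nat_Suc)
  qed
  define S where "S = (\<lambda>N. \<Sum>m. (1 - q ^ (Suc m * N)) * ?f m)"
  have geo: "(\<Sum>j<N. (q ^ Suc j) ^ Suc m / of_nat (Suc m)) = (1 - q ^ (Suc m * N)) * ?f m" for N m
  proof -
    have ne: "q ^ Suc m \<noteq> 1" using one_minus_exp_power_nonzero[OF assms, of m] by (auto simp: q_def)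
    have "(\<Sum>j<N. (q ^ Suc j) ^ Suc m) = q ^ Suc m * (\<Sum>j<N. (q ^ Suc m) ^ j)"
      unfolding sum_distrib_left by (intro sum.cong refl) (simp add: power_mult[symmetric] power_add[symmetric] algebra_simps del: power_Suc)
    also have "(\<Sum>j<N. (q ^ Suc m) ^ j) = (1 - q ^ (Suc m * N)) / (1 - q ^ Suc m)"
    proof -
      have "(a - 1) / (b - 1) = (1 - a) / (1 - b)" for a b :: complex
        by (metis minus_diff_eq minus_divide_divide)
      thus ?thesis unfolding geometric_sum[OF ne] power_mult .
    qed
    finally show ?thesis unfolding qf[symmetric] by (simp add: sum_divide_distrib[symmetric] mult_ac)
  qed
  have fin: "(\<Prod>j<N. 1 - q ^ Suc j) = exp (- S N)" for N
  proof -
    have "\<exists>l. (\<lambda>m. (q ^ Suc j) ^ Suc m / of_nat (Suc m)) sums l \<and> exp l = inverse (1 - q ^ Suc j)" for j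
    proof -
      have "norm (q ^ Suc j) < 1" unfolding norm_power using q by (subst power_less_one_iff) auto
      thus ?thesis using log_series_exp[of "q ^ Suc j"] by metis
    qed
    then obtain l where l: "\<And>j. (\<lambda>m. (q ^ Suc j) ^ Suc m / of_nat (Suc m)) sums l j"
       "\<And>j. exp (l j) = inverse (1 - q ^ Suc j)" by metis
    have "(\<lambda>m. \<Sum>j<N. (q ^ Suc j) ^ Suc m / of_nat (Suc m)) sums (\<Sum>j<N. l j)"
      by (intro sums_sum l)
    hence "(\<Sum>j<N. l j) = S N" unfolding geo S_def by (simp add: sums_iff)
    hence "exp (- S N) = (\<Prod>j<N. exp (- l j))"
      unfolding exp_sum[OF finite_lessThan, symmetric] by (simp add: sum_negf)
    thus ?thesis by (simp add: exp_minus l)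
  qed
  have "S \<longlonglongrightarrow> log_partition t"
  proof (rule Lim_transform)
    define B where "B = (\<Sum>m. norm (?f m))"
    show "(\<lambda>N. log_partition t) \<longlonglongrightarrow> log_partition t" by simp
    have bd2: "norm (S N - log_partition t) \<le> norm q ^ N * B" for N
    proof -
      have bd: "norm (q ^ (Suc m * N) * ?f m) \<le> norm q ^ N * norm (?f m)" for m
        unfolding norm_mult norm_power using q by (intro mult_right_mono power_decreasing) auto
      have sm: "summable (\<lambda>m. norm (q ^ (Suc m * N) * ?f m))"
        by (rule summable_comparison_test'[OF summable_mult[OF summable_log_partition[OF assms], of "norm q ^ N"]])
           (use bd in auto)
      have "(\<lambda>m. ?f m - q ^ (Suc m * N) * ?f m) sums (log_partition t - (\<Sum>m. q ^ (Suc m * N) * ?f m))"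
        by (intro sums_diff log_partition_sums assms summable_sums summable_norm_cancel[OF sm])
      hence "S N = log_partition t - (\<Sum>m. q ^ (Suc m * N) * ?f m)"
        unfolding S_def left_diff_distrib mult_1_left by (rule sums_unique[symmetric])
      hence "norm (S N - log_partition t) = norm (\<Sum>m. q ^ (Suc m * N) * ?f m)" by (simp add: norm_minus_commute)
      also have "\<dots> \<le> (\<Sum>m. norm (q ^ (Suc m * N) * ?f m))" by (rule summable_norm[OF sm])
      also have "\<dots> \<le> (\<Sum>m. norm q ^ N * norm (?f m))"
        by (intro suminf_le bd sm summable_mult summable_log_partition assms)
      also have "\<dots> = norm q ^ N * B" unfolding B_def by (rule suminf_mult[OF summable_log_partition[OF assms]])
      finally show ?thesis .
    qed
    have "(\<lambda>N. norm q ^ N * B) \<longlonglongrightarrow> 0 * B"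
      by (intro tendsto_mult tendsto_const LIMSEQ_power_zero) (use q in simp)
    hence lim0: "(\<lambda>N. norm q ^ N * B) \<longlonglongrightarrow> 0" by simp
    show "(\<lambda>N. S N - log_partition t) \<longlonglongrightarrow> 0"
      by (rule Lim_null_comparison[OF always_eventually lim0]) (use bd2 in blast)
  qed
  hence "(\<lambda>N. exp (- S N)) \<longlonglongrightarrow> exp (- log_partition t)" by (intro tendsto_intros)
  thus ?thesis by (simp add: fin[symmetric] q_def)
qed

lemma crank_prod_tendsto:
  assumes "Re t > 0" "norm w \<le> Re t / 2"
  shows "(\<lambda>N. \<Prod>j<N. (1 - exp (- t) ^ Suc j) / 
             ((1 - exp w * exp (- t) ^ Suc j) * (1 - exp (- w) * exp (- t) ^ Suc j)))
          \<longlonglongrightarrow> exp (log_partition t) / kap_prod w t"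
proof -
  have "(\<lambda>N. inverse (\<Prod>j<N. 1 - exp (- t) ^ Suc j) / (\<Prod>n<N. 1 - kap w * csch2 (of_nat (Suc n) * t)))
          \<longlonglongrightarrow> inverse (exp (- log_partition t)) / kap_prod w t"
    using kap_prod_ge[OF assms]
    by (intro tendsto_divide tendsto_inverse partition_prod_tendsto kap_prod_tendsto assms) auto
  moreover have a: "inverse a / (b * c / a ^ 2) = a / (b * c)" if "a \<noteq> 0" for a b c :: complex
    using that by (cases "b * c = 0") (auto simp: field_simps power2_eq_square)
  moreover have "(\<lambda>N. inverse (\<Prod>j<N. 1 - exp (- t) ^ Suc j) / (\<Prod>n<N. 1 - kap w * csch2 (of_nat (Suc n) * t)))
    = (\<lambda>N. \<Prod>j<N. (1 - exp (- t) ^ Suc j) / 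
             ((1 - exp w * exp (- t) ^ Suc j) * (1 - exp (- w) * exp (- t) ^ Suc j)))"
    unfolding prod_inversef[symmetric] prod_dividef[symmetric] one_minus_kap_csch2[OF assms(1)] o_def
    by (intro ext prod.cong refl a one_minus_exp_power_nonzero[OF assms(1)])
  ultimately show ?thesis by (simp only:) (simp add: exp_minus)
qed

text \<open>At w = t / 2 the products x q^n and q^n / x are odd powers of r = exp (- t / 2). A
  product over odd powers is the product over all powers, a reciprocal of P at t / 2, divided by the
  one over even powers, a reciprocal of P at t. The second assumption says that t is real.\<close>

lemma kap_prod_half:
  assumes "Re t > 0" "norm t \<le> Re t"
  shows "kap_prod (t / 2) t = exp (4 * log_partition t - 2 * log_partition (t / 2)) / (1 - exp (- t / 2))"
proof -
  define r where "r = exp (- t / 2)"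
  have r: "norm r < 1" using assms by (simp add: r_def norm_exp_eq_Re)
  have q: "exp (- t) = r ^ 2" by (simp add: r_def exp_double[symmetric])
  have r1: "r = exp (- (t / 2))" by (simp add: r_def)
  have rinv: "exp (t / 2) * r = 1" by (simp add: r_def flip: exp_add)
  let ?O = "\<lambda>N. \<Prod>j<N. 1 - r ^ (2 * j + 1)" and ?B = "\<lambda>N. \<Prod>j<N. 1 - exp (- t) ^ Suc j"
  have ne: "1 - r ^ Suc n \<noteq> 0" for n
    using one_minus_exp_power_nonzero[of "t / 2" n] assms by (simp add: r1)
  have ne': "1 - exp (- t) ^ Suc n \<noteq> 0" for n by (rule one_minus_exp_power_nonzero[OF assms(1)])
  have fac: "1 - kap (t / 2) * csch2 (of_nat (Suc n) * t) = 
     (1 - r ^ (2 * n + 1)) * (1 - r ^ (2 * n + 3)) / (1 - exp (- t) ^ Suc n) ^ 2" for n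
  proof -
    have qn: "exp (- t) ^ Suc n = r ^ (2 * n + 2)"
      unfolding q power_mult[symmetric] by (simp add: power2_eq_square)
    have "exp (t / 2) * exp (- t) ^ Suc n = (exp (t / 2) * r) * r ^ (2 * n + 1)"
      unfolding qn by simp
    hence 1: "exp (t / 2) * exp (- t) ^ Suc n = r ^ (2 * n + 1)" unfolding rinv by simp
    have 2: "exp (- (t / 2)) * exp (- t) ^ Suc n = r ^ (2 * n + 3)"
      unfolding qn r1[symmetric] by (simp add: numeral_3_eq_3)
    show ?thesis unfolding one_minus_kap_csch2[OF assms(1)] 1 2 ..
  qed
  have O2: "?O N * ?B N = (\<Prod>j<2 * N. 1 - r ^ Suc j)" for N
    by (induction N) (simp_all add: q power_mult[symmetric] mult_ac del: power_Suc)
  \<comment> \<open>The same product shifted by one index, so it lacks the factor 1 - r; this is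
    where the denominator of the result comes from.\<close>
  have O3: "(\<Prod>j<N. 1 - r ^ (2 * j + 3)) = ?O N * (1 - r ^ (2 * N + 1)) / (1 - r)" for N
  proof -
    have "(\<Prod>j<N. 1 - r ^ (2 * j + 3)) * (1 - r) = (\<Prod>j<Suc N. 1 - r ^ (2 * j + 1))"
      by (subst prod.lessThan_Suc_shift) (simp add: numeral_3_eq_3 mult_ac)
    moreover have "1 - r \<noteq> 0" using ne[of 0] by simp
    ultimately show ?thesis by (subst nonzero_eq_divide_eq) (simp_all add: prod.lessThan_Suc)
  qed
  have O: "?O N = (\<Prod>j<2 * N. 1 - r ^ Suc j) / ?B N" for N
  proof -
    have "?B N \<noteq> 0" using ne' by simp
    thus ?thesis using O2[of N] by (subst nonzero_eq_divide_eq) auto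
  qed
  have eqn: "(\<Prod>n<N. 1 - kap (t / 2) * csch2 (of_nat (Suc n) * t)) =
     ((\<Prod>j<2 * N. 1 - r ^ Suc j) / ?B N) ^ 2 * (1 - r ^ (2 * N + 1)) / (1 - r) / ?B N ^ 2" for N
    unfolding fac prod_dividef prod.distrib prod_power_distrib[symmetric] O3 unfolding O
    by (simp add: power2_eq_square mult_ac)
  have lim: "(\<lambda>N. ((\<Prod>j<2 * N. 1 - r ^ Suc j) / ?B N) ^ 2 * (1 - r ^ (2 * N + 1)) / (1 - r) / ?B N ^ 2)
     \<longlonglongrightarrow> (exp (- log_partition (t / 2)) / exp (- log_partition t)) ^ 2 * (1 - 0) / (1 - r) / exp (- log_partition t) ^ 2"
  proof (intro tendsto_intros partition_prod_tendsto assms)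
    have "(\<lambda>N. \<Prod>j<N. 1 - r ^ Suc j) \<longlonglongrightarrow> exp (- log_partition (t / 2))"
      using partition_prod_tendsto[of "t / 2"] assms by (simp add: r1)
    thus "(\<lambda>N. \<Prod>j<2 * N. 1 - r ^ Suc j) \<longlonglongrightarrow> exp (- log_partition (t / 2))"
      by (rule filterlim_compose) (rule mult_nat_left_at_top, simp)
    show "(\<lambda>N. r ^ (2 * N + 1)) \<longlonglongrightarrow> 0"
    proof (rule filterlim_compose[OF LIMSEQ_power_zero[OF r]])
      show "filterlim (\<lambda>N. 2 * N + 1) at_top sequentially"
        by (rule filterlim_subseq) (auto simp: strict_mono_def)
    qed
  qed (use ne[of 0] in auto)
  have "norm (t / 2) \<le> Re t / 2" using assms by simp
  hence "kap_prod (t / 2) t = (exp (- log_partition (t / 2)) / exp (- log_partition t)) ^ 2 * (1 - 0) / (1 - r) / exp (- log_partition t) ^ 2"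
    using LIMSEQ_unique[OF kap_prod_tendsto[OF assms(1), of "t / 2", unfolded eqn] lim] by blast
  also have "\<dots> = exp (4 * log_partition t - 2 * log_partition (t / 2)) / (1 - r)"
  proof -
    have "(exp (- a) / exp (- b)) ^ 2 / exp (- b) ^ 2 = exp (4 * b - 2 * a)" for a b :: complex
      unfolding exp_diff[symmetric] exp_double[symmetric] by (simp add: algebra_simps)
    from this[of "log_partition (t / 2)" "log_partition t", symmetric] show ?thesis by simp
  qed
  finally show ?thesis by (simp add: r_def)
qed

text \<open>Differentiating the m-th term in t gives exactly - a_m. Termwise differentiation is
  justified on the half-plane Re u > Re t / 2, where the terms are uniformly dominated.\<close>

lemma log_partition_deriv:
  assumes t: "t \<in> sector" "t \<noteq> 0"
  shows "(log_partition has_field_derivative - (csch_sum t / 4 + of_real (pi ^ 2 / 6) / t ^ 2)) (at t)"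
proof -
  have Re: "Re t > 0" using t by (rule sector_Re_pos)
  let ?f = "\<lambda>m t. 1 / (of_nat (Suc m) * (exp (of_nat (Suc m) * t) - 1))"
  define S where "S = {u. Re u > Re t / 2}"
  have "open S" unfolding S_def by (rule open_halfspace_Re_gt)
  moreover have "t \<in> S" using Re by (simp add: S_def)
  ultimately have S: "open S" "t \<in> S" .
  have Sp: "Re u > 0" if "u \<in> S" for u using that Re by (simp add: S_def)
  obtain g g' where g: "\<forall>x \<in> S. ((\<lambda>n. ?f n x) sums g x) \<and> ((\<lambda>n. - csch2 (of_nat (Suc n) * x)) sums g' x) \<and> 
      (g has_field_derivative g' x) (at x)"
  proof (rule series_and_derivative_comparison[OF S(1), of "\<lambda>n. 2 / Re t * (1 / real (Suc n) ^ 2)" ?f])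
    show "summable (\<lambda>n. 2 / Re t * (1 / real (Suc n) ^ 2))"
      using sums_summable[OF sums_inverse_squares] by (rule summable_mult)
    show "(?f n has_field_derivative - csch2 (of_nat (Suc n) * u)) (at u)" if "u \<in> S" for n u
    proof -
      define x where "x = exp (of_nat (Suc n) * u)"
      have "Re (of_nat (Suc n) * u) > 0" using Sp[OF that] by simp
      from norm_exp_minus_one_ge[OF this] this have ne: "x - 1 \<noteq> 0" by (auto simp: x_def)
      have nz: "of_nat (Suc n) \<noteq> (0::complex)" by (rule of_nat_neq_0)
      have cancel: "- (a * (a * x)) / (a * y) ^ 2 = - (x / y ^ 2)" if "a \<noteq> 0" for a y :: complex
        using that by (simp add: power2_eq_square)
      have "csch2 (of_nat (Suc n) * u) = x / (x - 1) ^ 2"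
        using ne unfolding csch2_exp exp_minus x_def[symmetric]
      proof -
        have "x \<noteq> 0" by (simp add: x_def)
        hence "1 - inverse x = (x - 1) / x" by (simp add: field_simps)
        thus "inverse x / (1 - inverse x) ^ 2 = x / (x - 1) ^ 2"
          using \<open>x \<noteq> 0\<close> ne by (simp add: power2_eq_square divide_simps)
      qed
      moreover have "(?f n has_field_derivative - (of_nat (Suc n) * (of_nat (Suc n) * x)) / (of_nat (Suc n) * (x - 1)) ^ 2) (at u)"
        using ne nz unfolding x_def
        by (auto intro!: derivative_eq_intros simp: power2_eq_square simp del: of_nat_Suc)
      moreover have "- (of_nat (Suc n) * (of_nat (Suc n) * x)) / (of_nat (Suc n) * (x - 1)) ^ 2 = - (x / (x - 1) ^ 2)"
        using nz by (rule cancel)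
      ultimately show ?thesis by simp
    qed
    have "norm (?f n u) \<le> 2 / Re t * (1 / real (Suc n) ^ 2)" if "u \<in> S" for n u
    proof -
      have "norm (?f n u) \<le> 1 / Re u * (1 / real (Suc n) ^ 2)"
        using Sp[OF that] by (rule log_partition_term_bound)
      moreover have "1 / Re u \<le> 1 / (Re t / 2)" using that Sp[OF that] Re
        by (intro divide_left_mono) (auto simp: S_def)
      hence "1 / Re u * (1 / real (Suc n) ^ 2) \<le> 1 / (Re t / 2) * (1 / real (Suc n) ^ 2)"
        by (rule mult_right_mono) simp
      ultimately show ?thesis by simp
    qed
    thus "\<forall>\<^sub>F n in sequentially. \<forall>u\<in>S. norm (?f n u) \<le> 2 / Re t * (1 / real (Suc n) ^ 2)" by auto
  qed blast
  have "g u = log_partition u" if "u \<in> S" for u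
    using g that log_partition_sums[OF Sp[OF that]] sums_unique2 by blast
  hence "(log_partition has_field_derivative g' t) (at t)"
    using g S has_field_derivative_transform_within_open[of g "g' t" t S log_partition] by blast
  moreover have "g' t = - (csch_sum t / 4 + of_real (pi ^ 2 / 6) / t ^ 2)"
    using g S(2) sums_minus[OF csch2_sum[OF t]] sums_unique2 by blast
  ultimately show ?thesis by simp
qed

section \<open>The asymptotics of P including its constant factor\<close>

lemma norm_exp_minus_one_le:
  assumes "norm (z::complex) \<le> 1"
  shows "norm (exp z - 1) \<le> 3 * norm z"
proof -
  have "norm (exp z - (\<Sum>k\<le>0. z ^ k / fact k)) \<le> exp \<bar>Re z\<bar> * norm z ^ Suc 0 / fact 0" by (rule Taylor_exp)
  moreover have "exp \<bar>Re z\<bar> \<le> exp (1::real)" using assms abs_Re_le_cmod[of z] by auto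
  hence "exp \<bar>Re z\<bar> \<le> 3" using exp_le by linarith
  hence "exp \<bar>Re z\<bar> * norm z \<le> 3 * norm z" by (intro mult_right_mono) auto
  ultimately show ?thesis by simp
qed

text \<open>The deviation of log P from its expansion without the constant term. Its exponential
  turns out to tend to 1 / sqrt (2 pi); at first only its variation is controlled.\<close>

definition partition_err :: "complex \<Rightarrow> complex" where
  "partition_err t = log_partition t - of_real (pi ^ 2 / 6) / t - Ln t / 2 + t / 24"

lemma closed_segment_sector:
  assumes "s \<in> sector" "t \<in> sector" "s \<noteq> 0" "t \<noteq> 0" "norm s \<le> norm t" "u \<in> closed_segment s t"
  shows "u \<in> sector" "u \<noteq> 0" "norm u \<le> norm t"
proof -
  obtain r where r: "0 \<le> r" "r \<le> 1" "u = of_real (1 - r) * s + of_real r * t"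
    using assms(6) by (auto simp: in_segment scaleR_conv_of_real)
  show "u \<in> sector" unfolding r using assms r by (intro sector_add sector_scaleR) auto
  have "Re u > 0"
  proof (cases "r = 0")
    case False
    hence "r * Re t > 0" using r sector_Re_pos[OF assms(2,4)] by simp
    moreover have "(1 - r) * Re s \<ge> 0" using r sectorD(1)[OF assms(1)] by (intro mult_nonneg_nonneg) auto
    ultimately show ?thesis unfolding r by simp
  qed (use r sector_Re_pos[OF assms(1,3)] in simp)
  thus "u \<noteq> 0" by auto
  have "norm u \<le> (1 - r) * norm s + r * norm t" unfolding r
    using r norm_triangle_ineq[of "of_real (1 - r) * s" "of_real r * t"]
    by (simp only: norm_mult norm_of_real abs_of_nonneg diff_ge_0_iff_ge)
  also have "\<dots> \<le> (1 - r) * norm t + r * norm t" using r assms by (intro add_right_mono mult_left_mono) auto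
  finally show "norm u \<le> norm t" by (simp add: algebra_simps)
qed

text \<open>The derivative is - (\<open>csch_sum u\<close> + 2 / u - 1 / 6) / 4 = O(u), and the
  segment from s to t stays in the sector with |u| \<le> |t|.\<close>

lemma partition_err_lipschitz:
  obtains C where "C > 0"
    "\<And>s t. s \<in> sector \<Longrightarrow> t \<in> sector \<Longrightarrow> s \<noteq> 0 \<Longrightarrow> t \<noteq> 0 \<Longrightarrow> norm s \<le> norm t \<Longrightarrow> norm t \<le> 1 \<Longrightarrow>
       norm (partition_err s - partition_err t) \<le> C * norm t ^ 2"
proof -
  obtain C where C: "C > 0" 
    "\<And>t. t \<in> sector \<Longrightarrow> t \<noteq> 0 \<Longrightarrow> norm t \<le> 1 \<Longrightarrow> norm (csch_sum t + 2 / t - 1 / 6) \<le> C * norm t"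
    using csch_sum_asymp by blast
  show ?thesis
  proof (rule that[of C])
    fix s t assume st: "s \<in> sector" "t \<in> sector" "s \<noteq> 0" "t \<noteq> 0" "norm s \<le> norm t" "norm t \<le> 1"
    have "norm (partition_err s - partition_err t) \<le> (C * norm t / 4) * norm (s - t)"
    proof (rule field_differentiable_bound[of "closed_segment s t"])
      fix u assume "u \<in> closed_segment s t"
      note u = closed_segment_sector[OF st(1-5) this]
      have Re: "Re u > 0" using u by (intro sector_Re_pos)
      have "u \<notin> \<real>\<^sub>\<le>\<^sub>0" using Re by (auto simp: complex_nonpos_Reals_iff)
      hence "(partition_err has_field_derivative 
        - (csch_sum u / 4 + of_real (pi ^ 2 / 6) / u ^ 2) - (- of_real (pi ^ 2 / 6) / u ^ 2) - inverse u / 2 + 1 / 24) (at u)"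
        unfolding partition_err_def using u
        by (auto intro!: derivative_eq_intros log_partition_deriv simp: power2_eq_square)
      also have "- (csch_sum u / 4 + of_real (pi ^ 2 / 6) / u ^ 2) - (- of_real (pi ^ 2 / 6) / u ^ 2) - inverse u / 2 + 1 / 24
         = - (csch_sum u + 2 / u - 1 / 6) / 4" using u by (simp add: field_simps)
      finally show "(partition_err has_field_derivative - (csch_sum u + 2 / u - 1 / 6) / 4) (at u within closed_segment s t)"
        by (rule has_field_derivative_at_within)
      have "norm (csch_sum u + 2 / u - 1 / 6) \<le> C * norm u" using u st by (intro C) auto
      also have "\<dots> \<le> C * norm t" using u C by (intro mult_left_mono) auto
      finally show "norm (- (csch_sum u + 2 / u - 1 / 6) / 4) \<le> C * norm t / 4" 
        by (simp only: norm_divide norm_minus_cancel) simp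
    qed auto
    also have "norm (s - t) \<le> norm s + norm t" by (rule norm_triangle_ineq4)
    also have "\<dots> \<le> 4 * norm t" using st norm_ge_zero[of t] by linarith
    hence "(C * norm t / 4) * (norm s + norm t) \<le> (C * norm t / 4) * (4 * norm t)"
      using C by (intro mult_left_mono) auto
    finally show "norm (partition_err s - partition_err t) \<le> C * norm t ^ 2"
      using C by (simp add: power2_eq_square mult_left_mono)
  qed (use C in auto)
qed

lemma partition_err_of_real:
  assumes "x > 0"
  shows "partition_err (of_real x) = of_real (Re (partition_err (of_real x)))"
proof -
  have "partition_err (of_real x) = of_real (Re (log_partition (of_real x)) - pi ^ 2 / 6 / x - ln x / 2 + x / 24)"
    unfolding partition_err_def by (subst log_partition_of_real[OF assms]) (use assms in \<open>simp add: Ln_of_real\<close>)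
  thus ?thesis by simp
qed

lemma sector_of_real: "x \<ge> 0 \<Longrightarrow> of_real x \<in> sector"
  by (simp add: sector_def)

text \<open>In 4 log P(x) - 2 log P(x / 2) the terms of order 1 / x cancel, the logarithms leave log
  (2 x) and the linear terms leave - x / 8. The unknown constant survives with the coefficient 4 - 2
  = 2, and \<open>sincpi (1 / 2)\<close> = 2 / pi supplies the pi.\<close>

lemma exp_partition_err_relation:
  assumes x: "x > (0::real)"
  defines "e \<equiv> \<lambda>x. Re (partition_err (of_real x))"
  shows "kap_prod (of_real x / 2) (of_real x) / sincpi (1 / 2) = 
     of_real (exp (4 * e x - 2 * e (x / 2)) * (pi * x * exp (- x / 8) / (1 - exp (- x / 2))))"
proof -
  define A where "A = (\<lambda>x. Re (log_partition (of_real x)))"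
  have e: "e x = A x - pi ^ 2 / 6 / x - ln x / 2 + x / 24" if "x > 0" for x
    using that by (simp add: e_def A_def partition_err_def Ln_of_real Re_divide_of_real)
  have eq: "4 * A x - 2 * A (x / 2) = (4 * e x - 2 * e (x / 2)) + (ln x + ln 2 - x / 8)"
    using x by (simp add: e ln_div field_simps)
  have sinc: "sincpi (1 / 2) = 2 / of_real pi"
  proof -
    have "sin (complex_of_real pi * (1 / 2)) = of_real (sin (pi / 2))" 
      by (simp add: sin_of_real[symmetric])
    thus ?thesis by (simp add: sincpi_def)
  qed
  have "exp (4 * A x - 2 * A (x / 2)) = exp (4 * e x - 2 * e (x / 2)) * (2 * x * exp (- x / 8))"
  proof -
    have "exp (ln x + ln 2 - x / 8) = exp (ln (2 * x)) * exp (- x / 8)"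
      using x by (simp add: ln_mult flip: exp_add)
    hence "exp (ln x + ln 2 - x / 8) = 2 * x * exp (- x / 8)" using x by simp
    thus ?thesis unfolding eq exp_add by (rule arg_cong)
  qed
  note 1 = this
  have 2: "kap_prod (of_real x / 2) (of_real x) = of_real (exp (4 * A x - 2 * A (x / 2)) / (1 - exp (- x / 2)))"
  proof -
    have "kap_prod (of_real x / 2) (of_real x) = 
       exp (4 * log_partition (of_real x) - 2 * log_partition (of_real (x / 2))) / (1 - exp (- of_real x / 2))"
      using x by (subst kap_prod_half) auto
    also have "\<dots> = of_real (exp (4 * A x - 2 * A (x / 2)) / (1 - exp (- x / 2)))"
      using log_partition_of_real[of x] log_partition_of_real[of "x / 2"] x
      by (simp add: A_def exp_of_real[symmetric])
    finally show ?thesis .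
  qed
  have 3: "of_real (E * (2 * x * a) / d) / (2 / of_real p) = complex_of_real (E * (p * x * a / d))" for E x a d p :: real
    by simp
  show ?thesis unfolding 2 1 sinc by (rule 3)
qed

text \<open>Compares two evaluations at s = 1/2: \<open>kap_prod_asymp\<close> gives 1 + x / 8 +
  O(x^2), \<open>exp_partition_err_relation\<close> gives exp (4 e(x) - 2 e(x / 2)) times an
  elementary factor. Since e(x / 2) - e(x) = O(x^2), this determines exp (2 e(x)).\<close>

lemma exp_partition_err_asymp_real:
  obtains C \<delta> where "C > 0" "\<delta> > 0" "\<delta> \<le> 1"
    "\<And>x. 0 < x \<Longrightarrow> x \<le> \<delta> \<Longrightarrow> \<bar>exp (Re (partition_err (of_real x))) * sqrt (2 * pi) - 1\<bar> \<le> C * x ^ 2"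
proof -
  define e where "e = (\<lambda>x::real. Re (partition_err (of_real x)))"
  obtain C1 \<delta>1 where C1: "C1 > 0" "\<delta>1 > 0" "\<delta>1 \<le> 1"
    "\<And>t w. t \<in> sector \<Longrightarrow> t \<noteq> 0 \<Longrightarrow> norm t \<le> \<delta>1 \<Longrightarrow> norm w \<le> Re t / 2 \<Longrightarrow>
       norm (kap_prod w t / sincpi (w / t) - (1 + w ^ 2 / (2 * t))) \<le> C1 * norm t ^ 2"
    using kap_prod_asymp by blast
  obtain C2 where C2: "C2 > 0"
    "\<And>s t. s \<in> sector \<Longrightarrow> t \<in> sector \<Longrightarrow> s \<noteq> 0 \<Longrightarrow> t \<noteq> 0 \<Longrightarrow> norm s \<le> norm t \<Longrightarrow> norm t \<le> 1 \<Longrightarrow>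
       norm (partition_err s - partition_err t) \<le> C2 * norm t ^ 2"
    using partition_err_lipschitz by blast
  \<comment> \<open>2 pi divided by the elementary factor. It is 1 - x / 8 + O(x^2), so its linear
    term cancels against that of \<open>k\<close>.\<close>
  define B where "B = (\<lambda>x::real. 2 * (1 - exp (- x / 2)) * exp (x / 8) / x)"
  have "(\<lambda>x. B x - (1 - x / 8)) \<in> O[at_right 0](\<lambda>x. x ^ 2)" unfolding B_def by real_asymp
  then obtain C3 where "C3 > 0" "\<forall>\<^sub>F x in at_right 0. norm (B x - (1 - x / 8)) \<le> C3 * norm (x ^ 2)"
    by (elim landau_o.bigE)
  then obtain \<delta>3 where C3: "C3 > 0" "\<delta>3 > 0" "\<And>x. 0 < x \<Longrightarrow> x < \<delta>3 \<Longrightarrow> \<bar>B x - (1 - x / 8)\<bar> \<le> C3 * x ^ 2"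
    by (auto simp: eventually_at_right_field)
  \<comment> \<open>\<open>\<delta>3 / 2\<close> turns the strict bound x < \<open>\<delta>3\<close>
    into one that admits x = \<delta>; the last entry keeps |\<eta>| \<le> 1 for the linear estimate
    of exp \<eta>.\<close>
  define \<delta> where "\<delta> = Min {\<delta>1, \<delta>3 / 2, 1 / (2 * C2 + 1)}"
  have \<delta>: "\<delta> > 0" "\<delta> \<le> \<delta>1" "\<delta> < \<delta>3" "\<delta> \<le> 1 / (2 * C2 + 1)" 
  proof -
    show "\<delta> > 0" unfolding \<delta>_def using C1 C2 C3 by (subst Min_gr_iff) (auto intro!: add_pos_pos)
    have "\<delta> \<le> \<delta>3 / 2" unfolding \<delta>_def by (rule Min_le) auto
    thus "\<delta> < \<delta>3" using C3 by simp
    show "\<delta> \<le> \<delta>1" "\<delta> \<le> 1 / (2 * C2 + 1)" unfolding \<delta>_def by (auto intro: Min_le)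
  qed
  define K where "K = 1 / 64 + (C1 + C3 * 2 + C1 * C3)"
  show ?thesis
  proof (rule that[of "(K + 6 * C2) + K * (6 * C2)" \<delta>])
    fix x :: real assume x: "0 < x" "x \<le> \<delta>"
    have x1: "x \<le> 1" using x \<delta> C1 by linarith
    define v where "v = exp (2 * e x) * (2 * pi)"
    define \<eta> where "\<eta> = 2 * (e (x / 2) - e x)"
    have \<eta>: "\<bar>\<eta>\<bar> \<le> 2 * C2 * x ^ 2" "\<bar>\<eta>\<bar> \<le> 1"
    proof -
      have "norm (partition_err (of_real (x / 2)) - partition_err (of_real x)) \<le> C2 * norm (complex_of_real x) ^ 2"
        using x x1 by (intro C2 sector_of_real) auto
      hence "\<bar>e (x / 2) - e x\<bar> \<le> C2 * x ^ 2" 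
        using abs_Re_le_cmod[of "partition_err (of_real (x / 2)) - partition_err (of_real x)"]
        by (simp add: e_def)
      thus 1: "\<bar>\<eta>\<bar> \<le> 2 * C2 * x ^ 2" unfolding \<eta>_def abs_mult by simp
      have "2 * C2 * x ^ 2 \<le> (2 * C2 + 1) * x" using x x1 C2 power_decreasing[of 1 2 x]
        by (intro mult_mono) auto
      also have "\<dots> \<le> (2 * C2 + 1) * (1 / (2 * C2 + 1))" using x \<delta> C2 by (intro mult_left_mono) auto
      also have "\<dots> = 1" using C2 by simp
      finally show "\<bar>\<eta>\<bar> \<le> 1" using 1 by linarith
    qed
    define k where "k = Re (kap_prod (of_real x / 2) (of_real x) / sincpi (1 / 2))"
    have kr: "kap_prod (of_real x / 2) (of_real x) / sincpi (1 / 2) = of_real k"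
      unfolding k_def exp_partition_err_relation[OF x(1)] by simp
    have "norm (kap_prod (of_real x / 2) (of_real x) / sincpi (of_real x / 2 / of_real x) - (1 + (of_real x / 2) ^ 2 / (2 * of_real x)))
       \<le> C1 * norm (complex_of_real x) ^ 2"
      using x \<delta> by (intro C1 sector_of_real) auto
    also have "of_real x / 2 / of_real x = (1 / 2 :: complex)" using x by simp
    also have "(1 + (of_real x / 2) ^ 2 / (2 * of_real x)) = complex_of_real (1 + x / 8)"
      using x by (simp add: power2_eq_square)
    also have "kap_prod (of_real x / 2) (of_real x) / sincpi (1 / 2) - complex_of_real (1 + x / 8) = of_real (k - (1 + x / 8))"
      unfolding kr by simp
    finally have k1: "\<bar>k - (1 + x / 8)\<bar> \<le> C1 * x ^ 2" by (simp only: norm_of_real) simp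
    have "k = exp (4 * e x - 2 * e (x / 2)) * (pi * x * exp (- x / 8) / (1 - exp (- x / 2)))"
      unfolding k_def exp_partition_err_relation[OF x(1)] e_def by simp
    moreover have ne: "1 - exp (- x / 2) > 0" using x by simp
    moreover have "exp (- x / 8) * exp (x / 8) = 1" by (simp flip: exp_add)
    moreover have "(E * (p * x * a / d)) * (2 * d * b / x) = E * (2 * p) * (a * b)" 
      if "d \<noteq> 0" for E p a d b :: real using that x by (simp add: field_simps)
    ultimately have kB: "k * B x = exp (4 * e x - 2 * e (x / 2)) * (2 * pi)"
      unfolding B_def by (metis less_irrefl mult.right_neutral)
    also have "4 * e x - 2 * e (x / 2) = 2 * e x - \<eta>" by (simp add: \<eta>_def algebra_simps)
    finally have v: "v = k * B x * exp \<eta>" by (simp add: v_def exp_diff)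
    define r where "r = k - (1 + x / 8)"
    define s where "s = B x - (1 - x / 8)"
    have rs: "\<bar>r\<bar> \<le> C1 * x ^ 2" "\<bar>s\<bar> \<le> C3 * x ^ 2" using k1 C3(3)[of x] x \<delta> by (auto simp: r_def s_def)
    have x2: "x ^ 2 \<le> 1" "0 \<le> x ^ 2" using x x1 by (auto intro: power_le_one)
    \<comment> \<open>(1 + x / 8)(1 - x / 8) = 1 - x^2 / 64, and the other terms each contain a
      remainder.\<close>
    have "k * B x - 1 = - (1 / 64 * x ^ 2) + (r * (1 - x / 8) + s * (1 + x / 8) + r * s)"
      by (simp add: r_def s_def power2_eq_square algebra_simps)
    also have "\<bar>\<dots>\<bar> \<le> 1 / 64 * x ^ 2 + ((C1 * x ^ 2) * 1 + (C3 * x ^ 2) * 2 + (C1 * x ^ 2) * (C3 * 1))"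
    proof (intro order.trans[OF abs_triangle_ineq] add_mono)
      show "\<bar>r * (1 - x / 8)\<bar> \<le> C1 * x ^ 2 * 1" "\<bar>s * (1 + x / 8)\<bar> \<le> C3 * x ^ 2 * 2"
        unfolding abs_mult using rs x x1 by (intro mult_mono; auto)+
      have "\<bar>s\<bar> \<le> C3 * 1" using rs(2) x2 C3 by (elim order.trans) auto
      thus "\<bar>r * s\<bar> \<le> C1 * x ^ 2 * (C3 * 1)" unfolding abs_mult using rs by (intro mult_mono) auto
    qed auto
    also have "\<dots> = K * x ^ 2" by (simp add: K_def algebra_simps)
    finally have kB1: "\<bar>k * B x - 1\<bar> \<le> K * x ^ 2" .
    have "norm (exp (complex_of_real \<eta>) - 1) \<le> 3 * norm (complex_of_real \<eta>)"
      using \<eta> by (intro norm_exp_minus_one_le) simp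
    also have "exp (complex_of_real \<eta>) - 1 = of_real (exp \<eta> - 1)" by (simp add: exp_of_real)
    finally have "\<bar>exp \<eta> - 1\<bar> \<le> 3 * \<bar>\<eta>\<bar>" by (simp only: norm_of_real)
    hence e1: "\<bar>exp \<eta> - 1\<bar> \<le> 6 * C2 * x ^ 2" using \<eta> by linarith
    have "v - 1 = (k * B x - 1) + (exp \<eta> - 1) + (k * B x - 1) * (exp \<eta> - 1)"
      unfolding v by (simp add: algebra_simps)
    also have "\<bar>\<dots>\<bar> \<le> K * x ^ 2 + 6 * C2 * x ^ 2 + (K * x ^ 2) * (6 * C2 * 1)"
    proof (intro order.trans[OF abs_triangle_ineq] add_mono kB1 e1)
      have "\<bar>exp \<eta> - 1\<bar> \<le> 6 * C2 * 1" using e1 x2 C2 by (elim order.trans) auto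
      thus "\<bar>(k * B x - 1) * (exp \<eta> - 1)\<bar> \<le> (K * x ^ 2) * (6 * C2 * 1)"
        unfolding abs_mult using kB1 by (intro mult_mono) auto
    qed
    finally have v1: "\<bar>v - 1\<bar> \<le> ((K + 6 * C2) + K * (6 * C2)) * x ^ 2" by (simp add: algebra_simps)
    define u where "u = exp (e x) * sqrt (2 * pi)"
    have u: "u > 0" by (simp add: u_def)
    have "v = u ^ 2" by (simp add: u_def v_def power_mult_distrib exp_double)
    hence v2: "\<bar>u - 1\<bar> * (u + 1) = \<bar>v - 1\<bar>"
      using u by (simp add: power2_eq_square square_diff_one_factored abs_mult)
    \<comment> \<open>Passing from v = u^2 to u loses nothing, because |v - 1| = |u - 1| (u + 1) and
      u is positive.\<close>
    have "\<bar>u - 1\<bar> * 1 \<le> \<bar>u - 1\<bar> * (u + 1)" using u by (intro mult_left_mono) auto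
    also note v2
    also note v1
    finally have "\<bar>u - 1\<bar> \<le> ((K + 6 * C2) + K * (6 * C2)) * x ^ 2" by simp
    thus "\<bar>exp (Re (partition_err (of_real x))) * sqrt (2 * pi) - 1\<bar> \<le> ((K + 6 * C2) + K * (6 * C2)) * x ^ 2"
      by (simp add: u_def e_def)
  qed (use C1 C2 C3 \<delta> in \<open>auto simp: K_def intro!: add_pos_pos mult_pos_pos\<close>)
qed

text \<open>Transfers the real case to the sector: t is compared with the real number |t|, and the
  Lipschitz estimate gives exp z = 1 + O(|t|^2) for the difference z of the two errors.\<close>

lemma exp_partition_err_asymp:
  obtains C \<delta> where "C > 0" "\<delta> > 0" "\<delta> \<le> 1"
    "\<And>t. t \<in> sector \<Longrightarrow> t \<noteq> 0 \<Longrightarrow> norm t \<le> \<delta> \<Longrightarrow> 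
       norm (exp (partition_err t) * of_real (sqrt (2 * pi)) - 1) \<le> C * norm t ^ 2"
proof -
  obtain C1 \<delta>1 where C1: "C1 > 0" "\<delta>1 > 0" "\<delta>1 \<le> 1"
    "\<And>x. 0 < x \<Longrightarrow> x \<le> \<delta>1 \<Longrightarrow> \<bar>exp (Re (partition_err (of_real x))) * sqrt (2 * pi) - 1\<bar> \<le> C1 * x ^ 2"
    using exp_partition_err_asymp_real by blast
  obtain C2 where C2: "C2 > 0"
    "\<And>s t. s \<in> sector \<Longrightarrow> t \<in> sector \<Longrightarrow> s \<noteq> 0 \<Longrightarrow> t \<noteq> 0 \<Longrightarrow> norm s \<le> norm t \<Longrightarrow> norm t \<le> 1 \<Longrightarrow>
       norm (partition_err s - partition_err t) \<le> C2 * norm t ^ 2"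
    using partition_err_lipschitz by blast
  define \<delta> where "\<delta> = min \<delta>1 (1 / (C2 + 1))"
  have \<delta>: "\<delta> > 0" "\<delta> \<le> \<delta>1" "\<delta> \<le> 1 / (C2 + 1)" using C1 C2 by (auto simp: \<delta>_def)
  show ?thesis
  proof (rule that[of "C1 + 3 * C2 + C1 * (3 * C2)" \<delta>])
    fix t assume t: "t \<in> sector" "t \<noteq> 0" "norm t \<le> \<delta>"
    define x where "x = norm t"
    have x: "0 < x" "x \<le> \<delta>" "x \<le> 1" using t \<delta> C1 by (auto simp: x_def)
    have x2: "x ^ 2 \<le> 1" "0 \<le> x ^ 2" using x by (auto intro: power_le_one)
    define u where "u = exp (Re (partition_err (of_real x))) * sqrt (2 * pi)"
    have u: "\<bar>u - 1\<bar> \<le> C1 * x ^ 2" unfolding u_def using x \<delta> by (intro C1) auto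
    define z where "z = partition_err t - partition_err (of_real x)"
    have z: "norm z \<le> C2 * x ^ 2"
      using C2(2)[of t "of_real x"] t x sector_of_real[of x] by (simp add: z_def x_def)
    have "C2 * x ^ 2 \<le> (C2 + 1) * x" using x C2 power_decreasing[of 1 2 x] by (intro mult_mono) auto
    also have "\<dots> \<le> (C2 + 1) * (1 / (C2 + 1))" using x \<delta> C2 by (intro mult_left_mono) auto
    finally have "norm z \<le> 1" using z C2 by simp
    hence ez: "norm (exp z - 1) \<le> 3 * C2 * x ^ 2" using norm_exp_minus_one_le[of z] z by linarith
    have "exp (partition_err t) * of_real (sqrt (2 * pi)) = of_real u * exp z"
      using partition_err_of_real[OF x(1)]
    proof -
      have "exp (partition_err t) = exp (partition_err (of_real x)) * exp z" by (simp add: z_def flip: exp_add)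
      also have "exp (partition_err (of_real x)) = of_real (exp (Re (partition_err (of_real x))))"
        using partition_err_of_real[OF x(1)] by (metis exp_of_real)
      finally show ?thesis by (simp add: u_def)
    qed
    hence "exp (partition_err t) * of_real (sqrt (2 * pi)) - 1 = of_real (u - 1) + (exp z - 1) + of_real (u - 1) * (exp z - 1)"
      by (simp add: algebra_simps)
    also have "norm \<dots> \<le> C1 * x ^ 2 + 3 * C2 * x ^ 2 + (C1 * x ^ 2) * (3 * C2 * 1)"
    proof (intro norm_triangle_mono ez)
      have "norm (exp z - 1) \<le> 3 * C2 * 1" using ez x2 C2 by (elim order.trans) auto
      thus "norm (of_real (u - 1) * (exp z - 1)) \<le> (C1 * x ^ 2) * (3 * C2 * 1)"
        unfolding norm_mult norm_of_real using u by (intro mult_mono) auto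
    qed (use u in \<open>simp only: norm_of_real\<close>)
    also have "\<dots> = (C1 + 3 * C2 + C1 * (3 * C2)) * x ^ 2" by (simp add: algebra_simps)
    finally show "norm (exp (partition_err t) * of_real (sqrt (2 * pi)) - 1) \<le> (C1 + 3 * C2 + C1 * (3 * C2)) * norm t ^ 2"
      by (simp add: x_def)
  qed (use C1 C2 \<delta> in \<open>auto intro!: add_pos_pos mult_pos_pos\<close>)
qed

section \<open>Arc integrals, Bessel functions and Bernoulli numbers\<close>

lemma rGamma_half_odd:
  "rGamma (real m + 3 / 2) / fact m = 2 * 4 ^ m / (sqrt pi * fact (2 * m + 1))"
proof (induction m)
  \<comment> \<open>The formula is Legendre's duplication formula at m + 1; the induction starts
    from Gamma(1/2) = sqrt pi.\<close>
  case 0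
  have "1 / 2 * rGamma (1 / 2 + 1) = rGamma (1 / 2 :: real)" by (rule rGamma_plus1)
  hence "rGamma (3 / 2 :: real) = 2 * rGamma (1 / 2)" by simp
  moreover have "rGamma (1 / 2 :: real) = 1 / sqrt pi"
    by (simp only: rGamma_inverse_Gamma Gamma_one_half_real inverse_eq_divide)
  ultimately show ?case by simp
next
  case (Suc m)
  have "(real m + 3 / 2) * rGamma (real m + 3 / 2 + 1) = rGamma (real m + 3 / 2)" by (rule rGamma_plus1)
  moreover have "real (Suc m) + 3 / 2 = real m + 3 / 2 + 1" by simp
  ultimately have 1: "rGamma (real (Suc m) + 3 / 2) = rGamma (real m + 3 / 2) / (real m + 3 / 2)"
    by (simp only:) (simp add: field_simps)
  have "rGamma (real (Suc m) + 3 / 2) / fact (Suc m) = (rGamma (real m + 3 / 2) / fact m) / ((real m + 3 / 2) * real (Suc m))"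
    unfolding 1 fact_Suc by (simp only: divide_divide_eq_left mult_ac of_nat_id)
  also have "\<dots> = 2 * 4 ^ m / (sqrt pi * fact (2 * m + 1)) / ((real m + 3 / 2) * real (Suc m))" unfolding Suc ..
  also have "\<dots> = 2 * 4 ^ Suc m / (sqrt pi * (real (2 * m + 3) * (real (2 * m + 2) * fact (2 * m + 1))))"
    by (simp add: divide_simps) (simp add: algebra_simps)
  also have "real (2 * m + 3) * (real (2 * m + 2) * fact (2 * m + 1)) = fact (2 * Suc m + 1)"
    by (simp add: numeral_3_eq_3 algebra_simps)
  finally show ?case .
qed

lemma sqrt_half_eq:
  assumes "x > 0"
  shows "2 * (sqrt (x / 2) / sqrt pi) = sqrt (2 / (pi * x)) * x"
proof -
  have "(2 * (sqrt (x / 2) / sqrt pi)) ^ 2 = (sqrt (2 / (pi * x)) * x) ^ 2"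
    using assms by (simp add: power_mult_distrib power_divide) (simp add: power2_eq_square)
  thus ?thesis using assms by (subst (asm) power2_eq_iff_nonneg) auto
qed

lemma sinh_sums_odd: "(\<lambda>m. x ^ (2 * m + 1) / fact (2 * m + 1)) sums sinh (x::real)"
proof -
  have "(\<lambda>m. (\<lambda>n. if even n then 0 else x ^ n /\<^sub>R fact n) (2 * m + 1)) sums sinh x"
    by (subst sums_mono_reindex) (auto simp: strict_mono_def sinh_converges elim!: oddE)
  thus ?thesis by (simp add: divide_inverse mult.commute)
qed

lemma cosh_sums_even: "(\<lambda>m. x ^ (2 * m) / fact (2 * m)) sums cosh (x::real)"
proof -
  have "(\<lambda>m. (\<lambda>n. if even n then x ^ n /\<^sub>R fact n else 0) (2 * m)) sums cosh x"
    by (subst sums_mono_reindex) (auto simp: strict_mono_def cosh_converges elim!: evenE)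
  thus ?thesis by (simp add: divide_inverse mult.commute)
qed

lemma bessel_I_half:
  assumes "x > 0"
  shows "bessel_I (1 / 2) x = sqrt (2 / (pi * x)) * sinh x"
proof -
  have "(x / 2) powr (2 * real m + 1 / 2) * rGamma (real m + 1 / 2 + 1) / fact m =
        sqrt (2 / (pi * x)) * (x ^ (2 * m + 1) / fact (2 * m + 1))" for m
  proof -
    have "(x / 2) powr (2 * real m + 1 / 2) = (x / 2) powr real (2 * m) * (x / 2) powr (1 / 2)"
      by (simp add: powr_add)
    also have "\<dots> = (x / 2) ^ (2 * m) * sqrt (x / 2)"
      using powr_realpow[of "x / 2" "2 * m"] powr_half_sqrt[of "x / 2"] assms by simp
    finally have "(x / 2) powr (2 * real m + 1 / 2) * rGamma (real m + 1 / 2 + 1) / fact m =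
      (x / 2) ^ (2 * m) * sqrt (x / 2) * (rGamma (real m + 3 / 2) / fact m)" by (simp add: add.assoc)
    also have "\<dots> = (2 * (sqrt (x / 2) / sqrt pi)) * x ^ (2 * m) / fact (2 * m + 1)"
      unfolding rGamma_half_odd by (simp add: power_divide power_mult del: fact_Suc)
    finally show ?thesis unfolding sqrt_half_eq[OF assms] by (simp add: mult_ac)
  qed
  thus ?thesis using sums_mult[OF sinh_sums_odd, of "sqrt (2 / (pi * x))" x]
    by (simp add: bessel_I_def sums_iff)
qed

text \<open>Uses 1 / ((2m + 1)! (2m + 3)) = 1 / (2m + 2)! - 1 / (2m + 3)!. The index is shifted by
  one because the constant terms of cosh x and sinh x / x cancel.\<close>

lemma bessel_I_three_halves:
  assumes "x > 0"
  shows "bessel_I (3 / 2) x = sqrt (2 / (pi * x)) * (cosh x - sinh x / x)"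
proof -
  have "(x / 2) powr (2 * real m + 3 / 2) * rGamma (real m + 3 / 2 + 1) / fact m =
        sqrt (2 / (pi * x)) * (x ^ (2 * Suc m) / fact (2 * Suc m) - x ^ (2 * Suc m) / fact (2 * Suc m + 1))" for m
  proof -
    have "(x / 2) powr (2 * real m + 3 / 2) = (x / 2) powr real (2 * m + 1) * (x / 2) powr (1 / 2)"
      by (simp flip: powr_add add: algebra_simps)
    also have "\<dots> = (x / 2) ^ (2 * m + 1) * sqrt (x / 2)"       using powr_realpow[of "x / 2" "2 * m + 1"] powr_half_sqrt[of "x / 2"] assms by simp
    finally have 1: "(x / 2) powr (2 * real m + 3 / 2) = (x / 2) ^ (2 * m + 1) * sqrt (x / 2)" .
    have "(real m + 3 / 2) * rGamma (real m + 3 / 2 + 1) = rGamma (real m + 3 / 2)" by (rule rGamma_plus1)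
    hence 2: "rGamma (real m + 3 / 2 + 1) = rGamma (real m + 3 / 2) / (real m + 3 / 2)"
      by (simp add: field_simps)
    have "(x / 2) powr (2 * real m + 3 / 2) * rGamma (real m + 3 / 2 + 1) / fact m =
      (x / 2) ^ (2 * m + 1) * sqrt (x / 2) * (rGamma (real m + 3 / 2) / fact m) / (real m + 3 / 2)" unfolding 1 2 by simp
    also have "\<dots> = (2 * (sqrt (x / 2) / sqrt pi)) * x ^ (2 * m + 1) / (fact (2 * m + 1) * (2 * real m + 3))"
      unfolding rGamma_half_odd by (simp add: power_divide power_mult divide_simps del: fact_Suc)
    also have "\<dots> = sqrt (2 / (pi * x)) * (x ^ (2 * Suc m) / (fact (2 * m + 1) * (2 * real m + 3)))"
      unfolding sqrt_half_eq[OF assms] by (simp add: power2_eq_square mult_ac)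
    also have "1 / (fact (2 * m + 1) * (2 * real m + 3)) = 1 / fact (2 * Suc m) - 1 / fact (2 * Suc m + 1)"
    proof -
      have f: "fact (2 * Suc m) = (2 * real m + 2) * fact (2 * m + 1)" 
        "fact (2 * Suc m + 1) = (2 * real m + 3) * ((2 * real m + 2) * fact (2 * m + 1))"
        by (simp_all add: numeral_3_eq_3 algebra_simps)
      define F where "F = (fact (2 * m + 1) :: real)"
      have "F \<noteq> 0" by (simp add: F_def)
      thus ?thesis unfolding f F_def[symmetric] by (simp add: divide_simps add_pos_nonneg)
    qed
    hence "x ^ (2 * Suc m) / (fact (2 * m + 1) * (2 * real m + 3)) = x ^ (2 * Suc m) * (1 / fact (2 * Suc m) - 1 / fact (2 * Suc m + 1))"
      by (metis times_divide_eq_right mult.right_neutral)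
    finally show ?thesis by (simp only: right_diff_distrib times_divide_eq_right mult.right_neutral)
  qed
  moreover have "(\<lambda>m. x ^ (2 * Suc m) / fact (2 * Suc m) - x ^ (2 * Suc m) / fact (2 * Suc m + 1)) sums (cosh x - sinh x / x)"
  proof -
    have "(\<lambda>m. x ^ (2 * m) / fact (2 * m + 1)) sums (sinh x / x)"
      using sums_divide[OF sinh_sums_odd[of x], of x] assms by (simp add: field_simps del: fact_Suc)
    with cosh_sums_even[of x] have "(\<lambda>m. x ^ (2 * m) / fact (2 * m) - x ^ (2 * m) / fact (2 * m + 1)) sums (cosh x - sinh x / x)"
      by (rule sums_diff)
    thus ?thesis
      using sums_Suc_iff[of "\<lambda>m. x ^ (2 * m) / fact (2 * m) - x ^ (2 * m) / fact (2 * m + 1)" "cosh x - sinh x / x"]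
      by (simp del: fact_Suc mult_Suc_right power_Suc)
  qed
  ultimately show ?thesis using sums_mult[of _ "cosh x - sinh x / x" "sqrt (2 / (pi * x))"]
    by (simp add: bessel_I_def sums_iff)
qed

text \<open>For integer \<nu> the same integral over a full period is 2 pi times the Bessel function
  I of order \<nu>. Cutting at pi / 4 loses only terms of size exp (y cos (pi / 4)).\<close>

definition arc_int :: "real \<Rightarrow> real \<Rightarrow> real" where
  "arc_int \<nu> y = integral {- pi / 4..pi / 4} (\<lambda>\<psi>. cos (\<nu> * \<psi>) * exp (y * cos \<psi>))"

lemma arc_int_integrable [simp]: 
  fixes \<nu> y a b :: real
  shows "(\<lambda>\<psi>. cos (\<nu> * \<psi>) * exp (y * cos \<psi>)) integrable_on {a..b}"
  by (intro integrable_continuous_real continuous_intros)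

lemma arc_int_minus: "arc_int (- \<nu>) y = arc_int \<nu> y"
  by (simp add: arc_int_def)

text \<open>Integrates the derivative of sin (\<nu> \<psi>) exp (y cos \<psi>). The result is the
  three-term recurrence of the functions I plus a boundary term at pi / 4.\<close>

lemma arc_int_rec:
  assumes "y > 0"
  shows "arc_int (\<nu> + 1) y = arc_int (\<nu> - 1) y - 2 * \<nu> / y * arc_int \<nu> y + 4 / y * sin (\<nu> * pi / 4) * exp (y * cos (pi / 4))"
proof -
  let ?F = "\<lambda>\<psi>. sin (\<nu> * \<psi>) * exp (y * cos \<psi>)"
  have "((\<lambda>\<psi>. \<nu> * (cos (\<nu> * \<psi>) * exp (y * cos \<psi>)) - y / 2 * (cos ((\<nu> - 1) * \<psi>) * exp (y * cos \<psi>) - cos ((\<nu> + 1) * \<psi>) * exp (y * cos \<psi>)))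
       has_integral (?F (pi / 4) - ?F (- pi / 4))) {- pi / 4..pi / 4}"
  proof (rule fundamental_theorem_of_calculus)
    fix \<psi> :: real
    have "(?F has_real_derivative \<nu> * cos (\<nu> * \<psi>) * exp (y * cos \<psi>) - y * (sin (\<nu> * \<psi>) * sin \<psi>) * exp (y * cos \<psi>)) (at \<psi>)"
      by (auto intro!: derivative_eq_intros)
    also have "sin (\<nu> * \<psi>) * sin \<psi> = (cos ((\<nu> - 1) * \<psi>) - cos ((\<nu> + 1) * \<psi>)) / 2"
      unfolding left_diff_distrib distrib_right mult_1_left by (rule sin_times_sin)
    finally have D: "(?F has_real_derivative \<nu> * cos (\<nu> * \<psi>) * exp (y * cos \<psi>) - y * ((cos ((\<nu> - 1) * \<psi>) - cos ((\<nu> + 1) * \<psi>)) / 2) * exp (y * cos \<psi>)) (at \<psi>)" .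
    have eq: "\<nu> * A * E - y * ((B - C) / 2) * E = \<nu> * (A * E) - y / 2 * (B * E - C * E)" for A B C E
      by (simp add: field_simps)
    show "(?F has_vector_derivative \<nu> * (cos (\<nu> * \<psi>) * exp (y * cos \<psi>)) - y / 2 * (cos ((\<nu> - 1) * \<psi>) * exp (y * cos \<psi>) - cos ((\<nu> + 1) * \<psi>) * exp (y * cos \<psi>))) (at \<psi> within {- pi / 4..pi / 4})"
      unfolding has_real_derivative_iff_has_vector_derivative[symmetric]
      using D unfolding eq by (rule has_field_derivative_at_within)
  qed auto
  moreover have "((\<lambda>\<psi>. \<nu> * (cos (\<nu> * \<psi>) * exp (y * cos \<psi>)) - y / 2 * (cos ((\<nu> - 1) * \<psi>) * exp (y * cos \<psi>) - cos ((\<nu> + 1) * \<psi>) * exp (y * cos \<psi>)))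
       has_integral (\<nu> * arc_int \<nu> y - y / 2 * (arc_int (\<nu> - 1) y - arc_int (\<nu> + 1) y))) {- pi / 4..pi / 4}"
    unfolding arc_int_def by (intro has_integral_diff has_integral_mult_right integrable_integral arc_int_integrable)
  ultimately have "\<nu> * arc_int \<nu> y - y / 2 * (arc_int (\<nu> - 1) y - arc_int (\<nu> + 1) y) = ?F (pi / 4) - ?F (- pi / 4)"
    by (rule has_integral_unique[symmetric])
  also have "\<dots> = 2 * sin (\<nu> * pi / 4) * exp (y * cos (pi / 4))" by simp
  finally have *: "\<nu> * arc_int \<nu> y - y / 2 * (arc_int (\<nu> - 1) y - arc_int (\<nu> + 1) y) = 2 * sin (\<nu> * pi / 4) * exp (y * cos (pi / 4))" .
  have "b = a - 2 * \<nu> / y * c + 4 / y * s * e" if "\<nu> * c - y / 2 * (a - b) = 2 * s * e" for a b c s e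
  proof -
    have "2 * (\<nu> * c) = 2 * (2 * s * e) + 2 * (y / 2 * (a - b))"
      unfolding that[symmetric] by simp
    also have "2 * (y / 2 * (a - b)) = y * a - y * b" by (simp add: right_diff_distrib)
    finally have "y * b = y * a - 2 * (\<nu> * c) + 2 * (2 * s * e)" by simp
    hence "b = (y * a - 2 * (\<nu> * c) + 2 * (2 * s * e)) / y" using assms by (simp add: field_simps)
    thus ?thesis using assms by (simp add: add_divide_distrib diff_divide_distrib)
  qed
  from this[OF *] show ?thesis .
qed

section \<open>Large argument asymptotics of the arc integrals\<close>

lemma gaussian_has_integral:
  assumes "a > 0"
  shows "((\<lambda>s. exp (- a * s ^ 2)) has_integral sqrt (pi / a)) UNIV"
proof -
  define \<sigma> where "\<sigma> = 1 / sqrt (2 * a)"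
  have \<sigma>: "\<sigma> > 0" "\<sigma> ^ 2 = 1 / (2 * a)" using assms by (auto simp: \<sigma>_def power_divide)
  have "(normal_density 0 \<sigma> has_integral 1) UNIV"
    using has_integral_integral_lborel[OF integrable_normal_density[of \<sigma> 0]] \<sigma> by simp
  hence "((\<lambda>s. sqrt (2 * pi * \<sigma> ^ 2) * normal_density 0 \<sigma> s) has_integral sqrt (2 * pi * \<sigma> ^ 2) * 1) UNIV"
    by (rule has_integral_mult_right)
  also have "(\<lambda>s. sqrt (2 * pi * \<sigma> ^ 2) * normal_density 0 \<sigma> s) = (\<lambda>s. exp (- a * s ^ 2))"
    using assms by (simp add: normal_density_def \<sigma>(2) fun_eq_iff)
  also have "sqrt (2 * pi * \<sigma> ^ 2) * 1 = sqrt (pi / a)" by (simp add: \<sigma>(2))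
  finally show ?thesis .
qed

text \<open>Outside [-r, r] one has exp (- a s^2) \<le> exp (- (a - 1) r^2) exp (- s^2), which
  leaves a full Gaussian integral.\<close>

lemma gaussian_truncated:
  assumes "r > 0" "a \<ge> 1"
  shows "\<bar>integral {- r..r} (\<lambda>s. exp (- a * s ^ 2)) - sqrt (pi / a)\<bar> \<le> exp (- (a - 1) * r ^ 2) * sqrt pi"
proof -
  let ?f = "\<lambda>s::real. exp (- a * s ^ 2)"
  let ?g = "\<lambda>s. if s \<in> {- r..r} then ?f s else 0"
  have int: "(?f has_integral integral {- r..r} ?f) {- r..r}"
    by (intro integrable_integral integrable_continuous_real continuous_intros)
  have "(?g has_integral integral {- r..r} ?f) UNIV" using int by (subst has_integral_restrict_UNIV)
  hence d: "((\<lambda>s. ?f s - ?g s) has_integral (sqrt (pi / a) - integral {- r..r} ?f)) UNIV"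
    using assms by (intro has_integral_diff gaussian_has_integral) auto
  have e: "((\<lambda>s. exp (- (a - 1) * r ^ 2) * exp (- 1 * s ^ 2)) has_integral exp (- (a - 1) * r ^ 2) * sqrt (pi / 1)) UNIV"
    by (intro has_integral_mult_right gaussian_has_integral) auto
  have "sqrt (pi / a) - integral {- r..r} ?f \<le> exp (- (a - 1) * r ^ 2) * sqrt (pi / 1)"
  proof (rule has_integral_le[OF d e])
    fix s :: real
    show "?f s - ?g s \<le> exp (- (a - 1) * r ^ 2) * exp (- 1 * s ^ 2)"
    proof (cases "s \<in> {- r..r}")
      case False
      hence "r \<le> \<bar>s\<bar>" by auto
      hence "r ^ 2 \<le> s ^ 2" using assms power_mono[of r "\<bar>s\<bar>" 2] by simp
      hence "(a - 1) * r ^ 2 \<le> (a - 1) * s ^ 2" using assms by (intro mult_left_mono) auto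
      hence "- a * s ^ 2 \<le> - (a - 1) * r ^ 2 - s ^ 2" by (simp add: algebra_simps)
      hence "?f s \<le> exp (- (a - 1) * r ^ 2 - s ^ 2)" by simp
      thus ?thesis using False by (simp add: exp_diff exp_minus divide_inverse)
    qed auto
  qed
  moreover have "0 \<le> sqrt (pi / a) - integral {- r..r} ?f"
    by (rule has_integral_nonneg[OF d]) auto
  ultimately show ?thesis by simp
qed

text \<open>With cos \<psi> = 1 - 2 sin^2 (\<psi> / 2) and s = sin (\<psi> / 2) the weight cos
  (\<psi> / 2) is exactly the Jacobian, up to the factor 2. This makes \<nu> = 1/2 the starting
  point of the recurrence.\<close>

lemma arc_int_half:
  "arc_int (1 / 2) y = 2 * exp y * integral {- sin (pi / 8)..sin (pi / 8)} (\<lambda>s. exp (- (2 * y) * s ^ 2))"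
proof -
  have "((\<lambda>\<psi>. (cos (\<psi> / 2) / 2) *\<^sub>R exp (- (2 * y) * sin (\<psi> / 2) ^ 2)) has_integral 
     integral {sin ((- pi / 4) / 2)..sin ((pi / 4) / 2)} (\<lambda>s. exp (- (2 * y) * s ^ 2))) {- pi / 4..pi / 4}"
  proof (rule has_integral_substitution)
    show "(\<lambda>\<psi>. sin (\<psi> / 2)) ` {- pi / 4..pi / 4} \<subseteq> {- 1..1}" by auto
    show "((\<lambda>\<psi>. sin (\<psi> / 2)) has_real_derivative cos (x / 2) / 2) (at x within {- pi / 4..pi / 4})" for x
      by (auto intro!: derivative_eq_intros)
    show "sin (- pi / 4 / 2) \<le> sin (pi / 4 / 2)" by (intro sin_monotone_2pi_le) auto
  qed (auto intro!: continuous_intros)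
  hence "((\<lambda>\<psi>. 2 * exp y * ((cos (\<psi> / 2) / 2) *\<^sub>R exp (- (2 * y) * sin (\<psi> / 2) ^ 2))) has_integral 
     2 * exp y * integral {sin ((- pi / 4) / 2)..sin ((pi / 4) / 2)} (\<lambda>s. exp (- (2 * y) * s ^ 2))) {- pi / 4..pi / 4}"
    by (rule has_integral_mult_right)
  moreover have "2 * exp y * ((cos (\<psi> / 2) / 2) *\<^sub>R exp (- (2 * y) * sin (\<psi> / 2) ^ 2)) = cos (1 / 2 * \<psi>) * exp (y * cos \<psi>)" for \<psi>
  proof -
    have "cos \<psi> = 1 - 2 * sin (\<psi> / 2) ^ 2" using cos_double_sin[of "\<psi> / 2"] by simp
    hence "exp (y * cos \<psi>) = exp y * exp (- (2 * y) * sin (\<psi> / 2) ^ 2)"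
      unfolding \<open>cos \<psi> = _\<close> by (simp add: algebra_simps flip: exp_add)
    thus ?thesis by simp
  qed
  ultimately have "((\<lambda>\<psi>. cos (1 / 2 * \<psi>) * exp (y * cos \<psi>)) has_integral 
     2 * exp y * integral {sin ((- pi / 4) / 2)..sin ((pi / 4) / 2)} (\<lambda>s. exp (- (2 * y) * s ^ 2))) {- pi / 4..pi / 4}"
    by (simp only:)
  thus ?thesis unfolding arc_int_def by (simp add: integral_unique)
qed

lemma cos_pi_4_le: "cos (pi / 4) \<le> 3 / 4"
proof -
  have "sqrt 2 \<le> sqrt ((3 / 2) ^ 2)" by (subst real_sqrt_le_iff) (simp add: power2_eq_square)
  also have "\<dots> = 3 / 2" by (subst real_sqrt_abs) simp
  finally show ?thesis by (simp add: cos_45)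
qed

lemma arc_int_half_asymp:
  "(\<lambda>y. arc_int (1 / 2) y - sqrt (2 * pi / y) * exp y) \<in> O[at_top](\<lambda>y. exp y * y powr (-5/2))"
proof -
  have s: "sin (pi / 8) > 0" by (intro sin_gt_zero) auto
  \<comment> \<open>sin^2 (pi / 8) = (1 - cos (pi / 4)) / 2 \<ge> 1/8, so the truncation error is of
    size exp (y - y / 4).\<close>
  have s2: "sin (pi / 8) ^ 2 \<ge> 1 / 8"
  proof -
    have "cos (pi / 4) = 1 - 2 * sin (pi / 8) ^ 2" using cos_double_sin[of "pi / 8"] by simp

    thus ?thesis using cos_pi_4_le by linarith
  qed
  have bound: "\<bar>arc_int (1 / 2) y - sqrt (2 * pi / y) * exp y\<bar> \<le> 2 * sqrt pi * exp (1 / 8) * exp (3 / 4 * y)" if y: "y \<ge> 1" for y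
  proof -
    have sq: "sqrt (2 * pi / y) = 2 * sqrt (pi / (2 * y))"
    proof -
      have "sqrt (2 * pi / y) = sqrt (4 * (pi / (2 * y)))" by simp
      thus ?thesis by (simp only: real_sqrt_mult) simp
    qed
    have "arc_int (1 / 2) y - sqrt (2 * pi / y) * exp y = 2 * exp y * (integral {- sin (pi / 8)..sin (pi / 8)} (\<lambda>s. exp (- (2 * y) * s ^ 2)) - sqrt (pi / (2 * y)))"
      unfolding arc_int_half sq by (simp add: algebra_simps)
    also have "\<bar>\<dots>\<bar> \<le> 2 * exp y * (exp (- (2 * y - 1) * sin (pi / 8) ^ 2) * sqrt pi)"
      unfolding abs_mult using gaussian_truncated[OF s, of "2 * y"] y by (intro mult_mono) auto
    also have "2 * exp y * (exp (- (2 * y - 1) * sin (pi / 8) ^ 2) * sqrt pi) \<le> 2 * exp y * (exp (1 / 8 - y / 4) * sqrt pi)"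
    proof -
    have "(2 * y - 1) * (1 / 8) \<le> (2 * y - 1) * sin (pi / 8) ^ 2" using s2 y by (intro mult_left_mono) auto
    hence "- ((2 * y - 1) * sin (pi / 8) ^ 2) \<le> - ((2 * y - 1) * (1 / 8))" by (simp only: neg_le_iff_le)
    also have "- ((2 * y - 1) * (1 / 8)) = 1 / 8 - y / 4" by (simp add: field_simps)
    finally have "exp (- (2 * y - 1) * sin (pi / 8) ^ 2) \<le> exp (1 / 8 - y / 4)" by (simp only: mult_minus_left exp_le_cancel_iff)
    thus ?thesis
      by (intro mult_left_mono mult_right_mono) auto
    qed
    also have "\<dots> = 2 * sqrt pi * (exp y * exp (1 / 8 - y / 4))" by (simp only: mult_ac)
    also have "exp y * exp (1 / 8 - y / 4) = exp (1 / 8) * exp (3 / 4 * y)"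
      by (simp flip: exp_add)
    finally show ?thesis by (simp add: mult_ac)
  qed
  have "\<forall>\<^sub>F y in at_top. norm (arc_int (1 / 2) y - sqrt (2 * pi / y) * exp y) \<le> (2 * sqrt pi * exp (1 / 8)) * norm (exp (3 / 4 * y))"
    using eventually_ge_at_top[of "1::real"] by eventually_elim (use bound in simp)
  hence "(\<lambda>y. arc_int (1 / 2) y - sqrt (2 * pi / y) * exp y) \<in> O[at_top](\<lambda>y. exp (3 / 4 * y))"
    by (rule bigoI)
  also have "(\<lambda>y::real. exp (3 / 4 * y)) \<in> O[at_top](\<lambda>y. exp y * y powr (-5/2))" by real_asymp
  finally show ?thesis .
qed

text \<open>2 pi times the first two terms of the large argument expansion of I of order
  \<nu>.\<close>

definition arc_main :: "real \<Rightarrow> real \<Rightarrow> real" where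
  "arc_main \<nu> y = sqrt (2 * pi / y) * exp y * (1 - (\<nu> ^ 2 - 1 / 4) / (2 * y))"

text \<open>The recurrence carries the asymptotics upwards, as its coefficients stay bounded for
  large y and \<open>arc_main\<close> satisfies it up to a relative O(1 / y^2). The starting values
  are \<nu> = 1/2 and \<nu> = -1/2, which coincide because the integral is even in \<nu>.\<close>

lemma arc_int_asymp_nat:
  "(\<lambda>y. arc_int (real j + 1 / 2) y - arc_main (real j + 1 / 2) y) \<in> O[at_top](\<lambda>y. exp y * y powr (-5/2))"
proof -
  let ?G = "\<lambda>y::real. exp y * y powr (-5/2)"
  have step: "(\<lambda>y. arc_int (\<nu> + 1) y - arc_main (\<nu> + 1) y) \<in> O[at_top](?G)"
    if 1: "(\<lambda>y. arc_int (\<nu> - 1) y - arc_main (\<nu> - 1) y) \<in> O[at_top](?G)"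
    and 2: "(\<lambda>y. arc_int \<nu> y - arc_main \<nu> y) \<in> O[at_top](?G)" for \<nu>
  proof -
    have cy: "(\<lambda>y. c / y) \<in> O[at_top](\<lambda>_. 1)" for c :: real
    proof (rule bigoI[of _ "\<bar>c\<bar>"])
      show "\<forall>\<^sub>F y in at_top. norm (c / y) \<le> \<bar>c\<bar> * norm (1::real)"
        using eventually_ge_at_top[of "1::real"]
      proof eventually_elim
        case (elim y)
        hence "\<bar>c\<bar> / y \<le> \<bar>c\<bar> / 1" by (intro divide_left_mono) auto
        thus ?case using elim by simp
      qed
    qed
    have a: "(\<lambda>y. - 2 * \<nu> / y * (arc_int \<nu> y - arc_main \<nu> y)) \<in> O[at_top](\<lambda>y. 1 * ?G y)"
      by (rule landau_o.big.mult[OF cy 2])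
    have "(\<lambda>y::real. exp (y * cos (pi / 4))) \<in> O[at_top](\<lambda>y. exp (3 / 4 * y))"
    proof (rule bigoI[of _ 1])
      show "\<forall>\<^sub>F y in at_top. norm (exp (y * cos (pi / 4))) \<le> 1 * norm (exp (3 / 4 * y))"
        using eventually_ge_at_top[of "0::real"]
      proof eventually_elim
        case (elim y)
        thus ?case using mult_left_mono[OF cos_pi_4_le, of y] by (simp add: mult.commute)
      qed
    qed
    also have "(\<lambda>y::real. exp (3 / 4 * y)) \<in> O[at_top](?G)" by real_asymp
    finally have "(\<lambda>y. (4 * sin (\<nu> * pi / 4)) / y * exp (y * cos (pi / 4))) \<in> O[at_top](\<lambda>y. 1 * ?G y)"
      by (intro landau_o.big.mult cy)
    hence b: "(\<lambda>y. 4 / y * sin (\<nu> * pi / 4) * exp (y * cos (pi / 4))) \<in> O[at_top](?G)"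
      by simp
    have c: "(\<lambda>y. arc_main (\<nu> - 1) y - 2 * \<nu> / y * arc_main \<nu> y - arc_main (\<nu> + 1) y) \<in> O[at_top](?G)"
    proof -
      \<comment> \<open>The terms of order 1 / y cancel because (\<nu> + 1)^2 - (\<nu> - 1)^2 = 4
        \<nu>.\<close>
      have ev: "\<forall>\<^sub>F y in at_top. arc_main (\<nu> - 1) y - 2 * \<nu> / y * arc_main \<nu> y - arc_main (\<nu> + 1) y =
         \<nu> * (\<nu> ^ 2 - 1 / 4) * (sqrt (2 * pi / y) * exp y / y ^ 2)"
        using eventually_gt_at_top[of "0::real"]
        by eventually_elim (simp add: arc_main_def field_simps power2_eq_square)
      have "(\<lambda>y. \<nu> * (\<nu> ^ 2 - 1 / 4) * (sqrt (2 * pi / y) * exp y / y ^ 2)) \<in> O[at_top](\<lambda>y. 1 * ?G y)"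
      proof (rule landau_o.big.mult)
        show "(\<lambda>y. sqrt (2 * pi / y) * exp y / y ^ 2) \<in> O[at_top](?G)" by real_asymp
      qed simp
      thus ?thesis unfolding landau_o.big.in_cong[OF ev] by (simp only: mult_1_left)
    qed
    have "(\<lambda>y. (arc_int (\<nu> - 1) y - arc_main (\<nu> - 1) y) + (- 2 * \<nu> / y * (arc_int \<nu> y - arc_main \<nu> y))
       + 4 / y * sin (\<nu> * pi / 4) * exp (y * cos (pi / 4))
       + (arc_main (\<nu> - 1) y - 2 * \<nu> / y * arc_main \<nu> y - arc_main (\<nu> + 1) y)) \<in> O[at_top](?G)"
      using a unfolding mult_1_left by (intro sum_in_bigo 1 b c)
    moreover have ev: "\<forall>\<^sub>F y in at_top. (arc_int (\<nu> - 1) y - arc_main (\<nu> - 1) y) + (- 2 * \<nu> / y * (arc_int \<nu> y - arc_main \<nu> y))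
       + 4 / y * sin (\<nu> * pi / 4) * exp (y * cos (pi / 4))
       + (arc_main (\<nu> - 1) y - 2 * \<nu> / y * arc_main \<nu> y - arc_main (\<nu> + 1) y) = arc_int (\<nu> + 1) y - arc_main (\<nu> + 1) y"
      using eventually_gt_at_top[of "0::real"]
    proof eventually_elim
      case (elim y)
      show ?case unfolding arc_int_rec[OF elim, of \<nu>] by (simp add: right_diff_distrib)
    qed
    ultimately show ?thesis unfolding landau_o.big.in_cong[OF ev] by simp
  qed
  let ?P = "\<lambda>\<nu>. (\<lambda>y. arc_int \<nu> y - arc_main \<nu> y) \<in> O[at_top](?G)"
  have P0: "?P (1 / 2)" using arc_int_half_asymp by (simp add: arc_main_def power2_eq_square)
  moreover have "arc_main (1 / 2 - 1) = arc_main (1 / 2)" by (simp add: arc_main_def fun_eq_iff power2_eq_square)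
  moreover have "arc_int (1 / 2 - 1) = arc_int (1 / 2)" using arc_int_minus[of "1 / 2"] by (simp add: fun_eq_iff)
  ultimately have P1: "?P (1 / 2 + 1)" using step[of "1 / 2"] by simp
  have "?P (real j + 1 / 2) \<and> ?P (real (Suc j) + 1 / 2)" for j
  proof (induction j)
    case 0
    thus ?case using P0 P1 by (simp add: add.commute)
  next
    case (Suc j)
    thus ?case using step[of "real (Suc j) + 1 / 2"] by (simp add: algebra_simps)
  qed
  thus ?thesis by blast
qed

text \<open>Negative orders do occur: 2k - 3/2 for k = 0 and 2k - 5/2 for k = 1.\<close>

lemma arc_int_asymp:
  assumes "\<nu> + 1 / 2 \<in> \<int>"
  shows "(\<lambda>y. arc_int \<nu> y - arc_main \<nu> y) \<in> O[at_top](\<lambda>y. exp y * y powr (-5/2))"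
proof -
  from assms obtain m :: int where m: "\<nu> = of_int m - 1 / 2" by (auto elim!: Ints_cases simp: algebra_simps)
  show ?thesis
  proof (cases "m \<ge> 1")
    case True
    hence "\<nu> = real (nat (m - 1)) + 1 / 2" by (simp add: m)
    thus ?thesis using arc_int_asymp_nat by simp
  next
    case False
    hence "- \<nu> = real (nat (- m)) + 1 / 2" by (simp add: m)
    hence "(\<lambda>y. arc_int (- \<nu>) y - arc_main (- \<nu>) y) \<in> O[at_top](\<lambda>y. exp y * y powr (-5/2))"
      using arc_int_asymp_nat by simp
    thus ?thesis by (simp add: arc_int_minus arc_main_def)
  qed
qed

section \<open>Taylor coefficients of the reciprocal of \<open>sincpi\<close>\<close>

lemma sincpi_holomorphic: "sincpi holomorphic_on UNIV"
proof -
  have "deriv (\<lambda>s. sin (of_real pi * s)) 0 = complex_of_real pi"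
    by (rule DERIV_imp_deriv) (auto intro!: derivative_eq_intros)
  hence "sincpi = (\<lambda>z. (if z = 0 then deriv (\<lambda>s. sin (of_real pi * s)) 0
      else (sin (of_real pi * z) - sin (of_real pi * 0)) / (z - 0)) / of_real pi)"
    by (auto simp: sincpi_def fun_eq_iff)
  moreover have "\<dots> holomorphic_on UNIV"
    by (intro holomorphic_intros pole_lemma) auto
  ultimately show ?thesis by simp
qed

lemma sincpi_nonzero: "norm s \<le> 1 / 2 \<Longrightarrow> sincpi s \<noteq> 0"
  using norm_sincpi_ge[of s] by auto

definition sinc_coeff :: "nat \<Rightarrow> complex" where
  "sinc_coeff n = fps_nth (fps_expansion (\<lambda>s. 1 / sincpi s) 0) n"

text \<open>Multiplying numerator and denominator of the generating function at 1/2 by exp (- X / 2)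
  makes the denominator symmetric, which is what resembles a sine.\<close>

lemma bernoulli_half_fps:
  defines "G \<equiv> Abs_fps (\<lambda>n. bernoulli_poly n (1 / 2) / fact n)"
  shows "G * (fps_exp (1 / 2) - fps_exp (- 1 / 2)) = fps_X"
proof -
  let ?D = "fps_exp 1 - 1 :: real fps"
  have G: "G = fps_X * fps_exp (1 / 2) / ?D" unfolding G_def by (rule fps_ext) (simp add: bernoulli_poly_def)
  have D0: "fps_nth ?D 0 = 0" "fps_nth ?D 1 = 1" by simp_all
  have nz: "?D \<noteq> 0" using D0(2) by force
  have "subdegree ?D = 1" by (rule subdegreeI) (use D0 in auto)
  moreover have "subdegree (fps_X * fps_exp (1 / 2) :: real fps) = 1" by (rule subdegreeI) auto
  moreover have nz2: "fps_X * fps_exp (1 / 2) \<noteq> (0 :: real fps)" by simp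
  \<comment> \<open>Division of power series is exact when the subdegree of the divisor does not
    exceed that of the dividend; both are 1 here.\<close>
  ultimately have "?D dvd fps_X * fps_exp (1 / 2)" using nz by (subst fps_dvd_iff) auto
  hence "G * ?D = fps_X * fps_exp (1 / 2)" unfolding G by (rule dvd_div_mult_self)
  hence "G * (?D * fps_exp (- 1 / 2)) = fps_X * (fps_exp (1 / 2) * fps_exp (- 1 / 2))"
    by (metis mult.assoc)
  thus ?thesis by (simp add: left_diff_distrib fps_exp_add_mult[symmetric])
qed

text \<open>Substituting 2 pi i s in the Bernoulli series at 1/2 turns it into pi s / sin (pi s).
  Both series become c X when multiplied by the same nonzero series, so they agree.\<close>

lemma sinc_coeff_bernoulli:
  "sinc_coeff n = (2 * of_real pi * \<i>) ^ n * of_real (bernoulli_poly n (1 / 2) / fact n)"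
proof -
  define c where "c = 2 * of_real pi * \<i>"
  define G where "G = Abs_fps (\<lambda>n. bernoulli_poly n (1 / 2) / fact n)"
  define H where "H = Abs_fps (\<lambda>n. c ^ n * of_real (fps_nth G n))"
  have G: "G * (fps_exp (1 / 2) - fps_exp (- 1 / 2)) = fps_X" unfolding G_def by (rule bernoulli_half_fps)
  have E: "fps_nth (fps_exp (c / 2) - fps_exp (- c / 2)) n = c ^ n * of_real (fps_nth (fps_exp (1 / 2) - fps_exp (- 1 / 2)) n)" for n
  proof -
    have "c / 2 = c * of_real (1 / 2)" "- c / 2 = c * of_real (- 1 / 2)" by simp_all
    thus ?thesis by (simp only: fps_sub_nth fps_exp_nth power_mult_distrib of_real_diff of_real_divide of_real_power of_real_fact)
      (simp add: right_diff_distrib)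
  qed
  have H: "H * (fps_exp (c / 2) - fps_exp (- c / 2)) = fps_const c * fps_X"
  proof (rule fps_ext)
    fix n
    have "fps_nth (H * (fps_exp (c / 2) - fps_exp (- c / 2))) n = 
       (\<Sum>i=0..n. c ^ n * of_real (fps_nth G i * fps_nth (fps_exp (1 / 2) - fps_exp (- 1 / 2)) (n - i)))"
      unfolding fps_mult_nth E H_def fps_nth_Abs_fps
    proof (intro sum.cong refl)
      fix i assume "i \<in> {0..n}"
      hence "c ^ n = c ^ i * c ^ (n - i)" by (simp flip: power_add)
      thus "c ^ i * of_real (fps_nth G i) * (c ^ (n - i) * of_real (fps_nth (fps_exp (1 / 2) - fps_exp (- 1 / 2)) (n - i))) =
        c ^ n * of_real (fps_nth G i * fps_nth (fps_exp (1 / 2) - fps_exp (- 1 / 2)) (n - i))"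
        by (simp only: of_real_mult mult_ac)
    qed
    also have "\<dots> = c ^ n * of_real (fps_nth (G * (fps_exp (1 / 2) - fps_exp (- 1 / 2))) n)"
      by (simp only: fps_mult_nth sum_distrib_left of_real_sum)
    also have "\<dots> = fps_nth (fps_const c * fps_X) n" unfolding G by (cases "n = 1") auto
    finally show "fps_nth (H * (fps_exp (c / 2) - fps_exp (- c / 2))) n = fps_nth (fps_const c * fps_X) n" .
  qed
  define F where "F = fps_expansion (\<lambda>s. 1 / sincpi s) 0"
  have F: "(\<lambda>s. 1 / sincpi s) has_fps_expansion F" unfolding F_def
  proof (rule has_fps_expansion_fps_expansion)
    show "(\<lambda>s. 1 / sincpi s) holomorphic_on ball 0 (1 / 2)"
      by (intro holomorphic_intros holomorphic_on_subset[OF sincpi_holomorphic]) (auto simp: sincpi_nonzero)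
  qed auto
  have "(\<lambda>s. 1 / sincpi s * (exp (c / 2 * s) - exp (- c / 2 * s))) has_fps_expansion F * (fps_exp (c / 2) - fps_exp (- c / 2))"
    by (intro fps_expansion_intros F)
  also have "(\<lambda>s. 1 / sincpi s * (exp (c / 2 * s) - exp (- c / 2 * s))) has_fps_expansion F * (fps_exp (c / 2) - fps_exp (- c / 2)) \<longleftrightarrow>
       (\<lambda>s. c * s) has_fps_expansion F * (fps_exp (c / 2) - fps_exp (- c / 2))"
  proof (rule has_fps_expansion_cong)
    have "\<forall>\<^sub>F s in nhds (0::complex). s \<in> ball 0 (1 / 2)" by (intro eventually_nhds_in_open) auto
    thus "\<forall>\<^sub>F s in nhds 0. 1 / sincpi s * (exp (c / 2 * s) - exp (- c / 2 * s)) = c * s"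
    proof eventually_elim
      case (elim s)
      have e: "exp (c / 2 * s) - exp (- c / 2 * s) = 2 * \<i> * sin (of_real pi * s)"
        by (simp add: c_def sin_exp_eq mult_ac)
      have "sincpi s \<noteq> 0" using elim by (intro sincpi_nonzero) auto
      moreover have "sin (of_real pi * s) = sincpi s * of_real pi * s" by (simp add: sincpi_def)
      ultimately show ?case unfolding e by (simp add: c_def)
    qed
  qed auto
  finally have "(\<lambda>s. c * s) has_fps_expansion F * (fps_exp (c / 2) - fps_exp (- c / 2))" .
  moreover have "(\<lambda>s. c * s) has_fps_expansion fps_const c * fps_X" by (intro fps_expansion_intros)
  ultimately have "F * (fps_exp (c / 2) - fps_exp (- c / 2)) = fps_const c * fps_X"
    by (rule fps_expansion_unique_complex)
  with H have "(F - H) * (fps_exp (c / 2) - fps_exp (- c / 2)) = 0" by (simp add: left_diff_distrib)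
  moreover have "fps_nth (fps_exp (c / 2) - fps_exp (- c / 2)) 1 \<noteq> 0" by (simp add: c_def)
  hence "fps_exp (c / 2) - fps_exp (- c / 2) \<noteq> 0" by force
  ultimately have "F = H" by simp
  thus ?thesis by (simp add: sinc_coeff_def F_def H_def G_def c_def)
qed

lemma sinc_coeff_xi: "sinc_coeff (2 * k) = of_real ((2 * pi) ^ (2 * k) * xi k / (2 * fact (2 * k)))"
proof -
  have "(2 * of_real pi * \<i>) ^ (2 * k) = complex_of_real ((2 * pi) ^ (2 * k) * (- 1) ^ k)"
    by (simp only: power_mult_distrib) (simp add: power_mult)
  thus ?thesis unfolding sinc_coeff_bernoulli xi_def by simp
qed

text \<open>After w = t s the factor 1 / \<open>sincpi\<close> has the coefficients
  \<open>sinc_coeff\<close>, and multiplying by 1 - w^2 / (2 t) mixes in the one two places lower.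
  The radius below |t| / 2 keeps w / t in a disc where \<open>sincpi\<close> has no zero.\<close>

lemma sinc_contour:
  assumes "\<rho> > 0" "\<rho> < norm t / 2"
  shows "((\<lambda>w. (1 / sincpi (w / t) * (1 - w ^ 2 / (2 * t))) / w ^ Suc (2 * k)) has_contour_integral
     2 * of_real pi * \<i> * ((1 / t) ^ (2 * k) * (sinc_coeff (2 * k) - (if k = 0 then 0 else t / 2 * sinc_coeff (2 * k - 2)))))
     (circlepath 0 \<rho>)"
proof -
  have t: "t \<noteq> 0" using assms by auto
  let ?f = "\<lambda>w. 1 / sincpi (w / t) * (1 - w ^ 2 / (2 * t))"
  define F where "F = fps_expansion (\<lambda>s. 1 / sincpi s) 0"
  have F: "(\<lambda>s. 1 / sincpi s) has_fps_expansion F" unfolding F_def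
  proof (rule has_fps_expansion_fps_expansion)
    show "(\<lambda>s. 1 / sincpi s) holomorphic_on ball 0 (1 / 2)"
      by (intro holomorphic_intros holomorphic_on_subset[OF sincpi_holomorphic]) (auto simp: sincpi_nonzero)
  qed auto
  have hol: "?f holomorphic_on ball 0 (norm t / 2)"
  proof -
    have "sincpi (w / t) \<noteq> 0" if "w \<in> ball 0 (norm t / 2)" for w
      using that t by (intro sincpi_nonzero) (auto simp: norm_divide divide_simps)
    thus ?thesis using t
      by (intro holomorphic_intros holomorphic_on_compose_gen[OF _ sincpi_holomorphic, unfolded o_def]) auto
  qed
  have "((\<lambda>s. 1 / sincpi s) \<circ> (\<lambda>w. 1 / t * w)) has_fps_expansion (F oo (fps_const (1 / t) * fps_X))"
    by (intro has_fps_expansion_compose F fps_expansion_intros) auto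
  hence "(\<lambda>w. 1 / sincpi (w / t)) has_fps_expansion (F oo (fps_const (1 / t) * fps_X))"
    by (simp add: o_def)
  moreover have "(\<lambda>w. 1 - 1 / (2 * t) * w ^ 2) has_fps_expansion 1 - fps_const (1 / (2 * t)) * fps_X ^ 2"
    by (intro fps_expansion_intros)
  ultimately have "(\<lambda>w. 1 / sincpi (w / t) * (1 - 1 / (2 * t) * w ^ 2)) has_fps_expansion 
     (F oo (fps_const (1 / t) * fps_X)) * (1 - fps_const (1 / (2 * t)) * fps_X ^ 2)"
    by (rule has_fps_expansion_mult)
  hence "?f has_fps_expansion (F oo (fps_const (1 / t) * fps_X)) * (1 - fps_const (1 / (2 * t)) * fps_X ^ 2)"
    by simp
  hence "(deriv ^^ (2 * k)) ?f 0 / fact (2 * k) = 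
      fps_nth ((F oo (fps_const (1 / t) * fps_X)) * (1 - fps_const (1 / (2 * t)) * fps_X ^ 2)) (2 * k)"
    by (rule fps_nth_fps_expansion[symmetric])
  also have "\<dots> = fps_nth (F oo (fps_const (1 / t) * fps_X)) (2 * k) 
      - (if k = 0 then 0 else 1 / (2 * t) * fps_nth (F oo (fps_const (1 / t) * fps_X)) (2 * k - 2))"
    by (simp add: right_diff_distrib fps_X_power_mult_right_nth mult.left_commute[of _ "fps_const _"])
  also have "\<dots> = (1 / t) ^ (2 * k) * (sinc_coeff (2 * k) - (if k = 0 then 0 else t / 2 * sinc_coeff (2 * k - 2)))"
  proof (cases k)
    case (Suc j)
    have "(1 / t) ^ (2 * k) * (t / 2) = 1 / (2 * t) * (1 / t) ^ (2 * k - 2)"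
      using t by (simp add: Suc field_simps)
    thus ?thesis unfolding fps_compose_linear fps_nth_Abs_fps sinc_coeff_def F_def
      using Suc by (simp add: right_diff_distrib mult.assoc[symmetric])
  qed (simp only: fps_compose_linear sinc_coeff_def F_def fps_nth_Abs_fps, simp)
  finally have d: "(deriv ^^ (2 * k)) ?f 0 / fact (2 * k) = 
     (1 / t) ^ (2 * k) * (sinc_coeff (2 * k) - (if k = 0 then 0 else t / 2 * sinc_coeff (2 * k - 2)))" .
  have "((\<lambda>w. ?f w / (w - 0) ^ Suc (2 * k)) has_contour_integral (2 * pi * \<i> / fact (2 * k)) * (deriv ^^ (2 * k)) ?f 0) (circlepath 0 \<rho>)"
    by (intro Cauchy_has_contour_integral_higher_derivative_circlepath holomorphic_on_imp_continuous_on holomorphic_on_subset[OF hol])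
       (use assms in auto)
  moreover have "(2 * pi * \<i> / fact (2 * k)) * (deriv ^^ (2 * k)) ?f 0 = 2 * of_real pi * \<i> * ((deriv ^^ (2 * k)) ?f 0 / fact (2 * k))"
    by simp
  ultimately show ?thesis unfolding d by simp
qed

section \<open>Contour integrals for the coefficients\<close>

text \<open>The partial product as a function of q. For N \<ge> n it has the same n-th coefficient
  as the infinite product, so the contour is moved with a finite product, and N tends to infinity
  only on the final contour.\<close>

definition crank_part :: "nat \<Rightarrow> complex \<Rightarrow> complex \<Rightarrow> complex" where
  "crank_part N w q = (\<Prod>j<N. (1 - q ^ Suc j) / ((1 - exp w * q ^ Suc j) * (1 - exp (- w) * q ^ Suc j)))"

lemma norm_exp_mult_power_less:
  fixes q w :: complex
  assumes "norm q < exp (- norm w)"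
  shows "norm (exp w * q ^ Suc j) < 1"
proof -
  have "exp (- norm w) \<le> 1" by simp
  hence q1: "norm q \<le> 1" using assms by linarith
  have "norm (exp w * q ^ Suc j) = exp (Re w) * (norm q * norm q ^ j)" by (simp add: norm_mult norm_power norm_exp_eq_Re)
  also have "\<dots> \<le> exp (norm w) * (norm q * 1)"
    using q1 complex_Re_le_cmod[of w] by (intro mult_mono mult_left_mono power_le_one) auto
  also have "\<dots> < exp (norm w) * exp (- norm w)" using assms by simp
  finally show ?thesis by (simp flip: exp_add)
qed

lemma crank_part_denom_nonzero:
  fixes q w :: complex
  assumes "norm q < exp (- norm w)"
  shows "1 - exp w * q ^ Suc j \<noteq> 0" "1 - exp (- w) * q ^ Suc j \<noteq> 0"
  using norm_exp_mult_power_less[of q w j] norm_exp_mult_power_less[of q "- w" j] assms by auto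

lemma crank_part_holomorphic: "crank_part N w holomorphic_on ball 0 (exp (- norm w))"
  unfolding crank_part_def
  by (intro holomorphic_intros no_zero_divisors crank_part_denom_nonzero) auto

lemma crank_part_expansion:
  "crank_part N w has_fps_expansion (\<Prod>j<N. crank_factor_at (exp w) (Suc j))"
proof -
  have "(\<lambda>q. (1 - q ^ Suc j) / ((1 - exp w * q ^ Suc j) * (1 - exp (- w) * q ^ Suc j))) has_fps_expansion crank_factor_at (exp w) (Suc j)" for j
    unfolding crank_factor_at_def exp_minus
    by (intro has_fps_expansion_divide' fps_expansion_intros) simp_all
  thus ?thesis unfolding crank_part_def by (intro has_fps_expansion_prod)
qed

lemma crank_exp_sum_contour:
  assumes "n \<le> N" "0 < r" "r < exp (- norm w)"
  shows "((\<lambda>q. crank_part N w q / q ^ Suc n) has_contour_integral (2 * of_real pi * \<i> * crank_exp_sum n w)) (circlepath 0 r)"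
proof -
  have "crank_exp_sum n w = (deriv ^^ n) (crank_part N w) 0 / fact n"
    unfolding crank_exp_sum_eq[OF assms(1)] by (rule fps_nth_fps_expansion[OF crank_part_expansion])
  moreover have "((\<lambda>q. crank_part N w q / (q - 0) ^ Suc n) has_contour_integral 
       (2 * pi * \<i>) / fact n * (deriv ^^ n) (crank_part N w) 0) (circlepath 0 r)"
    by (intro Cauchy_has_contour_integral_higher_derivative_circlepath holomorphic_on_imp_continuous_on
          holomorphic_on_subset[OF crank_part_holomorphic]) (use assms in auto)
  ultimately show ?thesis by simp
qed

definition crank_integrand :: "nat \<Rightarrow> nat \<Rightarrow> complex \<Rightarrow> complex \<Rightarrow> complex" where
  "crank_integrand N n w t = crank_part N w (exp (- t)) * exp (of_nat n * t)"

lemma crank_integrand_holomorphic: "crank_integrand N n w holomorphic_on {t. norm w < Re t}"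
proof -
  have "(crank_part N w \<circ> (\<lambda>t. exp (- t))) holomorphic_on {t. norm w < Re t}"
    by (rule holomorphic_on_compose_gen[OF _ crank_part_holomorphic])
       (auto intro!: holomorphic_intros simp: norm_exp_eq_Re)
  thus ?thesis unfolding crank_integrand_def o_def by (intro holomorphic_intros)
qed

lemma crank_integrand_periodic:
  "crank_integrand N n w (Complex e (x + 2 * pi)) = crank_integrand N n w (Complex e x)"
proof -
  have 1: "Complex e (x + 2 * pi) = Complex e x + 2 * of_real pi * \<i>" by (simp add: complex_eq_iff)
  have "exp (Complex e x + 2 * of_real pi * \<i>) = exp (Complex e x)"
    by (simp add: exp_add exp_two_pi_i)
  thus ?thesis unfolding 1 crank_integrand_def exp_minus exp_of_nat_mult by (simp only:)
qed

lemma cos_ge_arc: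
  assumes "\<psi> \<in> {- pi / 4..pi / 4}"
  shows "sqrt 2 / 2 \<le> cos \<psi>"
proof -
  have "cos (pi / 4) \<le> cos \<bar>\<psi>\<bar>" using assms by (intro cos_monotone_0_pi_le) auto
  thus ?thesis by (simp add: cos_45)
qed

lemma Re_arc_ge:
  assumes "e \<ge> 0" "\<psi> \<in> {- pi / 4..pi / 4}"
  shows "e \<le> Re (of_real (sqrt 2 * e) * cis \<psi>)"
proof -
  have "sqrt 2 * e * (sqrt 2 / 2) \<le> sqrt 2 * e * cos \<psi>"
    using assms cos_ge_arc by (intro mult_left_mono) auto
  moreover have "sqrt 2 * e * (sqrt 2 / 2) = e" by simp
  moreover have "Re (of_real (sqrt 2 * e) * cis \<psi>) = sqrt 2 * e * cos \<psi>" by simp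
  ultimately show ?thesis by linarith
qed

text \<open>Under q = exp (- t) the circle |q| = exp (- e) becomes a vertical segment of length 2
  pi. It is traversed downwards, which a reflection and a shift by the period undo.\<close>

lemma crank_exp_sum_line:
  assumes "n \<le> N" "norm w < e"
  shows "2 * of_real pi * crank_exp_sum n w = integral {0..2 * pi} (\<lambda>x. crank_integrand N n w (Complex e x))"
proof -
  define r where "r = exp (- e)"
  have r: "0 < r" "r < exp (- norm w)" using assms by (auto simp: r_def)
  let ?h = "\<lambda>x. crank_integrand N n w (Complex e x)"
  have cont: "continuous_on A ?h" for A
  proof -
    have "continuous_on A (crank_integrand N n w \<circ> Complex e)"
      by (rule continuous_on_compose[OF _ continuous_on_subset[OF holomorphic_on_imp_continuous_on[OF crank_integrand_holomorphic]]])
         (use assms in \<open>auto intro!: continuous_intros simp: Complex_eq\<close>)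
    thus ?thesis by (simp add: o_def)
  qed
  have "2 * of_real pi * \<i> * crank_exp_sum n w = contour_integral (part_circlepath 0 r 0 (2 * pi)) (\<lambda>q. crank_part N w q / q ^ Suc n)"
    using crank_exp_sum_contour[OF assms(1) r] by (simp add: contour_integral_unique circlepath_def)
  also have "\<dots> = integral {0..2 * pi} (\<lambda>\<theta>. crank_part N w (0 + r * cis \<theta>) / (0 + r * cis \<theta>) ^ Suc n * r * \<i> * cis \<theta>)"
    by (rule contour_integral_part_circlepath_eq) simp
  also have "\<dots> = integral {0..2 * pi} (\<lambda>\<theta>. \<i> * ?h (- \<theta>))"
  proof (rule integral_cong)
    fix \<theta> :: real
    have q: "exp (- Complex e (- \<theta>)) = of_real r * cis \<theta>"
      by (simp add: r_def Complex_eq exp_diff exp_minus cis_conv_exp exp_of_real[symmetric] divide_inverse)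
    have "exp (of_nat n * Complex e (- \<theta>)) = inverse (exp (- Complex e (- \<theta>)) ^ n)"
      unfolding exp_of_nat_mult[symmetric] by (simp add: exp_minus[symmetric])
    hence "exp (of_nat n * Complex e (- \<theta>)) = 1 / (of_real r * cis \<theta>) ^ n" unfolding q by (simp add: divide_inverse)
    thus "crank_part N w (0 + r * cis \<theta>) / (0 + r * cis \<theta>) ^ Suc n * r * \<i> * cis \<theta> = \<i> * ?h (- \<theta>)"
      unfolding crank_integrand_def q using r by (simp add: field_simps)
  qed
  also have "\<dots> = \<i> * integral {0..2 * pi} (\<lambda>\<theta>. ?h (- \<theta>))" by simp
  also have "integral {0..2 * pi} (\<lambda>\<theta>. ?h (- \<theta>)) = integral {- (2 * pi)..0} ?h"
    using Henstock_Kurzweil_Integration.integral_reflect_real[of 0 "- (2 * pi)" ?h] by simp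
  also have "\<dots> = integral {- (2 * pi)..0} (?h \<circ> (\<lambda>x. x + 2 * pi))"
    by (simp add: o_def crank_integrand_periodic)
  also have "\<dots> = integral {- (2 * pi) + 2 * pi..0 + 2 * pi} ?h"
    by (rule integral_shift) (rule cont)
  finally have "\<i> * (2 * of_real pi * crank_exp_sum n w) = \<i> * integral {0..2 * pi} ?h"
    by (simp add: mult_ac)
  thus ?thesis by (simp only: mult_cancel_left complex_i_not_zero simp_thms)
qed

lemma contour_integral_eq_convex:
  assumes hol: "f holomorphic_on S" and S: "convex S" "open S"
    and "valid_path g" "path_image g \<subseteq> S" "valid_path h" "path_image h \<subseteq> S"
    and "pathstart g = pathstart h" "pathfinish g = pathfinish h"
  shows "contour_integral g f = contour_integral h f"
proof -
  have int: "f contour_integrable_on g" "f contour_integrable_on h"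
    by (intro contour_integrable_holomorphic_simple[OF hol S(2)] assms)+
  have "(f has_contour_integral 0) (g +++ reversepath h)"
    using assms by (intro Cauchy_theorem_convex_simple[OF hol S(1)]) (auto simp: path_image_join)
  hence "contour_integral (g +++ reversepath h) f = 0" by (rule contour_integral_unique)
  moreover have "contour_integral (g +++ reversepath h) f = contour_integral g f + contour_integral (reversepath h) f"
    using int assms by (intro contour_integral_join) (auto simp: contour_integrable_reversepath)
  moreover have "contour_integral (reversepath h) f = - contour_integral h f"
    using assms by (intro contour_integral_reversepath)
  ultimately show ?thesis by (simp only: add_eq_0_iff2 minus_minus)
qed

text \<open>The part of the line with |Im t| \<le> e is replaced by the arc of radius sqrt 2 * e
  with the same end points e - i e and e + i e. Both lie in the half-plane Re t > |w|, which is
  convex and free of poles.\<close>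

lemma crank_exp_sum_arc:
  assumes "n \<le> N" "norm w < e" "e \<le> pi"
  shows "2 * of_real pi * crank_exp_sum n w = 
     integral {e..2 * pi - e} (\<lambda>x. crank_integrand N n w (Complex e x)) +
     integral {- pi / 4..pi / 4} (\<lambda>\<psi>. crank_integrand N n w (of_real (sqrt 2 * e) * cis \<psi>) * (of_real (sqrt 2 * e) * cis \<psi>))"
proof -
  let ?h = "\<lambda>x. crank_integrand N n w (Complex e x)"
  let ?f = "crank_integrand N n w"
  have e: "e > 0" using assms(2) norm_ge_zero[of w] by linarith
  have cont: "continuous_on A ?h" for A
  proof -
    have "continuous_on A (crank_integrand N n w \<circ> Complex e)"
      by (rule continuous_on_compose[OF _ continuous_on_subset[OF holomorphic_on_imp_continuous_on[OF crank_integrand_holomorphic]]])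
         (use assms in \<open>auto intro!: continuous_intros simp: Complex_eq\<close>)
    thus ?thesis by (simp add: o_def)
  qed
  have int: "?h integrable_on {a..b}" for a b by (intro integrable_continuous_real cont)
  have "2 * of_real pi * crank_exp_sum n w = integral {0..2 * pi} ?h" by (rule crank_exp_sum_line[OF assms(1,2)])
  also have "\<dots> = integral {0..e} ?h + integral {e..2 * pi} ?h"
    by (rule Henstock_Kurzweil_Integration.integral_combine[symmetric]) (use e assms int in auto)
  \<comment> \<open>By periodicity the piece next to 2 pi joins the one next to 0 to a segment
    symmetric about the real axis.\<close>
  also have "integral {e..2 * pi} ?h = integral {e..2 * pi - e} ?h + integral {2 * pi - e..2 * pi} ?h"
    by (rule Henstock_Kurzweil_Integration.integral_combine[symmetric]) (use e assms int in auto)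
  also have "integral {2 * pi - e..2 * pi} ?h = integral {- e + 2 * pi..0 + 2 * pi} ?h" by simp
  also have "\<dots> = integral {- e..0} (?h \<circ> (\<lambda>x. x + 2 * pi))"
    by (rule integral_shift[symmetric]) (rule cont)
  also have "\<dots> = integral {- e..0} ?h" by (simp add: o_def crank_integrand_periodic)
  also have "integral {0..e} ?h + (integral {e..2 * pi - e} ?h + integral {- e..0} ?h) =
     integral {e..2 * pi - e} ?h + (integral {- e..0} ?h + integral {0..e} ?h)" by simp
  also have "integral {- e..0} ?h + integral {0..e} ?h = integral {- e..e} ?h"
    by (rule Henstock_Kurzweil_Integration.integral_combine) (use e int in auto)
  also have "integral {- e..e} ?h = - \<i> * contour_integral (linepath (Complex e (- e)) (Complex e e)) ?f"
  proof -
    have h: "\<i> * integral {- e..e} ?h = contour_integral (linepath (Complex e (- e)) (Complex e e)) ?f"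
      by (rule contour_integral_linepath_same_Re[symmetric]) (use e in auto)
    have "a = - \<i> * (\<i> * a)" for a by (simp flip: mult.assoc)
    thus ?thesis unfolding h[symmetric] .
  qed
  also have "contour_integral (linepath (Complex e (- e)) (Complex e e)) ?f = 
     contour_integral (part_circlepath 0 (sqrt 2 * e) (- pi / 4) (pi / 4)) ?f"
  proof -
    let ?l = "linepath (Complex e (- e)) (Complex e e)" and ?a = "part_circlepath 0 (sqrt 2 * e) (- pi / 4) (pi / 4)"
    define S where "S = {t. norm w < Re t}"
    have S: "convex S" "open S" unfolding S_def by (auto simp: convex_halfspace_Re_gt open_halfspace_Re_gt)
    have c4: "cos (pi / 4) = sqrt 2 / 2" "sin (pi / 4) = sqrt 2 / 2" by (simp_all add: cos_45 sin_45)
    have starts: "pathstart ?a = Complex e (- e)" "pathfinish ?a = Complex e e"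
      by (simp_all add: complex_eq_iff exp_eq_polar c4 Re_exp Im_exp)
    have limg: "path_image ?l \<subseteq> S"
    proof -
      have "closed_segment (Complex e (- e)) (Complex e e) \<subseteq> S"
        using assms by (intro closed_segment_subset S(1)) (auto simp: S_def)
      thus ?thesis by simp
    qed
    have aimg: "path_image ?a \<subseteq> S"
    proof
      fix z assume "z \<in> path_image ?a"
      then obtain \<psi> where "\<psi> \<in> closed_segment (- pi / 4) (pi / 4)" "z = 0 + of_real (sqrt 2 * e) * exp (\<i> * of_real \<psi>)"
        by (subst (asm) path_image_part_circlepath') (auto simp: cis_conv_exp)
      hence \<psi>: "\<psi> \<in> {- pi / 4..pi / 4}" "z = of_real (sqrt 2 * e) * cis \<psi>"
        by (auto simp: closed_segment_eq_real_ivl cis_conv_exp split: if_splits)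
      have "e \<le> Re z" unfolding \<psi>(2) using e by (intro Re_arc_ge \<psi>) auto
      thus "z \<in> S" using assms by (simp add: S_def)
    qed
    have hol: "?f holomorphic_on S" unfolding S_def by (rule crank_integrand_holomorphic)
    show ?thesis
      by (rule contour_integral_eq_convex[OF hol S]) (use limg aimg starts in auto)
  qed
  also have "contour_integral (part_circlepath 0 (sqrt 2 * e) (- pi / 4) (pi / 4)) ?f = 
     integral {- pi / 4..pi / 4} (\<lambda>\<psi>. ?f (0 + of_real (sqrt 2 * e) * cis \<psi>) * of_real (sqrt 2 * e) * \<i> * cis \<psi>)"
    by (rule contour_integral_part_circlepath_eq) simp
  also have "\<dots> = \<i> * integral {- pi / 4..pi / 4} (\<lambda>\<psi>. ?f (of_real (sqrt 2 * e) * cis \<psi>) * (of_real (sqrt 2 * e) * cis \<psi>))"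
    by (simp only: integral_mult_right[symmetric] mult_ac add_0_left)
  finally show ?thesis by simp
qed

definition crank_fun :: "complex \<Rightarrow> complex \<Rightarrow> complex" where
  "crank_fun w t = exp (log_partition t) / kap_prod w t"

text \<open>A geometric bound uniform in q, for the Weierstrass test. With |w| \<le> e / 2 and |q|
  \<le> exp (- e) both factors of the denominator have norm at least 1 - exp (- e / 2).\<close>

lemma crank_factor_minus_one:
  fixes q w :: complex
  assumes e: "e > 0" and w: "norm w \<le> e / 2" and q: "norm q \<le> exp (- e)"
  shows "norm ((1 - q ^ Suc j) / ((1 - exp w * q ^ Suc j) * (1 - exp (- w) * q ^ Suc j)) - 1) \<le> 
     (2 * exp (e / 2) + 2) / (1 - exp (- e / 2)) ^ 2 * exp (- e) ^ Suc j"
proof -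
  define Q where "Q = q ^ Suc j"
  have Q: "norm Q \<le> exp (- e) ^ Suc j" unfolding Q_def norm_power using q by (intro power_mono) auto
  have "exp (- e) ^ Suc j \<le> exp (- e) ^ 1" using e by (intro power_decreasing) auto
  hence "exp (- e) ^ Suc j \<le> exp (- e)" by (simp only: power_one_right)
  with Q have Q1: "norm Q \<le> exp (- e)" by (rule order.trans)
  have x: "norm (exp v) \<le> exp (e / 2)" if "norm v \<le> e / 2" for v :: complex
    using that complex_Re_le_cmod[of v] by (simp add: norm_exp_eq_Re)
  have d: "1 - exp (- e / 2) \<le> norm (1 - exp v * Q)" if "norm v \<le> e / 2" for v
  proof -
    have "norm (exp v * Q) \<le> exp (e / 2) * exp (- e)" unfolding norm_mult using x[OF that] Q1 by (intro mult_mono) auto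
    also have "\<dots> = exp (- e / 2)" by (simp flip: exp_add)
    finally show ?thesis using norm_triangle_ineq2[of 1 "exp v * Q"] by simp
  qed
  have \<eta>: "1 - exp (- e / 2) > 0" using e by simp
  have den: "(1 - exp (- e / 2)) ^ 2 \<le> norm ((1 - exp w * Q) * (1 - exp (- w) * Q))"
    unfolding norm_mult power2_eq_square using d[OF w] d[of "- w"] w \<eta> by (intro mult_mono) auto
  have ne: "(1 - exp w * Q) * (1 - exp (- w) * Q) \<noteq> 0" using den \<eta> by (metis norm_zero not_le zero_less_power)
  have "exp w * exp (- w) = 1" by (simp flip: exp_add)
  hence "(1 - exp w * Q) * (1 - exp (- w) * Q) = 1 - (exp w + exp (- w)) * Q + Q * Q"
    by (simp add: algebra_simps)
  hence "(1 - Q) / ((1 - exp w * Q) * (1 - exp (- w) * Q)) - 1 = 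
     Q * (exp w + exp (- w) - 1 - Q) / ((1 - exp w * Q) * (1 - exp (- w) * Q))"
  proof -
    assume D: "(1 - exp w * Q) * (1 - exp (- w) * Q) = 1 - (exp w + exp (- w)) * Q + Q * Q"
    have "(1 - Q) / d - 1 = (1 - Q - d) / d" if "d \<noteq> 0" for d using that by (simp add: diff_divide_distrib)
    from this[OF ne] have "(1 - Q) / ((1 - exp w * Q) * (1 - exp (- w) * Q)) - 1 = 
      (1 - Q - (1 - exp w * Q) * (1 - exp (- w) * Q)) / ((1 - exp w * Q) * (1 - exp (- w) * Q))" .
    also have "1 - Q - (1 - exp w * Q) * (1 - exp (- w) * Q) = Q * (exp w + exp (- w) - 1 - Q)"
      unfolding D by (simp add: algebra_simps)
    finally show ?thesis .
  qed
  also have "norm \<dots> \<le> exp (- e) ^ Suc j * (2 * exp (e / 2) + 2) / (1 - exp (- e / 2)) ^ 2"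
  proof -
    have "norm (exp w + exp (- w) - 1 - Q) \<le> norm (exp w) + norm (exp (- w)) + 1 + norm Q"
      by (intro order.trans[OF norm_triangle_ineq4] add_mono norm_triangle_ineq) auto
    also have "\<dots> \<le> exp (e / 2) + exp (e / 2) + 1 + 1"
      using x[OF w] x[of "- w"] w Q1 e by (intro add_mono) (auto intro: order.trans)
    finally have "norm (exp w + exp (- w) - 1 - Q) \<le> 2 * exp (e / 2) + 2" by simp
    thus ?thesis unfolding norm_divide norm_mult[of Q] using Q den \<eta>
      by (intro frac_le mult_mono) auto
  qed
  finally show ?thesis by (simp add: Q_def mult_ac)
qed

text \<open>Stated for a path g in Re t \<ge> e and a weight h, so that it applies to the segment
  and to the arc alike. Uniform convergence of the product on the compact interval allows the limit
  under the integral.\<close>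

lemma crank_integrand_limit:
  assumes e: "e > 0" and w: "norm w \<le> e / 2"
    and g: "continuous_on {a..b} g" "\<And>x. x \<in> {a..b} \<Longrightarrow> Re (g x) \<ge> e"
    and h: "continuous_on {a..b} h"
  shows "(\<lambda>x. crank_fun w (g x) * exp (of_nat n * g x) * h x) integrable_on {a..b :: real}"
    "(\<lambda>N. integral {a..b} (\<lambda>x. crank_integrand N n w (g x) * h x)) \<longlonglongrightarrow> 
       integral {a..b} (\<lambda>x. crank_fun w (g x) * exp (of_nat n * g x) * h x)"
proof -
  define f where "f = (\<lambda>j x. (1 - exp (- g x) ^ Suc j) / ((1 - exp w * exp (- g x) ^ Suc j) * (1 - exp (- w) * exp (- g x) ^ Suc j)))"
  have we: "norm w < e" using w e by simp
  have ne: "1 - exp w * exp (- g x) ^ Suc j \<noteq> 0" "1 - exp (- w) * exp (- g x) ^ Suc j \<noteq> 0" if "x \<in> {a..b}" for x j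
    by (rule crank_part_denom_nonzero; use g(2)[OF that] we in \<open>simp add: norm_exp_eq_Re\<close>)+
  have contf: "continuous_on {a..b} (f j)" for j
    unfolding f_def using ne by (intro continuous_intros g(1)) auto
  have "uniform_limit {a..b} (\<lambda>N x. \<Sum>j<N. norm (f j x - 1)) (\<lambda>x. \<Sum>j. norm (f j x - 1)) sequentially"
  proof (rule Weierstrass_m_test)
    show "norm (norm (f j x - 1)) \<le> (2 * exp (e / 2) + 2) / (1 - exp (- e / 2)) ^ 2 * exp (- e) ^ Suc j" if "x \<in> {a..b}" for j x
      unfolding f_def real_norm_def abs_norm_cancel by (rule crank_factor_minus_one[OF e w]) (use g(2)[OF that] in \<open>simp add: norm_exp_eq_Re\<close>)
    show "summable (\<lambda>j. (2 * exp (e / 2) + 2) / (1 - exp (- e / 2)) ^ 2 * exp (- e) ^ Suc j)"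
      using e by (intro summable_mult) (subst summable_Suc_iff, simp add: summable_geometric)
  qed
  hence "uniformly_convergent_on {a..b} (\<lambda>N x. \<Sum>j<N. norm (f j x - 1))"
    by (auto simp: uniformly_convergent_on_def)
  hence "uniformly_convergent_on {a..b} (\<lambda>N x. \<Prod>j<N. f j x)"
    by (intro Infinite_Products.uniformly_convergent_on_prod' contf) auto
  then obtain l where l: "uniform_limit {a..b} (\<lambda>N x. \<Prod>j<N. f j x) l sequentially"
    by (auto simp: uniformly_convergent_on_def)
  have lx: "l x = crank_fun w (g x)" if "x \<in> {a..b}" for x
  proof (rule LIMSEQ_unique)
    show "(\<lambda>N. \<Prod>j<N. f j x) \<longlonglongrightarrow> l x" using l that by (rule tendsto_uniform_limitI)
    show "(\<lambda>N. \<Prod>j<N. f j x) \<longlonglongrightarrow> crank_fun w (g x)"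
      unfolding f_def crank_fun_def using g(2)[OF that] e w by (intro crank_prod_tendsto) auto
  qed
  have contl: "continuous_on {a..b} l"
    by (rule uniform_limit_theorem[OF _ l]) (auto intro!: continuous_intros contf always_eventually)
  have bdd: "bounded (l ` {a..b})" "bounded ((\<lambda>x. exp (of_nat n * g x) * h x) ` {a..b})"
    by (intro compact_imp_bounded compact_continuous_image continuous_intros g h contl; simp)+
  have "uniform_limit {a..b} (\<lambda>N x. (\<Prod>j<N. f j x) * (exp (of_nat n * g x) * h x)) (\<lambda>x. l x * (exp (of_nat n * g x) * h x)) sequentially"
    by (rule uniform_lim_mult[OF l uniform_limit_const bdd])
  then obtain I J where IJ: "\<And>N. ((\<lambda>x. (\<Prod>j<N. f j x) * (exp (of_nat n * g x) * h x)) has_integral I N) {a..b}"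
     "((\<lambda>x. l x * (exp (of_nat n * g x) * h x)) has_integral J) {a..b}" "I \<longlonglongrightarrow> J"
    by (rule uniform_limit_integral) (auto intro!: continuous_intros contf g h)
  have "((\<lambda>x. l x * (exp (of_nat n * g x) * h x)) has_integral J) {a..b} \<longleftrightarrow>
     ((\<lambda>x. crank_fun w (g x) * exp (of_nat n * g x) * h x) has_integral J) {a..b}"
    by (rule has_integral_cong) (simp add: lx)
  hence J: "((\<lambda>x. crank_fun w (g x) * exp (of_nat n * g x) * h x) has_integral J) {a..b}" using IJ by simp
  thus "(\<lambda>x. crank_fun w (g x) * exp (of_nat n * g x) * h x) integrable_on {a..b}" by blast
  have I: "I N = integral {a..b} (\<lambda>x. crank_integrand N n w (g x) * h x)" for N
    using IJ(1)[of N] by (simp add: integral_unique crank_integrand_def crank_part_def f_def mult.assoc del: power_Suc)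
  thus "(\<lambda>N. integral {a..b} (\<lambda>x. crank_integrand N n w (g x) * h x)) \<longlonglongrightarrow> 
       integral {a..b} (\<lambda>x. crank_fun w (g x) * exp (of_nat n * g x) * h x)"
  proof -
    have "I = (\<lambda>N. integral {a..b} (\<lambda>x. crank_integrand N n w (g x) * h x))" by (rule ext) (rule I)
    with IJ(3) show ?thesis by (simp only: integral_unique[OF J])
  qed
qed

lemma crank_exp_sum_integral:
  fixes n :: nat
  assumes e: "e > 0" "e \<le> pi" and w: "norm w \<le> e / 2"
  defines "\<Psi> \<equiv> \<lambda>t. crank_fun w t * exp (of_nat n * t)"
  shows "2 * of_real pi * crank_exp_sum n w = 
     integral {e..2 * pi - e} (\<lambda>x. \<Psi> (Complex e x)) +
     integral {- pi / 4..pi / 4} (\<lambda>\<psi>. \<Psi> (of_real (sqrt 2 * e) * cis \<psi>) * (of_real (sqrt 2 * e) * cis \<psi>))"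
    "(\<lambda>x. \<Psi> (Complex e x)) integrable_on {e..2 * pi - e}"
    "(\<lambda>\<psi>. \<Psi> (of_real (sqrt 2 * e) * cis \<psi>) * (of_real (sqrt 2 * e) * cis \<psi>)) integrable_on {- pi / 4..pi / 4}"
proof -
  have we: "norm w < e" using w e by simp
  have c1: "continuous_on A (Complex e)" for A unfolding Complex_eq by (intro continuous_intros)
  have c2: "continuous_on A (\<lambda>\<psi>. of_real (sqrt 2 * e) * cis \<psi>)" for A by (intro continuous_intros)
  have re: "Re (of_real (sqrt 2 * e) * cis \<psi>) \<ge> e" if "\<psi> \<in> {- pi / 4..pi / 4}" for \<psi>
    using Re_arc_ge[OF _ that, of e] e by simp
  note L1 = crank_integrand_limit[OF e(1) w c1 _ continuous_on_const[of _ 1], of e "2 * pi - e" n, simplified]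
  note L2 = crank_integrand_limit[OF e(1) w c2 re c2, where n = n]
  show "(\<lambda>x. \<Psi> (Complex e x)) integrable_on {e..2 * pi - e}" using L1(1) by (simp add: \<Psi>_def)
  show "(\<lambda>\<psi>. \<Psi> (of_real (sqrt 2 * e) * cis \<psi>) * (of_real (sqrt 2 * e) * cis \<psi>)) integrable_on {- pi / 4..pi / 4}"
    using L2(1) by (simp add: \<Psi>_def)
  \<comment> \<open>For N \<ge> n the sum of the two integrals does not depend on N, so its limit is
    the value sought.\<close>
  have ev: "\<forall>\<^sub>F N in sequentially. integral {e..2 * pi - e} (\<lambda>x. crank_integrand N n w (Complex e x)) +
     integral {- pi / 4..pi / 4} (\<lambda>\<psi>. crank_integrand N n w (of_real (sqrt 2 * e) * cis \<psi>) * (of_real (sqrt 2 * e) * cis \<psi>))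
     = 2 * of_real pi * crank_exp_sum n w"
    using eventually_ge_at_top[of n] by eventually_elim (rule crank_exp_sum_arc[OF _ we e(2), symmetric])
  have lim: "(\<lambda>N. integral {e..2 * pi - e} (\<lambda>x. crank_integrand N n w (Complex e x)) +
     integral {- pi / 4..pi / 4} (\<lambda>\<psi>. crank_integrand N n w (of_real (sqrt 2 * e) * cis \<psi>) * (of_real (sqrt 2 * e) * cis \<psi>)))
     \<longlonglongrightarrow> integral {e..2 * pi - e} (\<lambda>x. \<Psi> (Complex e x)) +
     integral {- pi / 4..pi / 4} (\<lambda>\<psi>. \<Psi> (of_real (sqrt 2 * e) * cis \<psi>) * (of_real (sqrt 2 * e) * cis \<psi>))"
    unfolding \<Psi>_def using L1(2) L2(2) by (intro tendsto_add)
  show "2 * of_real pi * crank_exp_sum n w = 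
     integral {e..2 * pi - e} (\<lambda>x. \<Psi> (Complex e x)) +
     integral {- pi / 4..pi / 4} (\<lambda>\<psi>. \<Psi> (of_real (sqrt 2 * e) * cis \<psi>) * (of_real (sqrt 2 * e) * cis \<psi>))"
    by (rule LIMSEQ_unique[OF tendsto_eventually[OF ev] lim])
qed

section \<open>Estimates on the contour\<close>

text \<open>Divides the asymptotics of P by that of \<open>kap_prod\<close>. Within a relative
  O(t^2) the quotient 1 / (1 + e) may be replaced by 1 - e, since e = w^2 / (2 t) is O(t).\<close>

lemma crank_fun_asymp:
  obtains C \<delta> where "C > 0" "\<delta> > 0" "\<delta> \<le> 1"
    "\<And>t w. t \<in> sector \<Longrightarrow> t \<noteq> 0 \<Longrightarrow> norm t \<le> \<delta> \<Longrightarrow> norm w \<le> Re t / 2 \<Longrightarrow>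
       norm (crank_fun w t - exp (of_real (pi ^ 2 / 6) / t + Ln t / 2 - t / 24) / of_real (sqrt (2 * pi)) * 
           (1 / sincpi (w / t) * (1 - w ^ 2 / (2 * t))))
       \<le> C * norm t ^ 2 * norm (exp (of_real (pi ^ 2 / 6) / t + Ln t / 2 - t / 24))"
proof -
  obtain C1 \<delta>1 where C1: "C1 > 0" "\<delta>1 > 0" "\<delta>1 \<le> 1"
    "\<And>t. t \<in> sector \<Longrightarrow> t \<noteq> 0 \<Longrightarrow> norm t \<le> \<delta>1 \<Longrightarrow> 
       norm (exp (partition_err t) * of_real (sqrt (2 * pi)) - 1) \<le> C1 * norm t ^ 2"
    using exp_partition_err_asymp by blast
  obtain C2 \<delta>2 where C2: "C2 > 0" "\<delta>2 > 0" "\<delta>2 \<le> 1"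
    "\<And>t w. t \<in> sector \<Longrightarrow> t \<noteq> 0 \<Longrightarrow> norm t \<le> \<delta>2 \<Longrightarrow> norm w \<le> Re t / 2 \<Longrightarrow>
       norm (kap_prod w t / sincpi (w / t) - (1 + w ^ 2 / (2 * t))) \<le> C2 * norm t ^ 2"
    using kap_prod_asymp by blast
  \<comment> \<open>1 / (4 * C2) makes |r| \<le> 1/4; together with |e| \<le> 1/8 this keeps |G|
    \<ge> 1/2.\<close>
  define \<delta> where "\<delta> = Min {\<delta>1, \<delta>2, 1 / (4 * C2)}"
  have \<delta>: "\<delta> > 0" "\<delta> \<le> \<delta>1" "\<delta> \<le> \<delta>2" "\<delta> \<le> 1 / (4 * C2)"
    using C1 C2 unfolding \<delta>_def by (auto intro: Min_le simp: Min_gr_iff)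
  define K where "K = exp 1 * (2 * C1 + (1 + 4 * C2))"
  show ?thesis
  proof (rule that[of K \<delta>])
    fix t w :: complex assume t: "t \<in> sector" "t \<noteq> 0" "norm t \<le> \<delta>" and w: "norm w \<le> Re t / 2"
    define T where "T = norm t"
    have T: "T > 0" "T \<le> 1" "C2 * T \<le> 1 / 4"
    proof -
      show "T > 0" "T \<le> 1" using t \<delta> C1 by (auto simp: T_def)
      have "C2 * T \<le> C2 * (1 / (4 * C2))" using t \<delta> C2 unfolding T_def by (intro mult_left_mono) auto
      thus "C2 * T \<le> 1 / 4" using C2 by simp
    qed
    have Re: "Re t > 0" using t by (intro sector_Re_pos)
    have wT: "norm w \<le> T / 2" using w complex_Re_le_cmod[of t] by (simp add: T_def)
    have s: "norm (w / t) \<le> 1 / 2" using wT T by (simp add: norm_divide T_def divide_simps)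
    define A where "A = exp (partition_err t) * of_real (sqrt (2 * pi))"
    define G where "G = kap_prod w t / sincpi (w / t)"
    define e where "e = w ^ 2 / (2 * t)"
    define r where "r = G - (1 + e)"
    define M where "M = exp (of_real (pi ^ 2 / 6) / t + Ln t / 2 - t / 24)"
    have A: "norm (A - 1) \<le> C1 * T ^ 2" unfolding A_def T_def using t \<delta> by (intro C1) auto
    have r: "norm r \<le> C2 * T ^ 2" unfolding r_def G_def e_def T_def using t w \<delta> by (intro C2) auto
    have e: "norm e \<le> T / 8"
    proof -
      have "norm e = norm w ^ 2 / (2 * T)" by (simp add: e_def norm_divide norm_mult norm_power T_def)
      also have "\<dots> \<le> (T / 2) ^ 2 / (2 * T)" using wT T by (intro divide_right_mono power_mono) auto
      also have "\<dots> = T / 8" using T by (simp add: power2_eq_square)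
      finally show ?thesis .
    qed
    have "C2 * T ^ 2 = (C2 * T) * T" by (simp add: power2_eq_square)
    also have "\<dots> \<le> 1 / 4 * 1" using T C2 by (intro mult_mono) auto
    finally have r4: "norm r \<le> 1 / 4" using r by simp
    have G: "norm G \<ge> 1 / 2"
    proof -
      have "norm (1 :: complex) = norm (G - e - r)" by (simp add: r_def)
      also have "\<dots> \<le> norm G + norm e + norm r" 
        by (intro order.trans[OF norm_triangle_ineq4] add_right_mono norm_triangle_ineq4)
      finally show ?thesis using e r4 T by simp
    qed
    have G0: "G \<noteq> 0" using G by auto
    have invG: "norm (1 / G) \<le> 2"
    proof -
      have "1 / norm G \<le> 1 / (1 / 2)" using G by (intro divide_left_mono) auto
      thus ?thesis by (simp add: norm_divide)
    qed
    have IG: "norm (1 / G - (1 - e)) \<le> (1 + 4 * C2) * T ^ 2"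
    proof -
      have "G = 1 + e + r" by (simp add: r_def)
      hence "1 - G * (1 - e) = e * e - r * (1 - e)" by (simp add: algebra_simps)
      hence "1 / G - (1 - e) = (1 / G) * (e * e - r * (1 - e))" using G0 by (simp add: field_simps)
      also have "norm \<dots> \<le> 2 * ((T / 8) * (T / 8) + (C2 * T ^ 2) * 2)"
        unfolding norm_mult
      proof (intro mult_mono invG order.trans[OF norm_triangle_ineq4] add_mono)
        show "norm (e * e) \<le> (T / 8) * (T / 8)" unfolding norm_mult using e T by (intro mult_mono) auto
        have "norm (1 - e) \<le> norm (1 :: complex) + norm e" by (rule norm_triangle_ineq4)
        also have "\<dots> \<le> 2" using e T by simp
        finally show "norm (r * (1 - e)) \<le> (C2 * T ^ 2) * 2" unfolding norm_mult using r C2 by (intro mult_mono) auto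
      qed auto
      also have "\<dots> \<le> (1 + 4 * C2) * T ^ 2" by (simp add: power2_eq_square algebra_simps)
      finally show ?thesis .
    qed
    have sinc: "norm (1 / sincpi (w / t)) \<le> exp 1" "sincpi (w / t) \<noteq> 0"
    proof -
      have "1 / norm (sincpi (w / t)) \<le> 1 / exp (- 1)"
        using norm_sincpi_ge[OF s] by (intro frac_le) auto
      moreover have "1 / exp (- 1) = exp (1 :: real)" by (simp add: exp_minus divide_inverse)
      ultimately show "norm (1 / sincpi (w / t)) \<le> exp 1" by (simp add: norm_divide)
    qed (use s sincpi_nonzero in auto)
    have sq: "sqrt (2 * pi) \<ge> 1" using pi_ge_two by simp
    have "log_partition t = partition_err t + (of_real (pi ^ 2 / 6) / t + Ln t / 2 - t / 24)"
      by (simp add: partition_err_def)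
    hence "exp (log_partition t) = exp (partition_err t) * M" unfolding M_def by (simp add: exp_add)
    also have "exp (partition_err t) = A / of_real (sqrt (2 * pi))" by (simp add: A_def)
    finally have "crank_fun w t = M / of_real (sqrt (2 * pi)) * (1 / sincpi (w / t) * (A * (1 / G)))"
      using G0 sinc by (simp add: crank_fun_def G_def field_simps)
    hence "crank_fun w t - M / of_real (sqrt (2 * pi)) * (1 / sincpi (w / t) * (1 - e)) = 
       M / of_real (sqrt (2 * pi)) * (1 / sincpi (w / t) * (A * (1 / G) - (1 - e)))"
      by (simp only: right_diff_distrib)
    also have "A * g - (1 - e) = (A - 1) * g + (g - (1 - e))" for g by (simp add: algebra_simps)
    also have "norm (M / of_real (sqrt (2 * pi)) * (1 / sincpi (w / t) * ((A - 1) * (1 / G) + (1 / G - (1 - e))))) \<le> 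
       norm M * (exp 1 * (C1 * T ^ 2 * 2 + (1 + 4 * C2) * T ^ 2))"
      unfolding norm_mult
    proof (intro mult_mono sinc norm_triangle_mono IG)
      show "norm (M / of_real (sqrt (2 * pi))) \<le> norm M"
        using sq by (simp add: norm_divide divide_le_eq mult_le_cancel_left1)
      show "norm ((A - 1) * (1 / G)) \<le> C1 * T ^ 2 * 2"
        unfolding norm_mult using A invG C1 by (intro mult_mono) auto
    qed auto
    also have "\<dots> = K * T ^ 2 * norm M" by (simp add: K_def algebra_simps)
    finally show "norm (crank_fun w t - exp (of_real (pi ^ 2 / 6) / t + Ln t / 2 - t / 24) / of_real (sqrt (2 * pi)) * 
           (1 / sincpi (w / t) * (1 - w ^ 2 / (2 * t))))
       \<le> K * norm t ^ 2 * norm (exp (of_real (pi ^ 2 / 6) / t + Ln t / 2 - t / 24))"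
      by (simp only: M_def T_def e_def)
  qed (use \<delta> C1 C2 in \<open>auto simp: K_def intro!: add_pos_pos mult_pos_pos\<close>)
qed

text \<open>On this segment |exp t - 1| is at least 11/8 times Re t = e, where 11/8 is slightly
  below sqrt 2. The first term of log P drops from 1 / e to (8/11) / e, which saves the 3/11 in the
  exponent.\<close>

lemma crank_fun_minor_bound:
  obtains \<delta> where "\<delta> > 0" "\<delta> \<le> 1"
    "\<And>e x w. 0 < e \<Longrightarrow> e \<le> \<delta> \<Longrightarrow> e \<le> x \<Longrightarrow> x \<le> 2 * pi - e \<Longrightarrow> norm w \<le> e / 2 \<Longrightarrow>
       norm (crank_fun w (Complex e x)) \<le> exp (1 + (pi ^ 2 / 6 - 3 / 11) / e)"
proof -
  \<comment> \<open>1 - e^2 / 2 with some slack for the higher terms; 9/20 is such that 1 + 2 *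
    (9/20) = 19/10 still exceeds (11/8)^2.\<close>
  have "\<forall>\<^sub>F e in at_right 0. cos e \<le> 1 - 9 / 20 * (e::real) ^ 2" by real_asymp
  then obtain d :: real where d: "d > 0" "\<And>e. 0 < e \<Longrightarrow> e < d \<Longrightarrow> cos e \<le> 1 - 9 / 20 * e ^ 2"
    by (auto simp: eventually_at_right_field)
  show ?thesis
  proof (rule that[of "min (d / 2) 1"])
    fix e x :: real and w :: complex
    assume e: "0 < e" "e \<le> min (d / 2) 1" and x: "e \<le> x" "x \<le> 2 * pi - e" and w: "norm w \<le> e / 2"
    define t where "t = Complex e x"
    have cosx: "cos x \<le> cos e"
    proof (cases "x \<le> pi")
      case True
      thus ?thesis using e x by (intro cos_monotone_0_pi_le) auto
    next
      case False
      have "cos x = cos (2 * pi - x)" by (simp add: cos_diff)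
      also have "\<dots> \<le> cos e" using False e x by (intro cos_monotone_0_pi_le) auto
      finally show ?thesis .
    qed
    have c1: "1 - cos x \<ge> 9 / 20 * e ^ 2" using cosx d(2)[of e] e d(1) by auto
    have ge: "exp e - 1 \<ge> e" using exp_ge_add_one_self[of e] by linarith
    have "norm (exp t - 1) ^ 2 = (exp e - 1) ^ 2 + 2 * exp e * (1 - cos x)"
    proof -
      have "norm (exp t - 1) ^ 2 = (exp e * cos x - 1) ^ 2 + (exp e * sin x) ^ 2"
        by (simp add: cmod_power2 Re_exp Im_exp t_def)
      also have "(a * c - 1) ^ 2 + (a * s) ^ 2 = a ^ 2 * (s ^ 2 + c ^ 2) - 2 * a * c + 1" for a c s :: real
        by (simp add: power2_eq_square algebra_simps)
      also have "exp e ^ 2 * (sin x ^ 2 + cos x ^ 2) - 2 * exp e * cos x + 1 = (exp e - 1) ^ 2 + 2 * exp e * (1 - cos x)"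
        unfolding sin_cos_squared_add by (simp add: power2_eq_square algebra_simps)
      finally show ?thesis .
    qed
    also have "\<dots> \<ge> e ^ 2 + 2 * 1 * (9 / 20 * e ^ 2)"
      using ge e c1 by (intro add_mono mult_mono power_mono) auto
    finally have "norm (exp t - 1) ^ 2 \<ge> 19 / 10 * e ^ 2" by simp
    moreover have "(11 / 8 * e) ^ 2 \<le> 19 / 10 * e ^ 2" by (simp add: power2_eq_square)
    ultimately have "(11 / 8 * e) ^ 2 \<le> norm (exp t - 1) ^ 2" by linarith
    hence n1: "11 / 8 * e \<le> norm (exp t - 1)" by (rule power2_le_imp_le) simp
    have "1 / norm (exp t - 1) \<le> 1 / (11 / 8 * e)" using n1 e by (intro frac_le) auto
    hence n2: "1 / norm (exp t - 1) \<le> (8 / 11) / e" by simp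
    have Re: "Re t > 0" "Re t = e" using e by (auto simp: t_def)
    have "norm (exp (log_partition t)) \<le> exp (1 / norm (exp t - 1) + (pi ^ 2 / 6 - 1) / Re t)"
      using Re by (intro norm_exp_log_partition_le) auto
    also have "\<dots> \<le> exp ((pi ^ 2 / 6 - 3 / 11) / e)"
      using n2 Re e by (simp add: diff_divide_distrib)
    finally have L: "norm (exp (log_partition t)) \<le> exp ((pi ^ 2 / 6 - 3 / 11) / e)" .
    have K: "exp (- 1) \<le> norm (kap_prod w t)" using Re w by (intro kap_prod_ge) auto
    have "norm (crank_fun w t) \<le> exp ((pi ^ 2 / 6 - 3 / 11) / e) / exp (- 1)"
      unfolding crank_fun_def norm_divide using L K by (intro frac_le) auto
    also have "\<dots> = exp (1 + (pi ^ 2 / 6 - 3 / 11) / e)" by (simp add: exp_add exp_minus field_simps)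
    finally show "norm (crank_fun w (Complex e x)) \<le> exp (1 + (pi ^ 2 / 6 - 3 / 11) / e)" by (simp add: t_def)
  qed (use d in auto)
qed

section \<open>Moments as Cauchy integrals in w\<close>

lemma crank_exp_sum_expansion:
  "crank_exp_sum n has_fps_expansion 
     (\<Sum>m | crank_coeff m n \<noteq> 0. fps_const (of_real (crank_coeff m n)) * fps_exp (of_int m))"
  unfolding crank_exp_sum_def by (intro fps_expansion_intros)

lemma crank_exp_sum_holomorphic: "crank_exp_sum n holomorphic_on A"
  unfolding crank_exp_sum_def by (intro holomorphic_intros)

lemma crank_moment_integral:
  assumes "\<rho> > 0"
  shows "((\<lambda>\<theta>. crank_exp_sum n (of_real \<rho> * cis \<theta>) / (of_real \<rho> * cis \<theta>) ^ j) has_integral 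
     2 * of_real pi * of_real (crank_moment j n / fact j)) {0..2 * pi}"
proof -
  have "(deriv ^^ j) (crank_exp_sum n) 0 / fact j = of_real (crank_moment j n / fact j)"
    unfolding fps_nth_fps_expansion[OF crank_exp_sum_expansion, symmetric] crank_moment_eq
    by (simp add: fps_sum_nth sum_divide_distrib mult.commute)
  moreover have "((\<lambda>u. crank_exp_sum n u / (u - 0) ^ Suc j) has_contour_integral ((2 * pi * \<i>) / fact j * (deriv ^^ j) (crank_exp_sum n) 0)) (circlepath 0 \<rho>)"
    using assms by (intro Cauchy_has_contour_integral_higher_derivative_circlepath holomorphic_on_imp_continuous_on crank_exp_sum_holomorphic) auto
  ultimately have "((\<lambda>u. crank_exp_sum n u / u ^ Suc j) has_contour_integral (\<i> * (2 * of_real pi * of_real (crank_moment j n / fact j)))) (part_circlepath 0 \<rho> 0 (2 * pi))"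
    by (simp add: circlepath_def field_simps)
  hence "((\<lambda>\<theta>. crank_exp_sum n (0 + \<rho> * cis \<theta>) / (0 + \<rho> * cis \<theta>) ^ Suc j * \<rho> * \<i> * cis \<theta>) has_integral 
     (\<i> * (2 * of_real pi * of_real (crank_moment j n / fact j)))) {0..2 * pi}"
    by (subst (asm) has_contour_integral_part_circlepath_iff) auto
  hence "((\<lambda>\<theta>. - \<i> * (crank_exp_sum n (0 + \<rho> * cis \<theta>) / (0 + \<rho> * cis \<theta>) ^ Suc j * \<rho> * \<i> * cis \<theta>)) has_integral 
     (- \<i> * (\<i> * (2 * of_real pi * of_real (crank_moment j n / fact j))))) {0..2 * pi}"
    by (rule has_integral_mult_right)
  moreover have "- \<i> * (a / (0 + \<rho> * cis \<theta>) ^ Suc j * \<rho> * \<i> * cis \<theta>) = a / (\<rho> * cis \<theta>) ^ j" for a \<theta>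
    using assms by (simp add: field_simps)
  moreover have "- \<i> * (\<i> * a) = a" for a by (simp flip: mult.assoc)
  ultimately show ?thesis by (simp only: add_0_left)
qed

lemma sinc_integral:
  assumes "\<rho> > 0" "\<rho> < norm t / 2"
  shows "integral {0..2 * pi} (\<lambda>\<theta>. (1 / sincpi (of_real \<rho> * cis \<theta> / t) * (1 - (of_real \<rho> * cis \<theta>) ^ 2 / (2 * t))) / (of_real \<rho> * cis \<theta>) ^ (2 * k))
     = 2 * of_real pi * ((1 / t) ^ (2 * k) * (sinc_coeff (2 * k) - (if k = 0 then 0 else t / 2 * sinc_coeff (2 * k - 2))))"
proof -
  let ?f = "\<lambda>w. 1 / sincpi (w / t) * (1 - w ^ 2 / (2 * t))"
  let ?R = "2 * of_real pi * ((1 / t) ^ (2 * k) * (sinc_coeff (2 * k) - (if k = 0 then 0 else t / 2 * sinc_coeff (2 * k - 2))))"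
  have "((\<lambda>w. ?f w / w ^ Suc (2 * k)) has_contour_integral (\<i> * ?R)) (part_circlepath 0 \<rho> 0 (2 * pi))"
    using sinc_contour[OF assms, of k] unfolding circlepath_def by (simp only: mult_ac)
  hence "((\<lambda>\<theta>. ?f (0 + \<rho> * cis \<theta>) / (0 + \<rho> * cis \<theta>) ^ Suc (2 * k) * \<rho> * \<i> * cis \<theta>) has_integral (\<i> * ?R)) {0..2 * pi}"
    by (subst (asm) has_contour_integral_part_circlepath_iff) auto
  hence "((\<lambda>\<theta>. - \<i> * (?f (0 + \<rho> * cis \<theta>) / (0 + \<rho> * cis \<theta>) ^ Suc (2 * k) * \<rho> * \<i> * cis \<theta>)) has_integral (- \<i> * (\<i> * ?R))) {0..2 * pi}"
    by (rule has_integral_mult_right)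
  moreover have "- \<i> * (a / (0 + \<rho> * cis \<theta>) ^ Suc j * \<rho> * \<i> * cis \<theta>) = a / (\<rho> * cis \<theta>) ^ j" for a \<theta> j
    using assms by (simp add: field_simps)
  moreover have "- \<i> * (\<i> * a) = a" for a by (simp flip: mult.assoc)
  ultimately have "((\<lambda>\<theta>. ?f (0 + \<rho> * cis \<theta>) / (\<rho> * cis \<theta>) ^ (2 * k)) has_integral ?R) {0..2 * pi}"
    by (simp only:)
  thus ?thesis by (simp add: integral_unique)
qed

text \<open>The leading approximation of P(exp (- t)) exp (n t), with N = n - 1/24: the linear term
  - t / 24 of log P is absorbed into the exponent. This is the origin of 24 n - 1.\<close>

definition arc_kernel :: "real \<Rightarrow> complex \<Rightarrow> complex" where
  "arc_kernel N t = exp (of_real (pi ^ 2 / 6) / t + Ln t / 2 + of_real N * t) / of_real (sqrt (2 * pi))"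

lemma cis_arc_sector:
  assumes "c > 0" "\<psi> \<in> {- pi / 4..pi / 4}"
  shows "of_real c * cis \<psi> \<in> sector" "of_real c * cis \<psi> \<noteq> 0" "Ln (of_real c * cis \<psi>) = of_real (ln c) + \<i> * of_real \<psi>"
proof -
  have 1: "cos \<psi> \<ge> sqrt 2 / 2" using cos_ge_arc assms by blast
  have "\<bar>sin \<psi>\<bar> \<le> cos \<psi>"
  proof (rule power2_le_imp_le)
    have "(sqrt 2 / 2) ^ 2 \<le> cos \<psi> ^ 2" using 1 by (intro power_mono) auto
    hence "1 / 2 \<le> cos \<psi> ^ 2" by (simp add: power_divide)
    thus "\<bar>sin \<psi>\<bar> ^ 2 \<le> cos \<psi> ^ 2" using sin_cos_squared_add[of \<psi>] unfolding power2_abs by linarith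
    show "0 \<le> cos \<psi>" using 1 by (rule order.trans[rotated]) simp
  qed
  thus "of_real c * cis \<psi> \<in> sector" using assms by (simp add: sector_def abs_mult)
  show "of_real c * cis \<psi> \<noteq> 0" using assms by simp
  have "of_real c * cis \<psi> = exp (of_real (ln c) + \<i> * of_real \<psi>)"
    using assms by (simp add: exp_add cis_conv_exp exp_of_real)
  also have "Ln \<dots> = of_real (ln c) + \<i> * of_real \<psi>"
  proof (rule Ln_exp)
    have "- (pi / 4) \<le> \<psi>" "\<psi> \<le> pi / 4" using assms by auto
    hence "- pi < \<psi>" "\<psi> \<le> pi" using pi_gt_zero by linarith+
    thus "- pi < Im (of_real (ln c) + \<i> * of_real \<psi>)" "Im (of_real (ln c) + \<i> * of_real \<psi>) \<le> pi" by simp_all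
  qed
  finally show "Ln (of_real c * cis \<psi>) = of_real (ln c) + \<i> * of_real \<psi>" .
qed

text \<open>The last two hypotheses say that c is the saddle point: on the arc pi^2 / (6 t) and N t
  are complex conjugates of modulus y / 2, so their sum is y cos \<psi>. The square root of t gives
  the rotation by \<psi> / 2.\<close>

lemma arc_kernel_cis:
  assumes "c > 0" "\<psi> \<in> {- pi / 4..pi / 4}" "pi ^ 2 / 6 / c = y / 2" "N * c = y / 2"
  shows "arc_kernel N (of_real c * cis \<psi>) = of_real (sqrt c * exp (y * cos \<psi>) / sqrt (2 * pi)) * cis (\<psi> / 2)"
proof -
  have "of_real a / (of_real c * z) = of_real (a / c) * inverse z" for a and z :: complex
    by (simp add: divide_inverse mult_ac)
  hence "of_real (pi ^ 2 / 6) / (of_real c * cis \<psi>) = of_real (pi ^ 2 / 6 / c) * cis (- \<psi>)"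
    unfolding cis_inverse[symmetric] .
  hence 1: "of_real (pi ^ 2 / 6) / (of_real c * cis \<psi>) = of_real (y / 2) * cis (- \<psi>)" unfolding assms(3) .
  have "of_real N * (of_real c * cis \<psi>) = of_real (N * c) * cis \<psi>" by simp
  hence 2: "of_real N * (of_real c * cis \<psi>) = of_real (y / 2) * cis \<psi>" unfolding assms(4) .
  have "of_real (y / 2) * cis (- \<psi>) + (of_real (ln c) + \<i> * of_real \<psi>) / 2 + of_real (y / 2) * cis \<psi> =
     of_real (y * cos \<psi>) + of_real (ln c / 2) + \<i> * of_real (\<psi> / 2)"
    by (simp add: complex_eq_iff)
  hence "arc_kernel N (of_real c * cis \<psi>) = exp (of_real (y * cos \<psi>) + of_real (ln c / 2) + \<i> * of_real (\<psi> / 2)) / of_real (sqrt (2 * pi))"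
    unfolding arc_kernel_def cis_arc_sector(3)[OF assms(1,2)] 1 2 by simp
  also have "\<dots> = of_real (exp (y * cos \<psi>)) * of_real (exp (ln c / 2)) * cis (\<psi> / 2) / of_real (sqrt (2 * pi))"
    by (simp only: exp_add exp_of_real cis_conv_exp)
  also have "exp (ln c / 2) = sqrt c" using assms(1) by (simp add: ln_sqrt[symmetric])
  finally show ?thesis by simp
qed

text \<open>The moment is a double integral over w and t. Replacing the integrand by its
  approximation costs a relative O(c^2) on the arc, and the segment costs exp (19/20 y). After
  exchanging the integrals the one over w is evaluated exactly.\<close>

lemma crank_moment_arc_bound:
  obtains C \<delta> where "C > 0" "\<delta> > 0"
    "\<And>c n k. 0 < c \<Longrightarrow> c \<le> \<delta> \<Longrightarrow> pi ^ 2 / 6 / c = y_crank n / 2 \<Longrightarrow> (real n - 1 / 24) * c = y_crank n / 2 \<Longrightarrow>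
       norm (2 * of_real pi * of_real (crank_moment (2 * k) n / fact (2 * k)) - 
         integral {- pi / 4..pi / 4} (\<lambda>\<psi>. arc_kernel (real n - 1 / 24) (of_real c * cis \<psi>) * (of_real c * cis \<psi>) *
            ((1 / (of_real c * cis \<psi>)) ^ (2 * k) * (sinc_coeff (2 * k) - (if k = 0 then 0 else (of_real c * cis \<psi>) / 2 * sinc_coeff (2 * k - 2))))))
       \<le> C * (c ^ 3 * sqrt c * arc_int (1 / 2) (y_crank n) + exp (19 / 20 * y_crank n)) * (2 * sqrt 2 / c) ^ (2 * k)"
proof -
  obtain C1 \<delta>1 where C1: "C1 > 0" "\<delta>1 > 0" "\<delta>1 \<le> 1"
    "\<And>t w. t \<in> sector \<Longrightarrow> t \<noteq> 0 \<Longrightarrow> norm t \<le> \<delta>1 \<Longrightarrow> norm w \<le> Re t / 2 \<Longrightarrow>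
       norm (crank_fun w t - exp (of_real (pi ^ 2 / 6) / t + Ln t / 2 - t / 24) / of_real (sqrt (2 * pi)) * 
           (1 / sincpi (w / t) * (1 - w ^ 2 / (2 * t))))
       \<le> C1 * norm t ^ 2 * norm (exp (of_real (pi ^ 2 / 6) / t + Ln t / 2 - t / 24))"
    using crank_fun_asymp by blast
  obtain \<delta>2 where C2: "\<delta>2 > 0" "\<delta>2 \<le> 1"
    "\<And>e x w. 0 < e \<Longrightarrow> e \<le> \<delta>2 \<Longrightarrow> e \<le> x \<Longrightarrow> x \<le> 2 * pi - e \<Longrightarrow> norm w \<le> e / 2 \<Longrightarrow>
       norm (crank_fun w (Complex e x)) \<le> exp (1 + (pi ^ 2 / 6 - 3 / 11) / e)"
    using crank_fun_minor_bound by blast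
  define C where "C = 2 * pi * exp 2 + 2 * C1"
  show ?thesis
  proof (rule that[of C "min \<delta>1 \<delta>2"])
    fix c :: real and n k :: nat
    assume c: "0 < c" "c \<le> min \<delta>1 \<delta>2" and y: "pi ^ 2 / 6 / c = y_crank n / 2" "(real n - 1 / 24) * c = y_crank n / 2"
    define N where "N = real n - 1 / 24"
    define Y where "Y = y_crank n"
    \<comment> \<open>The segment lies on Re t = c / sqrt 2, so that the points with |Im t| =
      \<open>e\<close> are on the circle |t| = c.\<close>
    define e where "e = c / sqrt 2"
    define \<rho> where "\<rho> = e / 2"
    define I where "I = {- pi / 4..pi / 4}"
    define t where "t = (\<lambda>\<psi>. of_real c * cis \<psi>)"
    define W where "W = (\<lambda>\<theta>. of_real \<rho> * cis \<theta>)"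
    have s2: "sqrt 2 \<ge> 1" "sqrt 2 > 0" by simp_all
    have e: "e > 0" "e \<le> c" "sqrt 2 * e = c" "e \<le> 1" "e \<le> \<delta>2" "e \<le> pi"
    proof -
      show "e > 0" "sqrt 2 * e = c" using c by (auto simp: e_def)
      show ec: "e \<le> c" using c s2 by (simp add: e_def divide_le_eq mult_le_cancel_left1)
      thus "e \<le> 1" "e \<le> \<delta>2" "e \<le> pi" using c C2 pi_gt3 by auto
    qed
    have \<rho>: "\<rho> > 0" "\<rho> < c / 2" 
    proof -
      show "\<rho> > 0" using e by (simp add: \<rho>_def)
      have "1 < sqrt (2::real)" by simp
      hence "e * 1 < e * sqrt 2" using e by (intro mult_strict_left_mono) auto
      thus "\<rho> < c / 2" using e(3) by (simp add: \<rho>_def mult.commute)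
    qed
    have W: "norm (W \<theta>) = \<rho>" for \<theta> using \<rho> by (simp add: W_def norm_mult)
    have T: "norm (t \<psi>) = c" for \<psi> using c by (simp add: t_def norm_mult)
    have t0: "t \<psi> \<noteq> 0" for \<psi> using T[of \<psi>] c by auto
    have Ret: "Re (t \<psi>) \<ge> e" if "\<psi> \<in> I" for \<psi>
      using Re_arc_ge[of e \<psi>] that e unfolding I_def t_def e(3) by simp
    define F where "F = (\<lambda>\<theta> \<psi>. 1 / sincpi (W \<theta> / t \<psi>) * (1 - W \<theta> ^ 2 / (2 * t \<psi>)))"

    define B where "B = 2 * C1 * (c ^ 3 * sqrt c * arc_int (1 / 2) Y) + 2 * pi * exp (2 + 19 / 20 * Y)"
    have K: "norm (arc_kernel N (t \<psi>)) = sqrt c * exp (Y * cos \<psi>) / sqrt (2 * pi)" if "\<psi> \<in> I" for \<psi>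
    proof -
      have "arc_kernel N (t \<psi>) = of_real (sqrt c * exp (Y * cos \<psi>) / sqrt (2 * pi)) * cis (\<psi> / 2)"
        unfolding t_def N_def Y_def using c(1) that y by (intro arc_kernel_cis) (auto simp: I_def)
      thus ?thesis using c(1) by (simp only: norm_mult norm_of_real norm_cis) simp
    qed
    have sinc0: "sincpi (W \<theta> / t \<psi>) \<noteq> 0" for \<theta> \<psi>
      using \<rho> c by (intro sincpi_nonzero) (simp add: norm_divide W T)
    have contt: "continuous_on A t" for A unfolding t_def by (intro continuous_intros)
    have contKt: "continuous_on I (\<lambda>\<psi>. arc_kernel N (t \<psi>))"
    proof -
      have "continuous_on I (\<lambda>\<psi>. of_real (sqrt c * exp (Y * cos \<psi>) / sqrt (2 * pi)) * cis (\<psi> / 2))"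
        by (intro continuous_intros) auto
      thus ?thesis
        by (rule continuous_on_eq) (use arc_kernel_cis[OF c(1), of _ Y N] y in \<open>auto simp: I_def t_def Y_def N_def\<close>)
    qed
    have contF: "continuous_on (UNIV \<times> UNIV) (\<lambda>(\<theta>, \<psi>). F \<theta> \<psi>)"
    proof -
      have "continuous_on UNIV sincpi" by (intro holomorphic_on_imp_continuous_on sincpi_holomorphic)
      hence "continuous_on UNIV (\<lambda>p. sincpi (W (fst p) / t (snd p)))"
        by (rule continuous_on_compose2) (use c(1) in \<open>auto simp: W_def t_def intro!: continuous_intros\<close>)
      thus ?thesis unfolding F_def case_prod_beta
        using t0 sinc0 by (auto simp: W_def t_def intro!: continuous_intros)
    qed
    have contFt: "continuous_on A (F \<theta>)" for A \<theta>
    proof -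
      have "continuous_on UNIV (\<lambda>\<psi>. (\<lambda>(\<theta>, \<psi>). F \<theta> \<psi>) (\<theta>, \<psi>))"
        by (rule continuous_on_compose2[OF contF]) (auto intro!: continuous_intros)
      thus ?thesis by (auto intro: continuous_on_subset)
    qed
    have Y: "Y > 0"
    proof -
      have "Y = 2 * (pi ^ 2 / 6 / c)" using y by (simp add: Y_def)
      also have "\<dots> > 0" using c by simp
      finally show ?thesis .
    qed
    \<comment> \<open>In units of y / 2 and up to a bounded term, the exponent on the segment is
      sqrt 2 (1 - 3 / (11 X)) + sqrt 2 / 2 with X = pi^2 / 6. Without the saving 3/11 it would be 3
      sqrt 2 / 2 > 2 and exceed the saddle point value; with it the exponent stays below
      19/10.\<close>
    have exponent: "(pi ^ 2 / 6 - 3 / 11) / e + real n * e \<le> 1 + 19 / 20 * Y"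
    proof -
      define X where "X = pi ^ 2 / 6"
      have "pi ^ 2 \<le> (3.1416 :: real) ^ 2" using pi_approx by (intro power_mono) auto
      hence X: "X > 0" "X \<le> 165 / 100" by (auto simp: X_def power2_eq_square)
      have "pi ^ 2 \<ge> 3 ^ 2" using pi_gt3 by (intro power_mono) auto
      hence X1: "X \<ge> 1" by (simp add: X_def)
      have "3 / 11 / X \<le> 3 / 11 / 1" using X1 by (intro divide_left_mono) auto
      hence X2: "3 / 2 - 3 / 11 / X \<ge> 0" by linarith
      have Xc: "X / c = Y / 2" using y by (simp add: X_def Y_def)
      have "(X - 3 / 11) / e = sqrt 2 * ((X - 3 / 11) / c)" using c by (simp add: e_def field_simps)
      also have "(X - 3 / 11) / c = (1 - 3 / 11 / X) * (X / c)" using X c by (simp add: field_simps)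
      also have "\<dots> = (1 - 3 / 11 / X) * (Y / 2)" unfolding Xc ..
      finally have 1: "(X - 3 / 11) / e = sqrt 2 * (1 - 3 / 11 / X) * (Y / 2)" by simp
      have "real n * e = N * c / sqrt 2 + e / 24" by (simp add: N_def e_def field_simps)
      also have "N * c / sqrt 2 = sqrt 2 / 2 * (Y / 2)"
      proof -
        have "N * c = Y / 2" using y by (simp add: N_def Y_def)
        moreover have "a / sqrt 2 = sqrt 2 / 2 * a" for a :: real by (simp add: field_simps)
        ultimately show ?thesis by (simp only:)
      qed
      finally have 2: "real n * e = sqrt 2 / 2 * (Y / 2) + e / 24" .
      have s: "sqrt 2 \<le> 1415 / 1000"
        by (rule real_le_lsqrt) (auto simp: power2_eq_square)
      have "3 / 11 / (165 / 100) \<le> 3 / 11 / X" using X by (intro divide_left_mono) auto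
      also have "3 / 11 / (165 / 100) = (20 / 121 :: real)" by simp
      finally have "3 / 2 - 3 / 11 / X \<le> 3 / 2 - 20 / 121" by linarith
      hence "sqrt 2 * (3 / 2 - 3 / 11 / X) \<le> 1415 / 1000 * (3 / 2 - 20 / 121)"
        using s X2 by (intro mult_mono) auto
      also have "\<dots> \<le> 19 / 10" by simp
      finally have "sqrt 2 * (3 / 2 - 3 / 11 / X) * (Y / 2) \<le> 19 / 10 * (Y / 2)"
        using Y by (intro mult_right_mono) auto
      moreover have "sqrt 2 * (1 - 3 / 11 / X) * (Y / 2) + sqrt 2 / 2 * (Y / 2) = sqrt 2 * (3 / 2 - 3 / 11 / X) * (Y / 2)"
        by (simp add: algebra_simps)
      moreover have "e / 24 \<le> 1" using e by simp
      ultimately have "(X - 3 / 11) / e + real n * e \<le> 1 + 19 / 20 * Y" unfolding 1 2 by linarith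
      thus ?thesis by (simp only: X_def)
    qed
    have bound: "norm (2 * of_real pi * crank_exp_sum n (W \<theta>) - integral I (\<lambda>\<psi>. arc_kernel N (t \<psi>) * F \<theta> \<psi> * t \<psi>)) \<le> B" for \<theta>
    proof -
      have td: "of_real c * cis \<psi> = t \<psi>" for \<psi> by (simp add: t_def)
      note cs = crank_exp_sum_integral[OF e(1) e(6), of "W \<theta>" n, unfolded e(3) td, folded I_def]
      have w: "norm (W \<theta>) \<le> e / 2" by (simp add: W \<rho>_def)
      have minor: "norm (integral {e..2 * pi - e} (\<lambda>x. crank_fun (W \<theta>) (Complex e x) * exp (of_nat n * Complex e x))) \<le> 2 * pi * exp (2 + 19 / 20 * Y)"
      proof -
        have "norm (integral {e..2 * pi - e} (\<lambda>x. crank_fun (W \<theta>) (Complex e x) * exp (of_nat n * Complex e x))) \<le> 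
          integral {e..2 * pi - e} (\<lambda>x. exp (2 + 19 / 20 * Y))"
        proof (rule integral_norm_bound_integral)
          show "(\<lambda>x. crank_fun (W \<theta>) (Complex e x) * exp (of_nat n * Complex e x)) integrable_on {e..2 * pi - e}"
            using cs(2) w by simp
          fix x assume x: "x \<in> {e..2 * pi - e}"
          have "norm (crank_fun (W \<theta>) (Complex e x) * exp (of_nat n * Complex e x)) \<le> exp (1 + (pi ^ 2 / 6 - 3 / 11) / e) * exp (real n * e)"
            unfolding norm_mult using x e w by (intro mult_mono C2) (auto simp: norm_exp_eq_Re)
          also have "\<dots> = exp (1 + ((pi ^ 2 / 6 - 3 / 11) / e + real n * e))" by (simp add: exp_add)
          also have "\<dots> \<le> exp (2 + 19 / 20 * Y)" using exponent by (subst exp_le_cancel_iff) linarith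
          finally show "norm (crank_fun (W \<theta>) (Complex e x) * exp (of_nat n * Complex e x)) \<le> exp (2 + 19 / 20 * Y)" .
        qed (rule integrable_const_ivl)
        also have "\<dots> = (2 * pi - 2 * e) * exp (2 + 19 / 20 * Y)" using e pi_gt3 by simp
        also have "\<dots> \<le> 2 * pi * exp (2 + 19 / 20 * Y)" using e by (intro mult_right_mono) auto
        finally show ?thesis .
      qed
      have arc: "norm (integral I (\<lambda>\<psi>. crank_fun (W \<theta>) (t \<psi>) * exp (of_nat n * t \<psi>) * t \<psi>) - integral I (\<lambda>\<psi>. arc_kernel N (t \<psi>) * F \<theta> \<psi> * t \<psi>))
         \<le> 2 * C1 * (c ^ 3 * sqrt c * arc_int (1 / 2) Y)"
      proof -
        have int1: "(\<lambda>\<psi>. crank_fun (W \<theta>) (t \<psi>) * exp (of_nat n * t \<psi>) * t \<psi>) integrable_on I"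
          using cs(3) w by simp
        have int2: "(\<lambda>\<psi>. arc_kernel N (t \<psi>) * F \<theta> \<psi> * t \<psi>) integrable_on I"
          unfolding I_def by (intro integrable_continuous_real continuous_intros contFt contt contKt[unfolded I_def])
        have "norm (integral I (\<lambda>\<psi>. crank_fun (W \<theta>) (t \<psi>) * exp (of_nat n * t \<psi>) * t \<psi> - arc_kernel N (t \<psi>) * F \<theta> \<psi> * t \<psi>))
           \<le> integral I (\<lambda>\<psi>. 2 * C1 * (c ^ 3 * sqrt c) * (cos (1 / 2 * \<psi>) * exp (Y * cos \<psi>)))"
        proof (rule integral_norm_bound_integral)
          show "(\<lambda>\<psi>. crank_fun (W \<theta>) (t \<psi>) * exp (of_nat n * t \<psi>) * t \<psi> - arc_kernel N (t \<psi>) * F \<theta> \<psi> * t \<psi>) integrable_on I"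
            by (intro integrable_diff int1 int2)
          show "(\<lambda>\<psi>. 2 * C1 * (c ^ 3 * sqrt c) * (cos (1 / 2 * \<psi>) * exp (Y * cos \<psi>))) integrable_on I"
            unfolding I_def by (intro integrable_continuous_real continuous_intros)
          fix \<psi> assume \<psi>: "\<psi> \<in> I"
          define M where "M = exp (of_real (pi ^ 2 / 6) / t \<psi> + Ln (t \<psi>) / 2 - t \<psi> / 24)"
          have sec: "t \<psi> \<in> sector" using cis_arc_sector(1)[OF c(1)] \<psi> by (simp add: t_def I_def)
          have "norm (crank_fun (W \<theta>) (t \<psi>) - M / of_real (sqrt (2 * pi)) * F \<theta> \<psi>) \<le> C1 * norm (t \<psi>) ^ 2 * norm M"
            unfolding M_def F_def using sec t0 T c Ret[OF \<psi>] by (intro C1) (auto simp: W \<rho>_def)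
          hence b: "norm (crank_fun (W \<theta>) (t \<psi>) - M / of_real (sqrt (2 * pi)) * F \<theta> \<psi>) \<le> C1 * c ^ 2 * norm M" unfolding T .
          have Mk: "M * exp (of_nat n * t \<psi>) / of_real (sqrt (2 * pi)) = arc_kernel N (t \<psi>)"
          proof -
            have "M * exp (of_nat n * t \<psi>) = exp (of_real (pi ^ 2 / 6) / t \<psi> + Ln (t \<psi>) / 2 - t \<psi> / 24 + of_nat n * t \<psi>)"
              unfolding M_def exp_add[symmetric] ..
            also have "of_real (pi ^ 2 / 6) / t \<psi> + Ln (t \<psi>) / 2 - t \<psi> / 24 + of_nat n * t \<psi> = of_real (pi ^ 2 / 6) / t \<psi> + Ln (t \<psi>) / 2 + of_real N * t \<psi>"
              by (simp add: N_def algebra_simps)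
            finally show ?thesis by (simp add: arc_kernel_def)
          qed
          have "norm (M * exp (of_nat n * t \<psi>)) = norm (arc_kernel N (t \<psi>)) * sqrt (2 * pi)"
            unfolding Mk[symmetric] by (simp add: norm_divide norm_mult)
          hence nM: "norm M * norm (exp (of_nat n * t \<psi>)) = sqrt c * exp (Y * cos \<psi>)"
            unfolding K[OF \<psi>] norm_mult by simp
          have "crank_fun (W \<theta>) (t \<psi>) * exp (of_nat n * t \<psi>) * t \<psi> - arc_kernel N (t \<psi>) * F \<theta> \<psi> * t \<psi> = 
             (crank_fun (W \<theta>) (t \<psi>) - M / of_real (sqrt (2 * pi)) * F \<theta> \<psi>) * exp (of_nat n * t \<psi>) * t \<psi>"
            unfolding Mk[symmetric] by (simp add: algebra_simps)
          also have "norm \<dots> \<le> (C1 * c ^ 2 * norm M) * norm (exp (of_nat n * t \<psi>)) * c"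
            unfolding norm_mult T using b c by (intro mult_right_mono) auto
          also have "\<dots> = C1 * c ^ 3 * (norm M * norm (exp (of_nat n * t \<psi>)))"
            by (simp add: power3_eq_cube power2_eq_square)
          also have "\<dots> = C1 * c ^ 3 * sqrt c * exp (Y * cos \<psi>) * 1" unfolding nM by simp
          \<comment> \<open>On the arc |\<psi> / 2| < pi / 3, so 2 cos (\<psi> / 2) \<ge> 1.
            Inserting this factor makes the bound an arc integral of order 1/2, whose growth is
            known.\<close>
          also have "\<dots> \<le> C1 * c ^ 3 * sqrt c * exp (Y * cos \<psi>) * (2 * cos (1 / 2 * \<psi>))"
          proof (rule mult_left_mono)
            have "cos (pi / 3) \<le> cos \<bar>\<psi> / 2\<bar>" using \<psi> by (intro cos_monotone_0_pi_le) (auto simp: I_def)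
            hence "1 / 2 \<le> cos (\<psi> / 2)" unfolding cos_abs_real cos_60 .
            thus "1 \<le> 2 * cos (1 / 2 * \<psi>)" by simp
          qed (use c C1 in auto)
          finally show "norm (crank_fun (W \<theta>) (t \<psi>) * exp (of_nat n * t \<psi>) * t \<psi> - arc_kernel N (t \<psi>) * F \<theta> \<psi> * t \<psi>)
             \<le> 2 * C1 * (c ^ 3 * sqrt c) * (cos (1 / 2 * \<psi>) * exp (Y * cos \<psi>))" by (simp only: mult_ac)
        qed
        also have "\<dots> = 2 * C1 * (c ^ 3 * sqrt c) * arc_int (1 / 2) Y"
          unfolding I_def arc_int_def by (rule integral_mult_right)
        finally show ?thesis using int1 int2 by (simp add: integral_diff)
      qed
      have "2 * of_real pi * crank_exp_sum n (W \<theta>) - integral I (\<lambda>\<psi>. arc_kernel N (t \<psi>) * F \<theta> \<psi> * t \<psi>) =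
        integral {e..2 * pi - e} (\<lambda>x. crank_fun (W \<theta>) (Complex e x) * exp (of_nat n * Complex e x)) +
        (integral I (\<lambda>\<psi>. crank_fun (W \<theta>) (t \<psi>) * exp (of_nat n * t \<psi>) * t \<psi>) - integral I (\<lambda>\<psi>. arc_kernel N (t \<psi>) * F \<theta> \<psi> * t \<psi>))"
        unfolding cs(1)[OF w] by simp
      also have "norm \<dots> \<le> 2 * pi * exp (2 + 19 / 20 * Y) + 2 * C1 * (c ^ 3 * sqrt c * arc_int (1 / 2) Y)"
        by (intro norm_triangle_mono minor arc)
      finally show ?thesis by (simp add: B_def)
    qed
    define Q where "Q = 2 * of_real pi * complex_of_real (crank_moment (2 * k) n / fact (2 * k))"
    define R where "R = (\<lambda>\<psi>. arc_kernel N (t \<psi>) * t \<psi> * ((1 / t \<psi>) ^ (2 * k) * (sinc_coeff (2 * k) - (if k = 0 then 0 else t \<psi> / 2 * sinc_coeff (2 * k - 2)))))"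
    define J where "J = (\<lambda>(\<theta>, \<psi>). arc_kernel N (t \<psi>) * F \<theta> \<psi> * t \<psi> / W \<theta> ^ (2 * k))"
    have W0: "W \<theta> \<noteq> 0" for \<theta> using W[of \<theta>] \<rho> by auto
    have contJ: "continuous_on (cbox (0, - pi / 4) (2 * pi, pi / 4)) J"
    proof -
      have "continuous_on (UNIV \<times> I) (\<lambda>p. arc_kernel N (t (snd p)))"
        by (rule continuous_on_compose2[OF contKt]) (auto intro!: continuous_intros)
      moreover have "continuous_on (UNIV \<times> I) (\<lambda>p. F (fst p) (snd p))"
        using contF by (auto simp: case_prod_beta intro: continuous_on_subset)
      ultimately have "continuous_on (UNIV \<times> I) J"
        unfolding J_def case_prod_beta using W0 by (auto simp: W_def t_def intro!: continuous_intros)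
      thus ?thesis by (rule continuous_on_subset) (auto simp: I_def cbox_Pair_eq)
    qed
    \<comment> \<open>The integrand is continuous on a compact rectangle; after the exchange the
      inner integral runs over the circle and is \<open>sinc_integral\<close>.\<close>
    have swap: "integral {0..2 * pi} (\<lambda>\<theta>. integral I (\<lambda>\<psi>. J (\<theta>, \<psi>))) = integral I (\<lambda>\<psi>. integral {0..2 * pi} (\<lambda>\<theta>. J (\<theta>, \<psi>)))"
      using integral_swap_continuous[of 0 "- pi / 4" "2 * pi" "pi / 4" "\<lambda>\<theta> \<psi>. J (\<theta>, \<psi>)"] contJ
      by (simp add: I_def case_prod_unfold)
    have intJ: "(\<lambda>\<theta>. integral I (\<lambda>\<psi>. J (\<theta>, \<psi>))) integrable_on {0..2 * pi}"
      using integral_integrable_2dim[OF contJ] by (simp add: I_def)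
    have inner: "integral {0..2 * pi} (\<lambda>\<theta>. J (\<theta>, \<psi>)) = 2 * of_real pi * R \<psi>" for \<psi>
    proof -
      have "integral {0..2 * pi} (\<lambda>\<theta>. J (\<theta>, \<psi>)) = integral {0..2 * pi} (\<lambda>\<theta>. arc_kernel N (t \<psi>) * t \<psi> * (F \<theta> \<psi> / W \<theta> ^ (2 * k)))"
        by (simp add: J_def mult_ac)
      also have "\<dots> = arc_kernel N (t \<psi>) * t \<psi> * integral {0..2 * pi} (\<lambda>\<theta>. F \<theta> \<psi> / W \<theta> ^ (2 * k))"
        by (rule integral_mult_right)
      also have "integral {0..2 * pi} (\<lambda>\<theta>. F \<theta> \<psi> / W \<theta> ^ (2 * k)) = 
        2 * of_real pi * ((1 / t \<psi>) ^ (2 * k) * (sinc_coeff (2 * k) - (if k = 0 then 0 else t \<psi> / 2 * sinc_coeff (2 * k - 2))))"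
        unfolding F_def W_def using \<rho> T by (intro sinc_integral) auto
      finally show ?thesis by (simp add: R_def mult_ac)
    qed
    have G: "((\<lambda>\<theta>. crank_exp_sum n (W \<theta>) / W \<theta> ^ (2 * k)) has_integral Q) {0..2 * pi}"
      unfolding W_def Q_def using \<rho>(1) by (rule crank_moment_integral)
    have G2: "((\<lambda>\<theta>. 2 * of_real pi * (crank_exp_sum n (W \<theta>) / W \<theta> ^ (2 * k)) - integral I (\<lambda>\<psi>. J (\<theta>, \<psi>))) has_integral 
       (2 * of_real pi * Q - 2 * of_real pi * integral I R)) {0..2 * pi}"
    proof (intro has_integral_diff has_integral_mult_right G)
      have "integral {0..2 * pi} (\<lambda>\<theta>. integral I (\<lambda>\<psi>. J (\<theta>, \<psi>))) = 2 * of_real pi * integral I R"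
        unfolding swap inner by (rule integral_mult_right)
      thus "((\<lambda>\<theta>. integral I (\<lambda>\<psi>. J (\<theta>, \<psi>))) has_integral 2 * of_real pi * integral I R) {0..2 * pi}"
        using integrable_integral[OF intJ] by simp
    qed
    have "norm (2 * of_real pi * Q - 2 * of_real pi * integral I R) \<le> B / \<rho> ^ (2 * k) * measure lborel (cbox 0 (2 * pi))"
    proof (rule has_integral_bound)
      show "0 \<le> B / \<rho> ^ (2 * k)"
        using order.trans[OF norm_ge_zero bound] \<rho> by simp
      show "((\<lambda>\<theta>. 2 * of_real pi * (crank_exp_sum n (W \<theta>) / W \<theta> ^ (2 * k)) - integral I (\<lambda>\<psi>. J (\<theta>, \<psi>))) has_integral 
       (2 * of_real pi * Q - 2 * of_real pi * integral I R)) (cbox 0 (2 * pi))" using G2 by simp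
      fix \<theta> :: real
      have "integral I (\<lambda>\<psi>. J (\<theta>, \<psi>)) = integral I (\<lambda>\<psi>. arc_kernel N (t \<psi>) * F \<theta> \<psi> * t \<psi>) / W \<theta> ^ (2 * k)"
        by (simp add: J_def)
      hence "2 * of_real pi * (crank_exp_sum n (W \<theta>) / W \<theta> ^ (2 * k)) - integral I (\<lambda>\<psi>. J (\<theta>, \<psi>)) = 
        (2 * of_real pi * crank_exp_sum n (W \<theta>) - integral I (\<lambda>\<psi>. arc_kernel N (t \<psi>) * F \<theta> \<psi> * t \<psi>)) / W \<theta> ^ (2 * k)"
        by (simp add: diff_divide_distrib)
      also have "norm \<dots> \<le> B / \<rho> ^ (2 * k)"
        unfolding norm_divide norm_power W using bound \<rho> by (intro divide_right_mono) auto
      finally show "norm (2 * of_real pi * (crank_exp_sum n (W \<theta>) / W \<theta> ^ (2 * k)) - integral I (\<lambda>\<psi>. J (\<theta>, \<psi>))) \<le> B / \<rho> ^ (2 * k)" .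
    qed
    also have "2 * of_real pi * Q - 2 * of_real pi * integral I R = 2 * of_real pi * (Q - integral I R)"
      by (simp add: algebra_simps)
    also have "norm \<dots> = 2 * pi * norm (Q - integral I R)" by (simp add: norm_mult)
    finally have "2 * pi * norm (Q - integral I R) \<le> 2 * pi * (B / \<rho> ^ (2 * k))" by (simp add: mult.commute)
    hence "norm (Q - integral I R) \<le> B / \<rho> ^ (2 * k)" by (subst (asm) mult_le_cancel_left_pos) auto
    also have "B / \<rho> ^ (2 * k) = B * (2 * sqrt 2 / c) ^ (2 * k)"
    proof -
      have "2 * sqrt 2 / c = 1 / \<rho>" using c by (simp add: \<rho>_def e_def)
      thus ?thesis by (simp add: power_one_over)
    qed
    also have "\<dots> \<le> C * (c ^ 3 * sqrt c * arc_int (1 / 2) Y + exp (19 / 20 * Y)) * (2 * sqrt 2 / c) ^ (2 * k)"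
    proof (rule mult_right_mono)
      have "arc_int (1 / 2) Y \<ge> 0" unfolding arc_int_def
      proof (intro integral_nonneg arc_int_integrable)
        fix \<psi> :: real assume "\<psi> \<in> {- pi / 4..pi / 4}"
        thus "0 \<le> cos (1 / 2 * \<psi>) * exp (Y * cos \<psi>)" by (intro mult_nonneg_nonneg cos_ge_zero) auto
      qed
      hence A: "c ^ 3 * sqrt c * arc_int (1 / 2) Y \<ge> 0" using c by simp
      have "B = 2 * C1 * (c ^ 3 * sqrt c * arc_int (1 / 2) Y) + 2 * pi * exp 2 * exp (19 / 20 * Y)"
        by (simp add: B_def exp_add)
      also have "\<dots> \<le> C * (c ^ 3 * sqrt c * arc_int (1 / 2) Y) + C * exp (19 / 20 * Y)"
        using A C1 by (intro add_mono mult_right_mono) (auto simp: C_def)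
      finally show "B \<le> C * (c ^ 3 * sqrt c * arc_int (1 / 2) Y + exp (19 / 20 * Y))" by (simp add: distrib_left)
    qed (use c in auto)
    finally show "norm (2 * of_real pi * of_real (crank_moment (2 * k) n / fact (2 * k)) - 
         integral {- pi / 4..pi / 4} (\<lambda>\<psi>. arc_kernel (real n - 1 / 24) (of_real c * cis \<psi>) * (of_real c * cis \<psi>) *
            ((1 / (of_real c * cis \<psi>)) ^ (2 * k) * (sinc_coeff (2 * k) - (if k = 0 then 0 else (of_real c * cis \<psi>) / 2 * sinc_coeff (2 * k - 2))))))
       \<le> C * (c ^ 3 * sqrt c * arc_int (1 / 2) (y_crank n) + exp (19 / 20 * y_crank n)) * (2 * sqrt 2 / c) ^ (2 * k)"
      unfolding Q_def R_def I_def N_def Y_def t_def .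
  qed (use C1 C2 in \<open>auto simp: C_def intro!: add_pos_pos\<close>)
qed

section \<open>The main term\<close>

text \<open>On the arc t^(3/2 - 2k) has the angular part cis ((3/2 - 2k) \<psi>), and the correction
  carries one more factor t. As the moment is real, taking real parts leaves cosines, that is, arc
  integrals of order 2k - 3/2 and 2k - 5/2.\<close>

lemma crank_moment_approx:
  obtains C \<delta> where "C > 0" "\<delta> > 0"
    "\<And>c n. 0 < c \<Longrightarrow> c \<le> \<delta> \<Longrightarrow> pi ^ 2 / 6 / c = y_crank n / 2 \<Longrightarrow> (real n - 1 / 24) * c = y_crank n / 2 \<Longrightarrow>
       \<bar>crank_moment (2 * k) n - fact (2 * k) / (2 * pi) * (sqrt c / sqrt (2 * pi) * (1 / c) ^ (2 * k) * 
          ((2 * pi) ^ (2 * k) * xi k / (2 * fact (2 * k)) * c * arc_int (2 * real k - 3 / 2) (y_crank n) - 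
           (if k = 0 then 0 else (2 * pi) ^ (2 * (k - 1)) * xi (k - 1) / (2 * fact (2 * (k - 1))) / 2 * c ^ 2 * arc_int (2 * real k - 5 / 2) (y_crank n))))\<bar>
       \<le> C * (c ^ 3 * sqrt c * arc_int (1 / 2) (y_crank n) + exp (19 / 20 * y_crank n)) * (1 / c) ^ (2 * k)"
proof -
  obtain C \<delta> where C: "C > 0" "\<delta> > 0"
    "\<And>c n k. 0 < c \<Longrightarrow> c \<le> \<delta> \<Longrightarrow> pi ^ 2 / 6 / c = y_crank n / 2 \<Longrightarrow> (real n - 1 / 24) * c = y_crank n / 2 \<Longrightarrow>
       norm (2 * of_real pi * of_real (crank_moment (2 * k) n / fact (2 * k)) - 
         integral {- pi / 4..pi / 4} (\<lambda>\<psi>. arc_kernel (real n - 1 / 24) (of_real c * cis \<psi>) * (of_real c * cis \<psi>) *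
            ((1 / (of_real c * cis \<psi>)) ^ (2 * k) * (sinc_coeff (2 * k) - (if k = 0 then 0 else (of_real c * cis \<psi>) / 2 * sinc_coeff (2 * k - 2))))))
       \<le> C * (c ^ 3 * sqrt c * arc_int (1 / 2) (y_crank n) + exp (19 / 20 * y_crank n)) * (2 * sqrt 2 / c) ^ (2 * k)"
    using crank_moment_arc_bound by blast
  define a where "a = (2 * pi) ^ (2 * k) * xi k / (2 * fact (2 * k))"
  define b where "b = (if k = 0 then 0 else (2 * pi) ^ (2 * (k - 1)) * xi (k - 1) / (2 * fact (2 * (k - 1))))"
  have ab: "sinc_coeff (2 * k) = of_real a" "k \<noteq> 0 \<Longrightarrow> sinc_coeff (2 * k - 2) = of_real b"
    using sinc_coeff_xi[of k] sinc_coeff_xi[of "k - 1"] by (auto simp: a_def b_def right_diff_distrib')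
  show ?thesis
  proof (rule that[of "fact (2 * k) / (2 * pi) * (C * (2 * sqrt 2) ^ (2 * k))" \<delta>])
    fix c :: real and n :: nat
    assume c: "0 < c" "c \<le> \<delta>" and y: "pi ^ 2 / 6 / c = y_crank n / 2" "(real n - 1 / 24) * c = y_crank n / 2"
    define Y where "Y = y_crank n"
    define I where "I = {- pi / 4..pi / 4}"
    define s where "s = sqrt c / sqrt (2 * pi) * (1 / c) ^ (2 * k)"
    define E where "E = (\<lambda>\<psi>. of_real (s * (a * c) * exp (Y * cos \<psi>)) * cis ((3 / 2 - 2 * real k) * \<psi>) - 
        of_real (s * (b / 2 * c ^ 2) * exp (Y * cos \<psi>)) * cis ((5 / 2 - 2 * real k) * \<psi>))"
    have RE: "arc_kernel (real n - 1 / 24) (of_real c * cis \<psi>) * (of_real c * cis \<psi>) *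
            ((1 / (of_real c * cis \<psi>)) ^ (2 * k) * (sinc_coeff (2 * k) - (if k = 0 then 0 else (of_real c * cis \<psi>) / 2 * sinc_coeff (2 * k - 2)))) = E \<psi>"
      if "\<psi> \<in> I" for \<psi>
    proof -
      have K: "arc_kernel (real n - 1 / 24) (of_real c * cis \<psi>) = of_real (sqrt c * exp (Y * cos \<psi>) / sqrt (2 * pi)) * cis (\<psi> / 2)"
        unfolding Y_def using c y that by (intro arc_kernel_cis) (auto simp: I_def)
      have p: "(1 / (of_real c * cis \<psi>)) ^ (2 * k) = of_real ((1 / c) ^ (2 * k)) * cis (- (2 * real k * \<psi>))"
      proof -
        have "1 / (of_real c * cis \<psi>) = of_real (1 / c) * cis (- \<psi>)"
          unfolding cis_inverse[symmetric] by (simp add: divide_inverse)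
        moreover have "cis (- \<psi>) ^ (2 * k) = cis (- (2 * real k * \<psi>))" by (simp add: Complex.DeMoivre)
        ultimately show ?thesis by (simp only: power_mult_distrib of_real_power)
      qed
      have i: "sinc_coeff (2 * k) - (if k = 0 then 0 else (of_real c * cis \<psi>) / 2 * sinc_coeff (2 * k - 2)) = 
         of_real a - of_real (c * b / 2) * cis \<psi>"
        using ab by (auto simp: b_def)
      have c1: "cis (\<psi> / 2) * cis \<psi> * cis (- (2 * real k * \<psi>)) = cis ((3 / 2 - 2 * real k) * \<psi>)"
        by (simp add: cis_mult algebra_simps)
      have c2: "cis ((3 / 2 - 2 * real k) * \<psi>) * cis \<psi> = cis ((5 / 2 - 2 * real k) * \<psi>)"
        by (simp add: cis_mult algebra_simps)
      have "of_real (sqrt c * exp (Y * cos \<psi>) / sqrt (2 * pi)) * cis (\<psi> / 2) * (of_real c * cis \<psi>) * 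
        (of_real ((1 / c) ^ (2 * k)) * cis (- (2 * real k * \<psi>)) * (of_real a - of_real (c * b / 2) * cis \<psi>)) = 
        of_real (s * c * exp (Y * cos \<psi>)) * (cis (\<psi> / 2) * cis \<psi> * cis (- (2 * real k * \<psi>))) * (of_real a - of_real (c * b / 2) * cis \<psi>)"
        by (simp add: s_def mult_ac)
      also have "\<dots> = of_real (s * c * exp (Y * cos \<psi>)) * of_real a * cis ((3 / 2 - 2 * real k) * \<psi>) - 
        of_real (s * c * exp (Y * cos \<psi>)) * of_real (c * b / 2) * (cis ((3 / 2 - 2 * real k) * \<psi>) * cis \<psi>)"
      proof -
        have "X * z * (A - B * u) = X * A * z - X * B * (z * u)" for X z A B u :: complex
          by (simp add: algebra_simps)
        thus ?thesis unfolding c1 .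
      qed
      also have "\<dots> = E \<psi>" unfolding c2 E_def by (simp add: power2_eq_square mult_ac)
      finally show ?thesis unfolding K p i .
    qed
    have "E integrable_on I" unfolding E_def I_def
      by (intro integrable_continuous_real continuous_intros)
    hence "Re (integral I E) = integral I (Re \<circ> E)"
      by (intro integral_linear[symmetric] bounded_linear_Re)
    also have "Re \<circ> E = (\<lambda>\<psi>. s * (a * c) * (cos ((2 * real k - 3 / 2) * \<psi>) * exp (Y * cos \<psi>)) - 
        s * (b / 2 * c ^ 2) * (cos ((2 * real k - 5 / 2) * \<psi>) * exp (Y * cos \<psi>)))"
    proof
      fix \<psi> :: real
      have e: "cos ((3 / 2 - 2 * real k) * \<psi>) = cos ((2 * real k - 3 / 2) * \<psi>)"
           "cos ((5 / 2 - 2 * real k) * \<psi>) = cos ((2 * real k - 5 / 2) * \<psi>)"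
        by (subst cos_minus[symmetric], simp add: algebra_simps)+
      show "(Re \<circ> E) \<psi> = s * (a * c) * (cos ((2 * real k - 3 / 2) * \<psi>) * exp (Y * cos \<psi>)) - 
        s * (b / 2 * c ^ 2) * (cos ((2 * real k - 5 / 2) * \<psi>) * exp (Y * cos \<psi>))"
        unfolding e[symmetric] by (simp add: E_def mult_ac)
    qed
    also have "integral I \<dots> = s * (a * c) * arc_int (2 * real k - 3 / 2) Y - s * (b / 2 * c ^ 2) * arc_int (2 * real k - 5 / 2) Y"
      unfolding arc_int_def I_def
      by (intro integral_unique has_integral_diff has_integral_mult_right integrable_integral arc_int_integrable)
    finally have ReE: "Re (integral I E) = s * (a * c) * arc_int (2 * real k - 3 / 2) Y - s * (b / 2 * c ^ 2) * arc_int (2 * real k - 5 / 2) Y" .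
    define M where "M = crank_moment (2 * k) n"
    have "norm (2 * of_real pi * of_real (M / fact (2 * k)) - integral I E) \<le> 
       C * (c ^ 3 * sqrt c * arc_int (1 / 2) Y + exp (19 / 20 * Y)) * (2 * sqrt 2 / c) ^ (2 * k)"
      using C(3)[OF c y, of k] integral_cong[of I, OF RE] unfolding M_def Y_def I_def by simp
    moreover have "\<bar>Re (2 * of_real pi * of_real (M / fact (2 * k)) - integral I E)\<bar> \<le> norm (2 * of_real pi * of_real (M / fact (2 * k)) - integral I E)"
      by (rule abs_Re_le_cmod)
    moreover have "Re (2 * of_real pi * of_real (M / fact (2 * k)) - integral I E) = 2 * pi / fact (2 * k) * 
       (M - fact (2 * k) / (2 * pi) * Re (integral I E))"
    proof -
      have "2 * of_real pi * of_real (M / fact (2 * k)) = complex_of_real (2 * pi * (M / fact (2 * k)))" by simp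
      moreover have "2 * pi * (M / f) - r = 2 * pi / f * (M - f / (2 * pi) * r)" if "f \<noteq> 0" for f r :: real
        using that by (simp add: field_simps)
      from this[of "fact (2 * k)" "Re (integral I E)"] 
      have "2 * pi * (M / fact (2 * k)) - Re (integral I E) = 2 * pi / fact (2 * k) * (M - fact (2 * k) / (2 * pi) * Re (integral I E))" by simp
      ultimately show ?thesis by (simp only: minus_complex.simps Re_complex_of_real)
    qed
    ultimately have "\<bar>2 * pi / fact (2 * k) * (M - fact (2 * k) / (2 * pi) * Re (integral I E))\<bar> \<le> 
       C * (c ^ 3 * sqrt c * arc_int (1 / 2) Y + exp (19 / 20 * Y)) * (2 * sqrt 2 / c) ^ (2 * k)" by simp
    hence "fact (2 * k) / (2 * pi) * \<bar>2 * pi / fact (2 * k) * (M - fact (2 * k) / (2 * pi) * Re (integral I E))\<bar> \<le> 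
       fact (2 * k) / (2 * pi) * (C * (c ^ 3 * sqrt c * arc_int (1 / 2) Y + exp (19 / 20 * Y)) * (2 * sqrt 2 / c) ^ (2 * k))"
      by (rule mult_left_mono) simp
    hence "\<bar>M - fact (2 * k) / (2 * pi) * Re (integral I E)\<bar> \<le> 
       fact (2 * k) / (2 * pi) * (C * (c ^ 3 * sqrt c * arc_int (1 / 2) Y + exp (19 / 20 * Y)) * (2 * sqrt 2 / c) ^ (2 * k))"
      by (simp add: abs_mult)
    also have "\<dots> = fact (2 * k) / (2 * pi) * (C * (2 * sqrt 2) ^ (2 * k)) * (c ^ 3 * sqrt c * arc_int (1 / 2) Y + exp (19 / 20 * Y)) * (1 / c) ^ (2 * k)"
      by (simp add: power_divide)
    also have "Re (integral I E) = s * (a * c * arc_int (2 * real k - 3 / 2) Y - (if k = 0 then 0 else b / 2 * c ^ 2 * arc_int (2 * real k - 5 / 2) Y))"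
      unfolding ReE by (auto simp: right_diff_distrib b_def)
    also have "(if k = 0 then 0 else b / 2 * c ^ 2 * arc_int (2 * real k - 5 / 2) Y) = 
       (if k = 0 then 0 else (2 * pi) ^ (2 * (k - 1)) * xi (k - 1) / (2 * fact (2 * (k - 1))) / 2 * c ^ 2 * arc_int (2 * real k - 5 / 2) Y)"
      by (simp add: b_def)
    finally show "\<bar>crank_moment (2 * k) n - fact (2 * k) / (2 * pi) * (sqrt c / sqrt (2 * pi) * (1 / c) ^ (2 * k) * 
          ((2 * pi) ^ (2 * k) * xi k / (2 * fact (2 * k)) * c * arc_int (2 * real k - 3 / 2) (y_crank n) - 
           (if k = 0 then 0 else (2 * pi) ^ (2 * (k - 1)) * xi (k - 1) / (2 * fact (2 * (k - 1))) / 2 * c ^ 2 * arc_int (2 * real k - 5 / 2) (y_crank n))))\<bar>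
       \<le> fact (2 * k) / (2 * pi) * (C * (2 * sqrt 2) ^ (2 * k)) * (c ^ 3 * sqrt c * arc_int (1 / 2) (y_crank n) + exp (19 / 20 * y_crank n)) * (1 / c) ^ (2 * k)"
      unfolding s_def a_def M_def Y_def .
  qed (use C in auto)
qed

text \<open>The powers of 2 pi cancel because 1 / c = sqrt D / (2 pi). The quotient (2k)! / (2k -
  2)! = 2k (2k - 1), the minus sign of the correction and c^2 = 4 pi^2 / D turn
  \<open>xi (k - 1)\<close> into \<open>xi' k\<close>.\<close>

lemma crank_main_term_eq:
  assumes "D > 0" and c: "c = 2 * pi / sqrt D"
  shows "fact (2 * k) / (2 * pi) * (sqrt c / sqrt (2 * pi) * (1 / c) ^ (2 * k) * 
          ((2 * pi) ^ (2 * k) * xi k / (2 * fact (2 * k)) * c * u - 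
           (if k = 0 then 0 else (2 * pi) ^ (2 * (k - 1)) * xi (k - 1) / (2 * fact (2 * (k - 1))) / 2 * c ^ 2 * v)))
    = D powr (real k - 3 / 4) * (xi k / 2 * u + xi' k / (2 * pi * sqrt D) * v)"
proof -
  have D: "D powr (real k - 3 / 4) = D ^ k / (sqrt D * sqrt (sqrt D))"
  proof -
    have "D powr (real k - 3 / 4) = D powr real k / (D powr (1 / 2) * D powr (1 / 4))"
      by (simp add: powr_diff flip: powr_add)
    also have "D powr (1 / 4) = (D powr (1 / 2)) powr (1 / 2)" by (simp add: powr_powr)
    finally show ?thesis using assms(1) by (simp add: powr_realpow powr_half_sqrt)
  qed
  have sc: "sqrt c / sqrt (2 * pi) = 1 / sqrt (sqrt D)"
    unfolding c by (simp add: real_sqrt_divide)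
  have ck: "(1 / c) ^ (2 * k) = D ^ k / (2 * pi) ^ (2 * k)"
    using assms by (simp add: power_divide power_mult)
  have xi0: "(2 * pi) ^ (2 * (k - 1)) * xi (k - 1) / (2 * fact (2 * (k - 1))) / 2 * c ^ 2 * fact (2 * k) / (2 * pi) ^ (2 * k) = - xi' k / D" if "k \<noteq> 0"
  proof -
    obtain j where j: "k = Suc j" using \<open>k \<noteq> 0\<close> by (cases k) auto
    have f: "fact (2 * k) = (2 * real k) * (2 * real k - 1) * fact (2 * (k - 1))"
      by (simp add: j algebra_simps)
    have p: "(2 * pi) ^ (2 * k) = (2 * pi) ^ (2 * (k - 1)) * (2 * pi) ^ 2" by (simp add: j power2_eq_square)
    have c2: "c ^ 2 = (2 * pi) ^ 2 / D" using assms by (simp add: power_divide)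
    have "xi' k = - (1 / 4) * (2 * real k) * (2 * real k - 1) * xi (k - 1)" using that by (simp add: xi'_def)
    moreover have "q * x / (2 * g) / 2 * (p / D) * (A * B * g) / (q * p) = - (- (1 / 4) * A * B * x) / D"
      if "q \<noteq> 0" "g \<noteq> 0" "p \<noteq> 0" for q x g p A B :: real using that by simp
    ultimately show ?thesis unfolding f p c2 by simp
  qed
  define w where "w = sqrt D"
  define S where "S = sqrt w"
  have w: "w > 0" "S > 0" "D = w * w" using assms by (auto simp: w_def S_def)
  have T1: "F / (2 * pi) * (1 / S * (E / P) * (P * x / (2 * F) * c * u)) = E / (w * S) * (x / 2 * u)"
    if "F > 0" "P > 0" for F P x E using that w unfolding c w_def[symmetric] by (simp add: field_simps)
  have T2: "F / (2 * pi) * (1 / S * (E / P) * (b * v)) = - E / (w * S) * (x / (2 * pi * w) * v)"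
    if "F > 0" "P > 0" "b * F / P = - x / D" for F P x E b
  proof -
    have "F / (2 * pi) * (1 / S * (E / P) * (b * v)) = 1 / (2 * pi) * (1 / S) * E * v * (b * F / P)" by (simp add: mult_ac)
    also have "\<dots> = 1 / (2 * pi) * (1 / S) * E * v * (- x / (w * w))" unfolding that(3) w(3) ..
    finally show ?thesis using w by (simp add: field_simps)
  qed
  show ?thesis
  proof (cases "k = 0")
    case True
    thus ?thesis using T1[of "fact (2 * k)" "(2 * pi) ^ (2 * k)" "D ^ k" "xi k"]
      unfolding D sc ck by (simp add: xi'_def w_def S_def)
  next
    case False
    have "fact (2 * k) / (2 * pi) * (1 / S * (D ^ k / (2 * pi) ^ (2 * k)) * ((2 * pi) ^ (2 * k) * xi k / (2 * fact (2 * k)) * c * u -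
         (2 * pi) ^ (2 * (k - 1)) * xi (k - 1) / (2 * fact (2 * (k - 1))) / 2 * c ^ 2 * v)) = 
       D ^ k / (w * S) * (xi k / 2 * u) - (- (D ^ k) / (w * S) * (xi' k / (2 * pi * w) * v))"
      unfolding right_diff_distrib
      by (intro arg_cong2[where f = "(-)"] T1 T2) (use xi0[OF False] in auto)
    thus ?thesis using False unfolding D sc ck by (simp add: w_def S_def ring_distribs)
  qed
qed

text \<open>Both sides are expanded to two terms. The second coefficient \<nu>^2 - 1/4 is 2 + 2k (2k
  - 3) for the order 2k - 3/2 and 2 for the order 3/2; the excess 2k (2k - 3) is matched by the
  summand -3 (2k)(2k - 3) \<open>xi k\<close> of \<open>xi_tilde k\<close>.\<close>

lemma bessel_arc_asymp:
  "(\<lambda>y. xi k / 2 * arc_int (2 * real k - 3 / 2) y + xi' k / (12 * y) * arc_int (2 * real k - 5 / 2) y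
       - (pi * xi k * bessel_I (3 / 2) y + xi_tilde k * (pi / (6 * y)) * bessel_I (1 / 2) y))
     \<in> O[at_top](\<lambda>y. exp y * y powr (- 5 / 2))"
proof -
  let ?G = "\<lambda>y::real. exp y * y powr (- 5 / 2)"
  let ?m = "\<lambda>y::real. sqrt (2 * pi / y) * exp y"
  have cst: "(\<lambda>y. c * f y) \<in> O[at_top](?G)" if "f \<in> O[at_top](?G)" for c and f :: "real \<Rightarrow> real"
    using that by (cases "c = 0") auto
  have "2 * real k - 3 / 2 + 1 / 2 = of_int (2 * int k - 1)" "2 * real k - 5 / 2 + 1 / 2 = of_int (2 * int k - 2)" by simp_all
  hence Z: "2 * real k - 3 / 2 + 1 / 2 \<in> \<int>" "2 * real k - 5 / 2 + 1 / 2 \<in> \<int>" by (metis Ints_of_int)+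
  have 1: "(\<lambda>y. arc_int (2 * real k - 3 / 2) y - arc_main (2 * real k - 3 / 2) y) \<in> O[at_top](?G)"
    by (rule arc_int_asymp[OF Z(1)])
  have 2: "(\<lambda>y. 1 / y * (arc_int (2 * real k - 5 / 2) y - arc_main (2 * real k - 5 / 2) y)) \<in> O[at_top](?G)"
  proof -
    have "(\<lambda>y::real. 1 / y) \<in> O[at_top](\<lambda>_. 1)" by real_asymp
    hence "(\<lambda>y. 1 / y * (arc_int (2 * real k - 5 / 2) y - arc_main (2 * real k - 5 / 2) y)) \<in> O[at_top](\<lambda>y. 1 * ?G y)"
      by (rule landau_o.big.mult[OF _ arc_int_asymp[OF Z(2)]])
    thus ?thesis by simp
  qed
  have 3: "(\<lambda>y. ?m y / y ^ 2) \<in> O[at_top](?G)" by real_asymp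
  \<comment> \<open>This and the next estimate dispose of the parts of sinh and cosh with exp (-
    y).\<close>
  have 4: "(\<lambda>y::real. sqrt (2 / (pi * y)) * exp (- y) * (1 + 1 / y)) \<in> O[at_top](?G)" by real_asymp
  have 5: "(\<lambda>y::real. 1 / y * (sqrt (2 / (pi * y)) * exp (- y))) \<in> O[at_top](?G)" by real_asymp
  let ?q = "((2 * real k - 5 / 2) ^ 2 - 1 / 4) / 2"
  have sum: "(\<lambda>y. xi k / 2 * (arc_int (2 * real k - 3 / 2) y - arc_main (2 * real k - 3 / 2) y)
     + xi' k / 12 * (1 / y * (arc_int (2 * real k - 5 / 2) y - arc_main (2 * real k - 5 / 2) y))
     + (- xi' k / 12 * ?q) * (?m y / y ^ 2)
     + (- pi * xi k / 2) * (sqrt (2 / (pi * y)) * exp (- y) * (1 + 1 / y))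
     + (xi_tilde k * pi / 12) * (1 / y * (sqrt (2 / (pi * y)) * exp (- y)))) \<in> O[at_top](?G)"
    by (intro sum_in_bigo cst 1 2 3 4 5)
  have ev: "\<forall>\<^sub>F y in at_top. xi k / 2 * arc_int (2 * real k - 3 / 2) y + xi' k / (12 * y) * arc_int (2 * real k - 5 / 2) y
       - (pi * xi k * bessel_I (3 / 2) y + xi_tilde k * (pi / (6 * y)) * bessel_I (1 / 2) y) = 
     xi k / 2 * (arc_int (2 * real k - 3 / 2) y - arc_main (2 * real k - 3 / 2) y)
     + xi' k / 12 * (1 / y * (arc_int (2 * real k - 5 / 2) y - arc_main (2 * real k - 5 / 2) y))
     + (- xi' k / 12 * ?q) * (?m y / y ^ 2)
     + (- pi * xi k / 2) * (sqrt (2 / (pi * y)) * exp (- y) * (1 + 1 / y))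
     + (xi_tilde k * pi / 12) * (1 / y * (sqrt (2 / (pi * y)) * exp (- y)))"
    using eventually_gt_at_top[of "0::real"]
  proof eventually_elim
    case (elim y)
    define m where "m = sqrt (2 * pi / y) * exp y"
    define l where "l = sqrt (2 / (pi * y)) * exp (- y)"
    have sq: "sqrt (2 / (pi * y)) = sqrt (2 * pi / y) / pi"
    proof -
      have "2 / (pi * y) = (2 * pi / y) / pi ^ 2" using elim by (simp add: power2_eq_square)
      thus ?thesis by (simp only: real_sqrt_divide) simp
    qed
    have I1: "bessel_I (1 / 2) y = m / (2 * pi) - l / 2"
      unfolding bessel_I_half[OF elim] sinh_field_def by (simp add: m_def l_def sq right_diff_distrib diff_divide_distrib)
    have I3: "bessel_I (3 / 2) y = m / (2 * pi) * (1 - 1 / y) + l / 2 * (1 + 1 / y)"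
      unfolding bessel_I_three_halves[OF elim] sinh_field_def cosh_field_def
    proof -
      have "r / pi * ((E + F) / 2 - (E - F) / 2 / y) = r * E / (2 * pi) * (1 - 1 / y) + r / pi * F / 2 * (1 + 1 / y)" for r E F
        using elim by (simp add: field_simps)
      thus "sqrt (2 / (pi * y)) * ((exp y + exp (- y)) / 2 - (exp y - exp (- y)) / 2 / y) = m / (2 * pi) * (1 - 1 / y) + l / 2 * (1 + 1 / y)"
        unfolding m_def l_def sq .
    qed
    have A1: "arc_main (2 * real k - 3 / 2) y = m * (1 - (2 + 2 * real k * (2 * real k - 3)) / (2 * y))"
      unfolding arc_main_def m_def by (simp add: power2_eq_square algebra_simps)
    have A2: "arc_main (2 * real k - 5 / 2) y = m * (1 - ?q / y)"
      unfolding arc_main_def m_def by simp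
    have xt: "xi_tilde k = - 3 * (2 * real k) * (2 * real k - 3) * xi k + xi' k" by (simp add: xi_tilde_def)
    show ?case unfolding I1 I3 A1 A2 m_def[symmetric] l_def[symmetric] xt using elim
      by (simp add: field_simps power2_eq_square)
  qed
  show ?thesis unfolding landau_o.big.in_cong[OF ev] by (rule sum)
qed

section \<open>Orders of growth in n\<close>

lemma y_crank_at_top: "filterlim y_crank at_top sequentially"
  unfolding y_crank_def by real_asymp

lemma powr_24_bigo: "(\<lambda>n. (24 * real n - 1) powr b) \<in> O(\<lambda>n. real n powr b)"
  by real_asymp

lemma y_crank_powr_bigo: "(\<lambda>n. y_crank n powr b) \<in> O(\<lambda>n. real n powr (b / 2))"
  unfolding y_crank_def by real_asymp

lemma arc_int_half_bigo: "arc_int (1 / 2) \<in> O[at_top](\<lambda>y. exp y * y powr (- 1 / 2))"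
proof -
  have "(\<lambda>y. arc_int (1 / 2) y - sqrt (2 * pi / y) * exp y) \<in> O[at_top](\<lambda>y. exp y * y powr (-5/2))"
    by (rule arc_int_half_asymp)
  also have "(\<lambda>y::real. exp y * y powr (-5/2)) \<in> O[at_top](\<lambda>y. exp y * y powr (-1/2))" by real_asymp
  finally have 1: "(\<lambda>y. arc_int (1 / 2) y - sqrt (2 * pi / y) * exp y) \<in> O[at_top](\<lambda>y. exp y * y powr (-1/2))" .
  have 2: "(\<lambda>y::real. sqrt (2 * pi / y) * exp y) \<in> O[at_top](\<lambda>y. exp y * y powr (-1/2))" by real_asymp
  from sum_in_bigo(1)[OF 1 2] show ?thesis by simp
qed

text \<open>The contribution of the vertical segment is exponentially smaller than the error
  term.\<close>

lemma exp_y_crank_bigo: 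
  "(\<lambda>n. exp (19 / 20 * y_crank n)) \<in> O(\<lambda>n. real n powr (- 2) * exp (y_crank n))"
  unfolding y_crank_def by real_asymp

theorem theorem1p1:
  fixes k :: nat
  shows "(\<lambda>n. crank_moment (2 * k) n
            - (pi * xi k * (24 * real n - 1) powr (real k - 3 / 4) * bessel_I (3 / 2) (y_crank n)
               + xi_tilde k * (24 * real n - 1) powr (real k - 5 / 4) * bessel_I (1 / 2) (y_crank n)))
         \<in> O(\<lambda>n. real n powr (real k - 7 / 4) * real n powr (- 1 / 4) * exp (y_crank n))"
proof -
  define D where "D = (\<lambda>n. 24 * real n - 1)"
  \<comment> \<open>Solves pi^2 / (6 c) = (n - 1/24) c, the saddle point equation of the exponent;
    the common value is y / 2.\<close>
  define c where "c = (\<lambda>n. 2 * pi / sqrt (D n))"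
  define T where "T = (\<lambda>n. real n powr (real k - 7 / 4) * real n powr (- 1 / 4) * exp (y_crank n))"
  define P where "P = (\<lambda>n. D n powr (real k - 3 / 4) * (xi k / 2 * arc_int (2 * real k - 3 / 2) (y_crank n) + 
      xi' k / (12 * y_crank n) * arc_int (2 * real k - 5 / 2) (y_crank n)))"
  define Q where "Q = (\<lambda>y. xi k / 2 * arc_int (2 * real k - 3 / 2) y + xi' k / (12 * y) * arc_int (2 * real k - 5 / 2) y
       - (pi * xi k * bessel_I (3 / 2) y + xi_tilde k * (pi / (6 * y)) * bessel_I (1 / 2) y))"
  have D_pos: "D n > 0" if "n > 0" for n using that by (simp add: D_def)
  have y: "y_crank n = pi / 6 * sqrt (D n)" for n by (simp add: y_crank_def D_def)

  obtain C \<delta> where C: "C > 0" "\<delta> > 0"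
    "\<And>c n. 0 < c \<Longrightarrow> c \<le> \<delta> \<Longrightarrow> pi ^ 2 / 6 / c = y_crank n / 2 \<Longrightarrow> (real n - 1 / 24) * c = y_crank n / 2 \<Longrightarrow>
       \<bar>crank_moment (2 * k) n - fact (2 * k) / (2 * pi) * (sqrt c / sqrt (2 * pi) * (1 / c) ^ (2 * k) * 
          ((2 * pi) ^ (2 * k) * xi k / (2 * fact (2 * k)) * c * arc_int (2 * real k - 3 / 2) (y_crank n) - 
           (if k = 0 then 0 else (2 * pi) ^ (2 * (k - 1)) * xi (k - 1) / (2 * fact (2 * (k - 1))) / 2 * c ^ 2 * arc_int (2 * real k - 5 / 2) (y_crank n))))\<bar>
       \<le> C * (c ^ 3 * sqrt c * arc_int (1 / 2) (y_crank n) + exp (19 / 20 * y_crank n)) * (1 / c) ^ (2 * k)"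
    using crank_moment_approx[where k = k] by blast

  have "(\<lambda>n. crank_moment (2 * k) n - P n) \<in> 
     O(\<lambda>n. (c n ^ 3 * sqrt (c n) * arc_int (1 / 2) (y_crank n) + exp (19 / 20 * y_crank n)) * (1 / c n) ^ (2 * k))"
  proof (rule bigoI[of _ C])
    have "c \<longlonglongrightarrow> 0" unfolding c_def D_def by real_asymp
    hence "\<forall>\<^sub>F n in sequentially. c n < \<delta>" using C(2) by (rule order_tendstoD)
    thus "\<forall>\<^sub>F n in sequentially. norm (crank_moment (2 * k) n - P n) \<le> C * 
       norm ((c n ^ 3 * sqrt (c n) * arc_int (1 / 2) (y_crank n) + exp (19 / 20 * y_crank n)) * (1 / c n) ^ (2 * k))"
      using eventually_gt_at_top[of 0]
    proof eventually_elim
      case (elim n)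
      have Dn: "D n > 0" "sqrt (D n) > 0" using D_pos elim by auto

      have c: "0 < c n" using Dn by (simp add: c_def)
      have y1: "pi ^ 2 / 6 / c n = y_crank n / 2"
        using Dn by (simp add: c_def y power2_eq_square)
      have "(real n - 1 / 24) * c n = D n / 24 * c n" by (simp add: D_def)
      also have "\<dots> = pi / 12 * (D n / sqrt (D n))" by (simp add: c_def)
      also have "D n / sqrt (D n) = sqrt (D n)" using Dn by (intro real_div_sqrt) simp
      also have "pi / 12 * sqrt (D n) = y_crank n / 2" by (simp add: y)
      finally have y2: "(real n - 1 / 24) * c n = y_crank n / 2" .
      have "2 * pi * sqrt (D n) = 12 * y_crank n" by (simp add: y)
      hence "\<bar>crank_moment (2 * k) n - P n\<bar> \<le> C * (c n ^ 3 * sqrt (c n) * arc_int (1 / 2) (y_crank n) + exp (19 / 20 * y_crank n)) * (1 / c n) ^ (2 * k)"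
        using C(3)[OF c less_imp_le[OF elim(1)] y1 y2] 
        unfolding crank_main_term_eq[OF Dn(1), of "c n" k, OF c_def[THEN fun_cong]] P_def by (simp only:)
      also have "\<dots> \<le> \<bar>C * (c n ^ 3 * sqrt (c n) * arc_int (1 / 2) (y_crank n) + exp (19 / 20 * y_crank n)) * (1 / c n) ^ (2 * k)\<bar>"
        by (rule abs_ge_self)
      finally show ?case using C(1) by (simp only: real_norm_def abs_mult abs_of_pos mult.assoc)
    qed
  qed
  \<comment> \<open>c is of order n^(-1/2): c^(7/2) gives n^(-7/4), the arc integral n^(-1/4) exp y,
    and c^(-2k) gives n^k. The product is exactly the admissible error n^(k - 2) exp y.\<close>
  also have "(\<lambda>n. (c n ^ 3 * sqrt (c n) * arc_int (1 / 2) (y_crank n) + exp (19 / 20 * y_crank n)) * (1 / c n) ^ (2 * k)) \<in> O(T)"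
  proof -
    have ck: "(\<lambda>n. (1 / c n) ^ (2 * k)) \<in> O(\<lambda>n. real n powr real k)" 
      unfolding c_def D_def by real_asymp
    have c3: "(\<lambda>n. c n ^ 3 * sqrt (c n)) \<in> O(\<lambda>n. real n powr (- 7 / 4))"
      unfolding c_def D_def by real_asymp
    have ai: "(\<lambda>n. arc_int (1 / 2) (y_crank n)) \<in> O(\<lambda>n. exp (y_crank n) * y_crank n powr (- 1 / 2))"
      by (rule landau_o.big.compose[OF arc_int_half_bigo y_crank_at_top])
    also have "(\<lambda>n. exp (y_crank n) * y_crank n powr (- 1 / 2)) \<in> O(\<lambda>n. exp (y_crank n) * real n powr (- 1 / 2 / 2))"
      by (intro landau_o.big.mult y_crank_powr_bigo) simp
    finally have "(\<lambda>n. c n ^ 3 * sqrt (c n) * arc_int (1 / 2) (y_crank n)) \<in> O(\<lambda>n. real n powr (- 7 / 4) * (exp (y_crank n) * real n powr (- 1 / 2 / 2)))"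
      by (rule landau_o.big.mult[OF c3])
    also have "(\<lambda>n. real n powr (- 7 / 4) * (exp (y_crank n) * real n powr (- 1 / 2 / 2))) = (\<lambda>n. real n powr (- 2) * exp (y_crank n))"
      by (simp add: fun_eq_iff powr_add[symmetric])
    finally have "(\<lambda>n. c n ^ 3 * sqrt (c n) * arc_int (1 / 2) (y_crank n) + exp (19 / 20 * y_crank n)) \<in> O(\<lambda>n. real n powr (- 2) * exp (y_crank n))"
      using exp_y_crank_bigo by (rule sum_in_bigo)
    hence "(\<lambda>n. (c n ^ 3 * sqrt (c n) * arc_int (1 / 2) (y_crank n) + exp (19 / 20 * y_crank n)) * (1 / c n) ^ (2 * k)) \<in> 
       O(\<lambda>n. real n powr (- 2) * exp (y_crank n) * real n powr real k)"
      using ck by (rule landau_o.big.mult)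
    also have "(\<lambda>n. real n powr (- 2) * exp (y_crank n) * real n powr real k) = T"
      by (simp add: T_def fun_eq_iff powr_add[symmetric])
    finally show ?thesis .
  qed
  finally have 1: "(\<lambda>n. crank_moment (2 * k) n - P n) \<in> O(T)" .

  \<comment> \<open>y^(-5/2) is of order n^(-5/4), which together with D^(k - 3/4) again gives n^(k
    - 2).\<close>
  have "(\<lambda>n. Q (y_crank n)) \<in> O(\<lambda>n. exp (y_crank n) * y_crank n powr (- 5 / 2))"
    unfolding Q_def by (rule landau_o.big.compose[OF bessel_arc_asymp y_crank_at_top])
  also have "(\<lambda>n. exp (y_crank n) * y_crank n powr (- 5 / 2)) \<in> O(\<lambda>n. exp (y_crank n) * real n powr (- 5 / 2 / 2))"
    by (intro landau_o.big.mult y_crank_powr_bigo) simp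
  finally have "(\<lambda>n. D n powr (real k - 3 / 4) * Q (y_crank n)) \<in> 
     O(\<lambda>n. real n powr (real k - 3 / 4) * (exp (y_crank n) * real n powr (- 5 / 2 / 2)))"
    unfolding D_def by (rule landau_o.big.mult[OF powr_24_bigo])
  also have "(\<lambda>n. real n powr (real k - 3 / 4) * (exp (y_crank n) * real n powr (- 5 / 2 / 2))) = T"
    by (simp add: T_def fun_eq_iff powr_add[symmetric])
  finally have 2: "(\<lambda>n. D n powr (real k - 3 / 4) * Q (y_crank n)) \<in> O(T)" .

  have ev: "\<forall>\<^sub>F n in sequentially. crank_moment (2 * k) n
            - (pi * xi k * (24 * real n - 1) powr (real k - 3 / 4) * bessel_I (3 / 2) (y_crank n)
               + xi_tilde k * (24 * real n - 1) powr (real k - 5 / 4) * bessel_I (1 / 2) (y_crank n))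
     = (crank_moment (2 * k) n - P n) + D n powr (real k - 3 / 4) * Q (y_crank n)"
    using eventually_gt_at_top[of 0]
  proof eventually_elim
    case (elim n)
    have Dn: "D n > 0" using D_pos elim by auto
    \<comment> \<open>sqrt D = 6 y / pi trades the missing power D^(-1/2) for pi / (6 y), so that
      both Bessel terms share the factor D^(k - 3/4).\<close>
    have "D n powr (real k - 5 / 4) = D n powr (real k - 3 / 4) * D n powr (- (1 / 2))" by (simp flip: powr_add)
    also have "D n powr (- (1 / 2)) = pi / (6 * y_crank n)"
    proof -
      have "D n powr (- (1 / 2)) = inverse (sqrt (D n))" using Dn by (simp only: powr_minus powr_half_sqrt less_imp_le)
      also have "\<dots> = pi / (6 * y_crank n)" by (simp add: y inverse_eq_divide)
      finally show ?thesis .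
    qed
    finally have h: "D n powr (real k - 5 / 4) = D n powr (real k - 3 / 4) * (pi / (6 * y_crank n))" .
    have Dd: "24 * real n - 1 = D n" by (simp add: D_def)
    show ?case unfolding P_def Q_def Dd h by (simp add: algebra_simps)
  qed
  show ?thesis unfolding T_def[symmetric] landau_o.big.in_cong[OF ev] using 1 2 by (rule sum_in_bigo)
qed

end
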